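(* Let $0<\alpha<2$, let $m$ be a $\sigma$-finite measure on a measurable space $(E,\mathscr{B})$, let $M$ be a symmetric $\alpha$-stable random measure on $E$ with control measure $m$, and let $a>0$. Let $f=f_1-f_2$, where $f_1,f_2:[0,a]\times E\to[0,\infty)$ are measurable with respect to the product $\sigma$-field $\mathcal{B}([0,a])\otimes\mathscr{B}$, and suppose there is a set $N\in\mathscr{B}$ with $m(N)=0$ such that for every $x\in E\setminus N$ and $i=1,2$ the function $t\mapsto f_i(t,x)$ is càdlàg and nondecreasing on $[0,a]$. Assume moreover that $$\int_E|f_i(a,x)|^\alpha\,m(dx)<\infty,\qquad i=1,2 .$$ Then the process $$X_t=\int_Ef(t,x)\,M(dx),\qquad t\in[0,a],$$ has a càdlàg modification.
   Context: A symmetric $\alpha$-stable random measure on $E$ with control measure $m$ is a family of real random variables $(M(A))_{A\in\mathcal{E}_0}$, $\mathcal{E}_0=\{A\in\mathscr{B}:m(A)<\infty\}$, such that: (i) for pairwise disjoint $A_1,A_2,\ldots\in\mathcal{E}_0$ the variables $M(A_1),M(A_2),\ldots$ are independent and, if also $m(\bigcup_nA_n)<\infty$, then $M(\bigcup_nA_n)=\sum_nM(A_n)$ a.s.; (ii) for $A\in\mathcal{E}_0$, $\mathbf{E}e^{i\theta M(A)}=\exp\{-m(A)|\theta|^\alpha\}$ for all $\theta\in\mathbb{R}$. For measurable $g:E\to\mathbb{R}$ with $\int_E|g|^\alpha\,dm<\infty$ the integral $\int_Eg(x)\,M(dx)$ is defined in the usual way as the limit in probability of integrals of simple functions approximating $g$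 (in $L^\alpha(E,m)$), where $\int_E\sum_kc_k1_{A_k}\,dM=\sum_kc_kM(A_k)$; it satisfies $\mathbf{E}\exp\{i\int_Eg\,dM\}=\exp\{-\int_E|g|^\alpha\,dm\}$. *)

theory Defs
  imports "HOL-Probability.Probability"
begin

text \<open>
  Throughout, \<open>P\<close> is the underlying probability measure, \<open>m\<close> the control measure
  (\<open>E\<close> is \<open>space m\<close> and its sigma-field is \<open>sets m\<close>), \<open>\<alpha>\<close> the stability index, and
  \<open>M A \<omega>\<close> the value of the random measure on the set \<open>A\<close>. The values of \<open>M\<close> on sets that
  are not measurable, or have infinite control measure, are irrelevant.
\<close>

definition finite_measure_sets :: "'e measure \<Rightarrow> 'e set set" where
  "finite_measure_sets m = {A \<in> sets m. emeasure m A < \<infinity>}"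

definition sas_random_measure ::
  "'w measure \<Rightarrow> real \<Rightarrow> 'e measure \<Rightarrow> ('e set \<Rightarrow> 'w \<Rightarrow> real) \<Rightarrow> bool" where
  "sas_random_measure P \<alpha> m M \<longleftrightarrow>
     (\<forall>A \<in> finite_measure_sets m. M A \<in> borel_measurable P) \<and>
     (\<forall>A :: nat \<Rightarrow> 'e set. range A \<subseteq> finite_measure_sets m \<longrightarrow> disjoint_family A \<longrightarrow>
        prob_space.indep_vars P (\<lambda>_. borel) (\<lambda>n. M (A n)) UNIV \<and>
        (emeasure m (\<Union>n. A n) < \<infinity> \<longrightarrow>
          (AE \<omega> in P. (\<lambda>n. M (A n) \<omega>) sums M (\<Union>n. A n) \<omega>))) \<and>
     (\<forall>A \<in> finite_measure_sets m. \<forall>\<theta> :: real.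
        char (distr P borel (M A)) \<theta> = complex_of_real (exp (- (measure m A * \<bar>\<theta>\<bar> powr \<alpha>))))"

definition conv_in_probability ::
  "'w measure \<Rightarrow> (nat \<Rightarrow> 'w \<Rightarrow> real) \<Rightarrow> ('w \<Rightarrow> real) \<Rightarrow> bool" where
  "conv_in_probability P Z Y \<longleftrightarrow>
     (\<forall>\<epsilon>>0. (\<lambda>n. measure P {\<omega> \<in> space P. \<bar>Z n \<omega> - Y \<omega>\<bar> > \<epsilon>}) \<longlonglongrightarrow> 0)"

text \<open>
  The integral of a simple function, taken along its canonical representation by level sets.
  The level set of the value 0 is left out: it may have infinite control measure.
\<close>

definition simple_stable_integral ::
  "'e measure \<Rightarrow> ('e set \<Rightarrow> 'w \<Rightarrow> real) \<Rightarrow> ('e \<Rightarrow> real) \<Rightarrow> 'w \<Rightarrow> real" where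
  "simple_stable_integral m M s \<omega> =
     (\<Sum>c \<in> s ` space m - {0}. c * M (s -` {c} \<inter> space m) \<omega>)"

definition has_stable_integral ::
  "'w measure \<Rightarrow> real \<Rightarrow> 'e measure \<Rightarrow> ('e set \<Rightarrow> 'w \<Rightarrow> real) \<Rightarrow> ('e \<Rightarrow> real) \<Rightarrow> ('w \<Rightarrow> real) \<Rightarrow> bool"
  where
  "has_stable_integral P \<alpha> m M g Y \<longleftrightarrow>
     g \<in> borel_measurable m \<and>
     (\<integral>\<^sup>+x. ennreal (\<bar>g x\<bar> powr \<alpha>) \<partial>m) < \<infinity> \<and>
     Y \<in> borel_measurable P \<and>
     (\<exists>s :: nat \<Rightarrow> 'e \<Rightarrow> real.
        (\<forall>n. simple_function m (s n)) \<and>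
        (\<forall>n. emeasure m {x \<in> space m. s n x \<noteq> 0} < \<infinity>) \<and>
        (\<lambda>n. \<integral>\<^sup>+x. ennreal (\<bar>s n x - g x\<bar> powr \<alpha>) \<partial>m) \<longlonglongrightarrow> 0 \<and>
        conv_in_probability P (\<lambda>n. simple_stable_integral m M (s n)) Y)"

text \<open>
  A limit in probability is determined only up to almost sure equality, so the integral is a
  chosen version; this is harmless for statements about modifications.
\<close>

definition stable_integral ::
  "'w measure \<Rightarrow> real \<Rightarrow> 'e measure \<Rightarrow> ('e set \<Rightarrow> 'w \<Rightarrow> real) \<Rightarrow> ('e \<Rightarrow> real) \<Rightarrow> 'w \<Rightarrow> real" where
  "stable_integral P \<alpha> m M g = (SOME Y. has_stable_integral P \<alpha> m M g Y)"

definition cadlag_on :: "real \<Rightarrow> real \<Rightarrow> (real \<Rightarrow> real) \<Rightarrow> bool" where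
  "cadlag_on a b h \<longleftrightarrow>
     (\<forall>t. a \<le> t \<and> t < b \<longrightarrow> (h \<longlongrightarrow> h t) (at_right t)) \<and>
     (\<forall>t. a < t \<and> t \<le> b \<longrightarrow> (\<exists>l. (h \<longlongrightarrow> l) (at_left t)))"

definition is_modification ::
  "'w measure \<Rightarrow> 't set \<Rightarrow> ('t \<Rightarrow> 'w \<Rightarrow> real) \<Rightarrow> ('t \<Rightarrow> 'w \<Rightarrow> real) \<Rightarrow> bool" where
  "is_modification P T X Y \<longleftrightarrow>
     (\<forall>t \<in> T. Y t \<in> borel_measurable P \<and> (AE \<omega> in P. X t \<omega> = Y t \<omega>))"

definition has_cadlag_modification ::
  "'w measure \<Rightarrow> real \<Rightarrow> real \<Rightarrow> (real \<Rightarrow> 'w \<Rightarrow> real) \<Rightarrow> bool" where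
  "has_cadlag_modification P a b X \<longleftrightarrow>
     (\<exists>Y. is_modification P {a..b} X Y \<and> (\<forall>\<omega> \<in> space P. cadlag_on a b (\<lambda>t. Y t \<omega>)))"

end

theory Submission
  imports Defs
begin

text \<open>
  Why the process has a modification with regular paths: seen along finitely many times, it is a
  mixture of partial sums of independent variables, and partial sums of centred square integrable
  independent variables stay close to functions whose variation is controlled by the variance.

  Fix finitely many times and approximate the integrands by simple functions of \<open>x\<close>. The process
  becomes \<open>\<Sum>j. (v1 j t - v2 j t) * \<zeta> j\<close> with independent symmetric stable variables \<open>\<zeta> j\<close> and
  nondecreasing weights \<open>v1 j\<close>, \<open>v2 j\<close> with values in \<open>[0,1]\<close>. If a weight function is the
  indicator of \<open>t \<ge> \<tau> j\<close> for every \<open>j\<close>, then one family of weights produces the partial sums of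
  the \<open>\<zeta> j\<close> in the order of the times \<open>\<tau> j\<close>. Following these sums by a step function that is
  reset only when they have moved by more than \<open>e\<close> gives a process within distance \<open>e\<close>; by
  orthogonality the expected sum of its squared jumps is at most the total variance, so its
  expected variation is at most the total variance divided by \<open>e\<close>, however many times there are
  (lemma \<open>step_sum_near_bounded_variation\<close>). The property of lying within \<open>e\<close> of a process with
  expected variation at most \<open>K\<close> survives convex combinations, and a nondecreasing weight with
  values in \<open>[0,1]\<close> is a convex combination of indicators; so the same bound holds for all
  monotone weights (lemma \<open>monotone_sum_near_bounded_variation\<close>).

  Stable variables have infinite variance, so they are truncated at a level \<open>H\<close>. The
  characteristic function bounds the probability that some \<open>\<bar>\<zeta> j\<bar>\<close> exceeds \<open>H\<close> and the sum of the
  truncated second moments, both in terms of \<open>\<sigma> = \<integral> (f1 a + f2 a)\<^sup>\<alpha> dm\<close> alone. Therefore the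
  probability that the process makes \<open>L\<close> successive oscillations larger than \<open>6 * e\<close> is at most
  \<open>\<sigma>\<close> times \<open>C * H powr (- \<alpha>) + 16 * H powr (2 - \<alpha>) / (e\<^sup>2 * L)\<close>
  (lemma \<open>stable_integral_chain_probability\<close>), uniformly over all finite sets of times. Letting
  first \<open>L\<close> and then \<open>H\<close> tend to infinity, almost surely the number of successive oscillations of
  a given size along the dyadic points of \<open>[0,a]\<close> is bounded (lemma \<open>AE_bounded_chains\<close>), which
  means that one-sided limits along the dyadic points exist. The right limits form a cadlag
  process. It agrees with the original process at each time almost surely, because the latter is
  right-continuous in probability by dominated convergence.
\<close>

section \<open>Partial sums lie near processes of bounded variation\<close>

text \<open>
  A variable indexed by \<open>B\<close> has mean zero and is independent of every function of the variables
  indexed by \<open>A\<close>, so that the cross terms vanish; the indices of \<open>B\<close> are moved into \<open>A\<close> one by one.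
  In the application \<open>G\<close> is a function of the past and \<open>B\<close> indexes the summands of the next step.
\<close>

lemma (in prob_space) indep_sum_second_moment:
  fixes \<eta> :: "'i \<Rightarrow> 'a \<Rightarrow> real"
  assumes ind: "indep_vars (\<lambda>_. borel) \<eta> J"
    and sq: "\<And>j. j \<in> J \<Longrightarrow> integrable M (\<lambda>\<omega>. (\<eta> j \<omega>)\<^sup>2)"
    and mean: "\<And>j. j \<in> J \<Longrightarrow> expectation (\<eta> j) = 0"
    and "finite B" "A \<subseteq> J" "B \<subseteq> J" "A \<inter> B = {}"
    and "G \<in> borel_measurable (PiM A (\<lambda>_. borel))"
    and "integrable M (\<lambda>\<omega>. (G (\<lambda>i\<in>A. \<eta> i \<omega>))\<^sup>2)"
  shows "integrable M (\<lambda>\<omega>. (G (\<lambda>i\<in>A. \<eta> i \<omega>) + (\<Sum>j\<in>B. \<eta> j \<omega>))\<^sup>2) \<and>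
    expectation (\<lambda>\<omega>. (G (\<lambda>i\<in>A. \<eta> i \<omega>) + (\<Sum>j\<in>B. \<eta> j \<omega>))\<^sup>2)
      = expectation (\<lambda>\<omega>. (G (\<lambda>i\<in>A. \<eta> i \<omega>))\<^sup>2) + (\<Sum>j\<in>B. expectation (\<lambda>\<omega>. (\<eta> j \<omega>)\<^sup>2))"
  using assms(4-)
proof (induction B arbitrary: A G rule: finite_induct)
  case empty
  then show ?case by simp
next
  case (insert j B)
  define R where "R = (\<lambda>\<omega>. G (\<lambda>i\<in>A. \<eta> i \<omega>))"
  have rv: "\<eta> i \<in> borel_measurable M" if "i \<in> J" for i
    using ind that by (auto simp: indep_vars_def)
  have jJ: "j \<in> J" and jA: "j \<notin> A" using insert by auto
  have [measurable]: "\<eta> j \<in> borel_measurable M" by (rule rv[OF jJ])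
  have iv: "indep_var (PiM A (\<lambda>_. borel)) (\<lambda>\<omega>. \<lambda>i\<in>A. \<eta> i \<omega>) (PiM {j} (\<lambda>_. borel)) (\<lambda>\<omega>. \<lambda>i\<in>{j}. \<eta> i \<omega>)"
    using jJ jA insert.prems by (intro indep_var_restrict[OF ind]) auto
  have "indep_var borel (G \<circ> (\<lambda>\<omega>. \<lambda>i\<in>A. \<eta> i \<omega>)) borel ((\<lambda>y. y j) \<circ> (\<lambda>\<omega>. \<lambda>i\<in>{j}. \<eta> i \<omega>))"
    by (intro indep_var_compose[OF iv]) (use insert.prems in auto)
  then have ivR: "indep_var borel R borel (\<eta> j)"
    by (simp add: comp_def R_def)
  then have [measurable]: "R \<in> borel_measurable M" by (rule indep_var_rv1)
  have R2: "integrable M (\<lambda>\<omega>. (R \<omega>)\<^sup>2)" unfolding R_def by (rule insert.prems(5))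
  have Ri: "integrable M R" and ji: "integrable M (\<eta> j)"
    by (auto intro!: square_integrable_imp_integrable R2 sq jJ)
  have prod: "expectation (\<lambda>\<omega>. R \<omega> * \<eta> j \<omega>) = 0" "integrable M (\<lambda>\<omega>. R \<omega> * \<eta> j \<omega>)"
    using indep_var_lebesgue_integral[OF ivR Ri ji] indep_var_integrable[OF ivR Ri ji] mean[OF jJ]
    by auto
  have sqe: "(R \<omega> + \<eta> j \<omega>)\<^sup>2 = (R \<omega>)\<^sup>2 + (\<eta> j \<omega>)\<^sup>2 + 2 * (R \<omega> * \<eta> j \<omega>)" for \<omega>
    by (simp add: power2_eq_square algebra_simps)
  have i1: "integrable M (\<lambda>\<omega>. (R \<omega> + \<eta> j \<omega>)\<^sup>2)"
    unfolding sqe using R2 sq[OF jJ] prod by auto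
  have e1: "expectation (\<lambda>\<omega>. (R \<omega> + \<eta> j \<omega>)\<^sup>2) = expectation (\<lambda>\<omega>. (R \<omega>)\<^sup>2) + expectation (\<lambda>\<omega>. (\<eta> j \<omega>)\<^sup>2)"
    unfolding sqe using R2 sq[OF jJ] prod by simp
  define G' where "G' y = G (restrict y A) + y j" for y
  have G'm: "G' \<in> borel_measurable (PiM (insert j A) (\<lambda>_. borel))"
    unfolding G'_def using insert.prems
    by (intro borel_measurable_add measurable_compose[OF measurable_restrict_subset])
       (auto intro: measurable_component_singleton)
  have G'e: "G' (\<lambda>i\<in>insert j A. \<eta> i \<omega>) = R \<omega> + \<eta> j \<omega>" for \<omega>
    by (simp add: G'_def R_def restrict_def) (rule arg_cong[where f=G], auto)
  have IH: "integrable M (\<lambda>\<omega>. (R \<omega> + \<eta> j \<omega> + (\<Sum>j\<in>B. \<eta> j \<omega>))\<^sup>2) \<and>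
      expectation (\<lambda>\<omega>. (R \<omega> + \<eta> j \<omega> + (\<Sum>j\<in>B. \<eta> j \<omega>))\<^sup>2)
      = expectation (\<lambda>\<omega>. (R \<omega> + \<eta> j \<omega>)\<^sup>2) + (\<Sum>j\<in>B. expectation (\<lambda>\<omega>. (\<eta> j \<omega>)\<^sup>2))"
    using insert.IH[of "insert j A" G', unfolded G'e] insert.prems(1-3) insert.hyps G'm i1 by blast
  have "R \<omega> + (\<Sum>j\<in>insert j B. \<eta> j \<omega>) = R \<omega> + \<eta> j \<omega> + (\<Sum>j\<in>B. \<eta> j \<omega>)" for \<omega>
    using insert.hyps by simp
  moreover have "(\<Sum>j\<in>insert j B. expectation (\<lambda>\<omega>. (\<eta> j \<omega>)\<^sup>2))
      = expectation (\<lambda>\<omega>. (\<eta> j \<omega>)\<^sup>2) + (\<Sum>j\<in>B. expectation (\<lambda>\<omega>. (\<eta> j \<omega>)\<^sup>2))"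
    using insert.hyps by simp
  moreover have "G (\<lambda>i\<in>A. \<eta> i \<omega>) = R \<omega>" for \<omega>
    by (simp only: R_def)
  ultimately show ?case
    using IH e1 by (simp only: add.assoc simp_thms)
qed

text \<open>
  Resetting only after a deviation larger than \<open>e\<close> makes every jump larger than \<open>e\<close>, so the variation
  is at most the sum of the squared jumps divided by \<open>e\<close>. The value at \<open>k\<close> depends on \<open>S\<close> up to
  \<open>k\<close> only, which makes it independent of later increments.
\<close>

primrec greedy :: "real \<Rightarrow> (nat \<Rightarrow> real) \<Rightarrow> nat \<Rightarrow> real" where
  "greedy e S 0 = S 0"
| "greedy e S (Suc k) = (if \<bar>S (Suc k) - greedy e S k\<bar> \<le> e then greedy e S k else S (Suc k))"

lemma greedy_close: "0 \<le> e \<Longrightarrow> \<bar>S k - greedy e S k\<bar> \<le> e"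
  by (cases k) auto

text \<open>
  There is no cross term, because at each step either the jump or the remaining error is zero.
\<close>

lemma greedy_pythagoras:
  "(S (Suc k) - greedy e S (Suc k))\<^sup>2 + (greedy e S (Suc k) - greedy e S k)\<^sup>2 = (S (Suc k) - greedy e S k)\<^sup>2"
  by auto

lemma greedy_jump: "0 \<le> e \<Longrightarrow> e * \<bar>greedy e S (Suc k) - greedy e S k\<bar> \<le> (greedy e S (Suc k) - greedy e S k)\<^sup>2"
  using mult_right_mono[of e "\<bar>S (Suc k) - greedy e S k\<bar>" "\<bar>S (Suc k) - greedy e S k\<bar>"]
  by (auto simp: power2_eq_square)

lemma greedy_measurable:
  assumes "\<And>i. i \<le> k \<Longrightarrow> (\<lambda>y. S y i) \<in> borel_measurable N"
  shows "(\<lambda>y. greedy e (S y) k) \<in> borel_measurable N"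
  using assms
proof (induction k)
  case (Suc k)
  have [measurable]: "(\<lambda>y. greedy e (S y) k) \<in> borel_measurable N" "(\<lambda>y. S y (Suc k)) \<in> borel_measurable N"
    using Suc by auto
  show ?case by simp
qed simp

lemma greedy_cong: "(\<And>i. i \<le> k \<Longrightarrow> S i = S' i) \<Longrightarrow> greedy e S k = greedy e S' k"
  by (induction k) auto

text \<open>
  Take expectations in \<open>greedy_pythagoras\<close>: the right-hand side is the previous error plus the summands
  that are switched on at the next time, and these are orthogonal to the past. The errors telescope,
  so the squared jumps add up to at most the total variance. That \<open>n\<close> does not occur in the bound
  is what allows infinitely many times later.
\<close>

lemma (in prob_space) step_sum_near_bounded_variation:
  fixes \<eta> :: "'i \<Rightarrow> 'a \<Rightarrow> real" and \<tau> :: "'i \<Rightarrow> nat"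
  assumes ind: "indep_vars (\<lambda>_. borel) \<eta> J" and fin: "finite J"
    and sq: "\<And>j. j \<in> J \<Longrightarrow> integrable M (\<lambda>\<omega>. (\<eta> j \<omega>)\<^sup>2)"
    and mean: "\<And>j. j \<in> J \<Longrightarrow> expectation (\<eta> j) = 0"
    and e: "0 < e"
  shows "\<exists>z. (\<forall>k. z k \<in> borel_measurable M) \<and>
    (\<forall>k\<le>n. \<forall>\<omega>. \<bar>(\<Sum>j\<in>J. of_bool (\<tau> j \<le> k) * \<eta> j \<omega>) - z k \<omega>\<bar> \<le> e) \<and>
    (\<integral>\<^sup>+\<omega>. ennreal (\<Sum>k<n. \<bar>z (Suc k) \<omega> - z k \<omega>\<bar>) \<partial>M) \<le> ennreal ((\<Sum>j\<in>J. expectation (\<lambda>\<omega>. (\<eta> j \<omega>)\<^sup>2)) / e)"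
proof -
  have rv[measurable]: "\<eta> i \<in> borel_measurable M" if "i \<in> J" for i
    using ind that by (auto simp: indep_vars_def)
  define S where "S y k = (\<Sum>j\<in>{j\<in>J. \<tau> j \<le> k}. y j)" for y :: "'i \<Rightarrow> real" and k
  define z where "z k \<omega> = greedy e (S (\<lambda>i. \<eta> i \<omega>)) k" for k \<omega>
  define R where "R k \<omega> = S (\<lambda>i. \<eta> i \<omega>) k - z k \<omega>" for k \<omega>
  define Q where "Q k \<omega> = (\<Sum>i<k. (z (Suc i) \<omega> - z i \<omega>)\<^sup>2)" for k \<omega>
  have Sm[measurable]: "(\<lambda>\<omega>. S (\<lambda>i. \<eta> i \<omega>) k) \<in> borel_measurable M" for k
    unfolding S_def by (intro borel_measurable_sum) auto
  have zm[measurable]: "z k \<in> borel_measurable M" for k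
    unfolding z_def by (rule greedy_measurable) simp
  have Rm[measurable]: "R k \<in> borel_measurable M" for k
    unfolding R_def by simp
  have Rb: "\<bar>R k \<omega>\<bar> \<le> e" for k \<omega>
    unfolding R_def z_def using e by (intro greedy_close) simp
  have R2: "integrable M (\<lambda>\<omega>. (R k \<omega>)\<^sup>2)" for k
    by (rule integrable_const_bound[of _ "e\<^sup>2"]) (use Rb e in \<open>auto simp: abs_le_square_iff[symmetric]\<close>)
  \<comment> \<open>The error \<open>R k\<close> is carried along: whatever a reset removes from it goes into \<open>Q\<close>.\<close>
  have main: "integrable M (Q k) \<and> expectation (\<lambda>\<omega>. (R k \<omega>)\<^sup>2) + expectation (Q k)
      \<le> (\<Sum>j\<in>{j\<in>J. \<tau> j \<le> k}. expectation (\<lambda>\<omega>. (\<eta> j \<omega>)\<^sup>2))" for k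
  proof (induction k)
    case 0
    show ?case by (auto simp: Q_def R_def z_def intro!: sum_nonneg)
  next
    case (Suc k)
    define A where "A = {j\<in>J. \<tau> j \<le> k}"
    define B where "B = {j\<in>J. \<tau> j = Suc k}"
    define G where "G y = S y k - greedy e (S y) k" for y
    have AB: "{j\<in>J. \<tau> j \<le> Suc k} = A \<union> B" "A \<inter> B = {}" "finite A" "finite B" "A \<subseteq> J" "B \<subseteq> J"
      using fin by (auto simp: A_def B_def)
    have Sm': "(\<lambda>y. S y i) \<in> borel_measurable (PiM A (\<lambda>_. borel))" if "i \<le> k" for i
      unfolding S_def using that
      by (intro borel_measurable_sum measurable_component_singleton) (auto simp: A_def)
    have Gm: "G \<in> borel_measurable (PiM A (\<lambda>_. borel))"
      unfolding G_def by (intro borel_measurable_diff greedy_measurable Sm') auto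
    have Se: "S (\<lambda>i\<in>A. \<eta> i \<omega>) i = S (\<lambda>i. \<eta> i \<omega>) i" if "i \<le> k" for i \<omega>
      unfolding S_def using that by (intro sum.cong) (auto simp: A_def)
    have Ge: "G (\<lambda>i\<in>A. \<eta> i \<omega>) = R k \<omega>" for \<omega>
      unfolding G_def R_def z_def by (simp add: Se greedy_cong[of k "S (\<lambda>i\<in>A. \<eta> i \<omega>)" "S (\<lambda>i. \<eta> i \<omega>)"])
    have Sn: "S (\<lambda>i. \<eta> i \<omega>) (Suc k) - z k \<omega> = R k \<omega> + (\<Sum>j\<in>B. \<eta> j \<omega>)" for \<omega>
      unfolding R_def S_def AB(1) using AB(2-4) by (subst sum.union_disjoint) (auto simp: A_def)
    have pyth: "(R (Suc k) \<omega>)\<^sup>2 + (z (Suc k) \<omega> - z k \<omega>)\<^sup>2 = (R k \<omega> + (\<Sum>j\<in>B. \<eta> j \<omega>))\<^sup>2" for \<omega>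
      using greedy_pythagoras[of "S (\<lambda>i. \<eta> i \<omega>)" k e] unfolding Sn[symmetric] by (simp only: R_def z_def)
    note om = indep_sum_second_moment[OF ind sq mean AB(4,5,6,2) Gm, unfolded Ge, OF _ _ R2[of k]]
    have d: "(z (Suc k) \<omega> - z k \<omega>)\<^sup>2 = (R k \<omega> + (\<Sum>j\<in>B. \<eta> j \<omega>))\<^sup>2 - (R (Suc k) \<omega>)\<^sup>2" for \<omega>
      using pyth[of \<omega>] by simp
    have Qs: "Q (Suc k) = (\<lambda>\<omega>. Q k \<omega> + ((R k \<omega> + (\<Sum>j\<in>B. \<eta> j \<omega>))\<^sup>2 - (R (Suc k) \<omega>)\<^sup>2))"
      unfolding Q_def by (auto simp: d)
    have "integrable M (Q (Suc k))"
      unfolding Qs using Suc om R2[of "Suc k"] by auto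
    moreover have "expectation (Q (Suc k)) = expectation (Q k) + (expectation (\<lambda>\<omega>. (R k \<omega>)\<^sup>2)
       + (\<Sum>j\<in>B. expectation (\<lambda>\<omega>. (\<eta> j \<omega>)\<^sup>2))) - expectation (\<lambda>\<omega>. (R (Suc k) \<omega>)\<^sup>2)"
      unfolding Qs using Suc om R2[of "Suc k"] by (simp add: Bochner_Integration.integral_add Bochner_Integration.integral_diff)
    ultimately show ?case
      using Suc unfolding AB(1) A_def[symmetric] by (subst sum.union_disjoint) (auto simp: AB)
  qed
  have Qn: "expectation (Q n) \<le> (\<Sum>j\<in>J. expectation (\<lambda>\<omega>. (\<eta> j \<omega>)\<^sup>2))"
  proof -
    have "expectation (Q n) \<le> expectation (\<lambda>\<omega>. (R n \<omega>)\<^sup>2) + expectation (Q n)" by simp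
    also have "\<dots> \<le> (\<Sum>j\<in>{j\<in>J. \<tau> j \<le> n}. expectation (\<lambda>\<omega>. (\<eta> j \<omega>)\<^sup>2))" using main[of n] by auto
    also have "\<dots> \<le> (\<Sum>j\<in>J. expectation (\<lambda>\<omega>. (\<eta> j \<omega>)\<^sup>2))" using fin by (intro sum_mono2) auto
    finally show ?thesis .
  qed
  have "(\<integral>\<^sup>+\<omega>. ennreal (\<Sum>k<n. \<bar>z (Suc k) \<omega> - z k \<omega>\<bar>) \<partial>M) \<le> (\<integral>\<^sup>+\<omega>. ennreal (Q n \<omega> / e) \<partial>M)"
  proof (intro nn_integral_mono ennreal_leI)
    fix \<omega>
    have "e * (\<Sum>k<n. \<bar>z (Suc k) \<omega> - z k \<omega>\<bar>) \<le> Q n \<omega>"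
      unfolding Q_def sum_distrib_left z_def using e by (intro sum_mono greedy_jump) simp
    then show "(\<Sum>k<n. \<bar>z (Suc k) \<omega> - z k \<omega>\<bar>) \<le> Q n \<omega> / e"
      using e by (simp add: field_simps)
  qed
  also have "\<dots> = ennreal (expectation (\<lambda>\<omega>. Q n \<omega> / e))"
    using main[of n] e by (intro nn_integral_eq_integral) (auto simp: Q_def[abs_def] intro!: divide_nonneg_nonneg sum_nonneg)
  also have "\<dots> \<le> ennreal ((\<Sum>j\<in>J. expectation (\<lambda>\<omega>. (\<eta> j \<omega>)\<^sup>2)) / e)"
    using Qn e by (intro ennreal_leI) (simp add: divide_right_mono)
  finally have V: "(\<integral>\<^sup>+\<omega>. ennreal (\<Sum>k<n. \<bar>z (Suc k) \<omega> - z k \<omega>\<bar>) \<partial>M) \<le> ennreal ((\<Sum>j\<in>J. expectation (\<lambda>\<omega>. (\<eta> j \<omega>)\<^sup>2)) / e)" .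
  have "(\<Sum>j\<in>J. of_bool (\<tau> j \<le> k) * \<eta> j \<omega>) = S (\<lambda>i. \<eta> i \<omega>) k" for k \<omega>
    unfolding S_def sum.inter_filter[OF fin] by (intro sum.cong) auto
  then show ?thesis
    using V Rb unfolding R_def by (intro exI[of _ z]) auto
qed

text \<open>
  A nondecreasing \<open>v j\<close> with values in \<open>[0,1]\<close> is the distribution function of a random switching time:
  it is a mixture of indicators of \<open>\<tau> \<le> k\<close>. The conclusion is preserved when a single \<open>v j\<close> is
  replaced by a mixture, since the mixture of the approximating processes is as close and has at
  most the mixed variation. Starting from indicators, the induction replaces one coordinate after
  the other.
\<close>

lemma (in prob_space) monotone_sum_near_bounded_variation:
  fixes \<eta> :: "'i \<Rightarrow> 'a \<Rightarrow> real" and v :: "'i \<Rightarrow> nat \<Rightarrow> real"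
  assumes ind: "indep_vars (\<lambda>_. borel) \<eta> J" and fin: "finite J"
    and sq: "\<And>j. j \<in> J \<Longrightarrow> integrable M (\<lambda>\<omega>. (\<eta> j \<omega>)\<^sup>2)"
    and mean: "\<And>j. j \<in> J \<Longrightarrow> expectation (\<eta> j) = 0"
    and e: "0 < e"
    and v: "\<And>j. j \<in> J \<Longrightarrow> mono_on {..n} (v j) \<and> v j ` {..n} \<subseteq> {0..1}"
  shows "\<exists>z. (\<forall>k. z k \<in> borel_measurable M) \<and>
    (\<forall>k\<le>n. \<forall>\<omega>. \<bar>(\<Sum>j\<in>J. v j k * \<eta> j \<omega>) - z k \<omega>\<bar> \<le> e) \<and>
    (\<integral>\<^sup>+\<omega>. ennreal (\<Sum>k<n. \<bar>z (Suc k) \<omega> - z k \<omega>\<bar>) \<partial>M) \<le> ennreal ((\<Sum>j\<in>J. expectation (\<lambda>\<omega>. (\<eta> j \<omega>)\<^sup>2)) / e)"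
    (is "?P v")
proof -
  let ?K = "(\<Sum>j\<in>J. expectation (\<lambda>\<omega>. (\<eta> j \<omega>)\<^sup>2)) / e"
  have "?P v" if "finite B" "B \<subseteq> J" "\<And>j. j \<in> B \<Longrightarrow> mono_on {..n} (v j) \<and> v j ` {..n} \<subseteq> {0..1}"
    "\<And>j. j \<in> J - B \<Longrightarrow> \<exists>\<tau>. \<forall>k. v j k = of_bool (\<tau> \<le> k)" for B v
    using that
  proof (induction B arbitrary: v rule: finite_induct)
    case empty
    then have "\<forall>j\<in>J. \<exists>\<tau>. \<forall>k. v j k = of_bool (\<tau> \<le> k)" by simp
    then obtain \<tau> where \<tau>: "\<forall>j\<in>J. \<forall>k. v j k = of_bool (\<tau> j \<le> k)" by metis
    then have eq: "(\<Sum>j\<in>J. v j k * \<eta> j \<omega>) = (\<Sum>j\<in>J. of_bool (\<tau> j \<le> k) * \<eta> j \<omega>)" for k \<omega>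
      by (intro sum.cong) auto
    show ?case unfolding eq by (rule step_sum_near_bounded_variation[OF ind fin sq mean e])
  next
    case (insert i B)
    have iJ: "i \<in> J" using insert by auto
    \<comment> \<open>The remaining mass \<open>1 - v i n\<close> sits at the time \<open>Suc n\<close>, which is beyond the range considered.\<close>
    define w where "w k = (if k \<le> n then v i k else 1)" for k
    define p where "p k = (case k of 0 \<Rightarrow> w 0 | Suc k' \<Rightarrow> w (Suc k') - w k')" for k
    have vi: "mono_on {..n} (v i)" "\<And>k. k \<le> n \<Longrightarrow> 0 \<le> v i k \<and> v i k \<le> 1"
      using insert.prems(2)[of i] by auto
    have p0: "0 \<le> p k" for k
      using vi by (auto simp: p_def w_def mono_on_def split: nat.split)
    have ps: "(\<Sum>\<tau>\<le>k. p \<tau>) = w k" for k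
      by (induction k) (auto simp: p_def)
    have p1: "(\<Sum>\<tau>\<le>Suc n. p \<tau>) = 1" unfolding ps by (simp add: w_def)
    have pv: "(\<Sum>\<tau>\<le>Suc n. p \<tau> * of_bool (\<tau> \<le> k)) = v i k" if "k \<le> n" for k
    proof -
      have "(\<Sum>\<tau>\<le>Suc n. p \<tau> * of_bool (\<tau> \<le> k)) = (\<Sum>\<tau>\<le>k. p \<tau>)"
        using that by (intro sum.mono_neutral_cong_right) auto
      then show ?thesis using that by (simp add: ps w_def)
    qed
    define v' where "v' \<tau> = v(i := (\<lambda>k. of_bool (\<tau> \<le> k)))" for \<tau> :: nat
    have ex: "\<forall>\<tau>. ?P (v' \<tau>)"
    proof (intro allI insert.IH)
      fix \<tau>
      show "B \<subseteq> J" using insert by auto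
      show "mono_on {..n} (v' \<tau> j) \<and> v' \<tau> j ` {..n} \<subseteq> {0..1}" if "j \<in> B" for j
        using insert.prems(2)[of j] insert.hyps that by (auto simp: v'_def)
      show "\<exists>\<sigma>. \<forall>k. v' \<tau> j k = of_bool (\<sigma> \<le> k)" if "j \<in> J - B" for j
        using insert.prems(3)[of j] insert.hyps that by (auto simp: v'_def)
    qed
    then obtain zz where zm: "\<And>\<tau> k. zz \<tau> k \<in> borel_measurable M"
      and zc: "\<And>\<tau> k \<omega>. k \<le> n \<Longrightarrow> \<bar>(\<Sum>j\<in>J. v' \<tau> j k * \<eta> j \<omega>) - zz \<tau> k \<omega>\<bar> \<le> e"
      and zv: "\<And>\<tau>. (\<integral>\<^sup>+\<omega>. ennreal (\<Sum>k<n. \<bar>zz \<tau> (Suc k) \<omega> - zz \<tau> k \<omega>\<bar>) \<partial>M) \<le> ennreal ?K"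
      using choice[OF ex] by blast
    note [measurable] = zm
    define z where "z k \<omega> = (\<Sum>\<tau>\<le>Suc n. p \<tau> * zz \<tau> k \<omega>)" for k \<omega>
    have "z k \<in> borel_measurable M" for k unfolding z_def by measurable
    moreover have "\<bar>(\<Sum>j\<in>J. v j k * \<eta> j \<omega>) - z k \<omega>\<bar> \<le> e" if k: "k \<le> n" for k \<omega>
    proof -
      have "(\<Sum>\<tau>\<le>Suc n. p \<tau> * (\<Sum>j\<in>J. v' \<tau> j k * \<eta> j \<omega>)) = (\<Sum>j\<in>J. (\<Sum>\<tau>\<le>Suc n. p \<tau> * v' \<tau> j k) * \<eta> j \<omega>)"
        unfolding sum_distrib_left sum_distrib_right by (subst sum.swap) (simp add: mult.assoc)
      also have "\<dots> = (\<Sum>j\<in>J. v j k * \<eta> j \<omega>)"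
      proof (intro sum.cong refl arg_cong2[where f="(*)"])
        fix j
        show "(\<Sum>\<tau>\<le>Suc n. p \<tau> * v' \<tau> j k) = v j k"
        proof (cases "j = i")
          case True
          then show ?thesis using pv[OF k] by (simp add: v'_def)
        next
          case False
          then show ?thesis using p1 by (simp add: v'_def sum_distrib_right[symmetric] del: sum.atMost_Suc)
        qed
      qed
      finally have "(\<Sum>j\<in>J. v j k * \<eta> j \<omega>) - z k \<omega> = (\<Sum>\<tau>\<le>Suc n. p \<tau> * ((\<Sum>j\<in>J. v' \<tau> j k * \<eta> j \<omega>) - zz \<tau> k \<omega>))"
        by (simp add: z_def right_diff_distrib sum_subtractf del: sum.atMost_Suc)
      also have "\<bar>\<dots>\<bar> \<le> (\<Sum>\<tau>\<le>Suc n. p \<tau> * e)"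
        using zc[OF k] p0 by (intro order_trans[OF sum_abs] sum_mono) (auto simp: abs_mult intro: mult_left_mono)
      also have "\<dots> = e" using p1 by (simp add: sum_distrib_right[symmetric] del: sum.atMost_Suc)
      finally show ?thesis .
    qed
    moreover have "(\<integral>\<^sup>+\<omega>. ennreal (\<Sum>k<n. \<bar>z (Suc k) \<omega> - z k \<omega>\<bar>) \<partial>M) \<le> ennreal ?K"
    proof -
      have "(\<Sum>k<n. \<bar>z (Suc k) \<omega> - z k \<omega>\<bar>) \<le> (\<Sum>\<tau>\<le>Suc n. p \<tau> * (\<Sum>k<n. \<bar>zz \<tau> (Suc k) \<omega> - zz \<tau> k \<omega>\<bar>))" for \<omega>
      proof -
        have "\<bar>z (Suc k) \<omega> - z k \<omega>\<bar> \<le> (\<Sum>\<tau>\<le>Suc n. p \<tau> * \<bar>zz \<tau> (Suc k) \<omega> - zz \<tau> k \<omega>\<bar>)" for k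
        proof -
          have "z (Suc k) \<omega> - z k \<omega> = (\<Sum>\<tau>\<le>Suc n. p \<tau> * (zz \<tau> (Suc k) \<omega> - zz \<tau> k \<omega>))"
            by (simp add: z_def right_diff_distrib sum_subtractf del: sum.atMost_Suc)
          also have "\<bar>\<dots>\<bar> \<le> (\<Sum>\<tau>\<le>Suc n. \<bar>p \<tau> * (zz \<tau> (Suc k) \<omega> - zz \<tau> k \<omega>)\<bar>)" by (rule sum_abs)
          finally show ?thesis using p0 by (simp add: abs_mult del: sum.atMost_Suc)
        qed
        then have "(\<Sum>k<n. \<bar>z (Suc k) \<omega> - z k \<omega>\<bar>) \<le> (\<Sum>k<n. \<Sum>\<tau>\<le>Suc n. p \<tau> * \<bar>zz \<tau> (Suc k) \<omega> - zz \<tau> k \<omega>\<bar>)"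
          by (intro sum_mono)
        also have "\<dots> = (\<Sum>\<tau>\<le>Suc n. p \<tau> * (\<Sum>k<n. \<bar>zz \<tau> (Suc k) \<omega> - zz \<tau> k \<omega>\<bar>))"
          unfolding sum_distrib_left by (rule sum.swap)
        finally show ?thesis .
      qed
      then have "(\<integral>\<^sup>+\<omega>. ennreal (\<Sum>k<n. \<bar>z (Suc k) \<omega> - z k \<omega>\<bar>) \<partial>M)
          \<le> (\<integral>\<^sup>+\<omega>. (\<Sum>\<tau>\<le>Suc n. ennreal (p \<tau>) * ennreal (\<Sum>k<n. \<bar>zz \<tau> (Suc k) \<omega> - zz \<tau> k \<omega>\<bar>)) \<partial>M)"
        using p0 by (intro nn_integral_mono)
          (simp add: sum_ennreal ennreal_mult[symmetric] sum_nonneg ennreal_leI del: sum.atMost_Suc)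
      also have "\<dots> = (\<Sum>\<tau>\<le>Suc n. ennreal (p \<tau>) * (\<integral>\<^sup>+\<omega>. ennreal (\<Sum>k<n. \<bar>zz \<tau> (Suc k) \<omega> - zz \<tau> k \<omega>\<bar>) \<partial>M))"
        by (subst nn_integral_sum) (simp_all add: nn_integral_cmult del: sum.atMost_Suc)
      also have "\<dots> \<le> (\<Sum>\<tau>\<le>Suc n. ennreal (p \<tau>) * ennreal ?K)"
        by (intro sum_mono mult_left_mono zv) simp
      also have "\<dots> = ennreal ?K"
        using p0 p1 by (simp add: sum_distrib_right[symmetric] sum_ennreal del: sum.atMost_Suc)
      finally show ?thesis .
    qed
    ultimately show ?case by blast
  qed
  from this[of J v] show ?thesis using v fin by blast
qed

section \<open>Chains of oscillations\<close>

text \<open>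
  Chains measure oscillation without reference to a level. A function has one-sided limits along \<open>D\<close>
  as soon as for each \<open>e > 0\<close> the length of its chains is bounded.
\<close>

definition has_chain :: "('t::order \<Rightarrow> real) \<Rightarrow> 't set \<Rightarrow> real \<Rightarrow> nat \<Rightarrow> bool" where
  "has_chain x D e L \<longleftrightarrow>
     (\<exists>c. (\<forall>i\<le>L. c i \<in> D) \<and> (\<forall>i<L. c i < c (Suc i) \<and> e < \<bar>x (c (Suc i)) - x (c i)\<bar>))"

lemma has_chain_perturb:
  assumes "has_chain x D e L" and "\<And>t. t \<in> D \<Longrightarrow> \<bar>x t - y t\<bar> \<le> d" and "e' + 2 * d \<le> e"
  shows "has_chain y D e' L"
proof -
  from assms(1) obtain c where c: "\<forall>i\<le>L. c i \<in> D" "\<forall>i<L. c i < c (Suc i) \<and> e < \<bar>x (c (Suc i)) - x (c i)\<bar>"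
    unfolding has_chain_def by blast
  have "e' < \<bar>y (c (Suc i)) - y (c i)\<bar>" if "i < L" for i
    using assms(2)[of "c i"] assms(2)[of "c (Suc i)"] assms(3) c that
    by (force simp: abs_le_iff less_Suc_eq_le[symmetric])
  with c show ?thesis unfolding has_chain_def by blast
qed

lemma has_chain_variation:
  assumes "has_chain x {..n} e L"
  shows "real L * e \<le> (\<Sum>k<n. \<bar>x (Suc k) - x k\<bar>)"
proof -
  from assms obtain c where c: "\<forall>i\<le>L. c i \<in> {..n}" "\<forall>i<L. c i < c (Suc i) \<and> e < \<bar>x (c (Suc i)) - x (c i)\<bar>"
    unfolding has_chain_def by blast
  have "real i * e \<le> (\<Sum>k<c i. \<bar>x (Suc k) - x k\<bar>)" if "i \<le> L" for i
    using that
  proof (induction i)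
    case 0
    show ?case by (simp add: sum_nonneg)
  next
    case (Suc i)
    have lt: "c i < c (Suc i)" and gt: "e < \<bar>x (c (Suc i)) - x (c i)\<bar>" using c(2) Suc.prems by auto
    have "x (c (Suc i)) - x (c i) = (\<Sum>k=c i..<c (Suc i). x (Suc k) - x k)"
      using lt by (simp add: sum_Suc_diff')
    then have "\<bar>x (c (Suc i)) - x (c i)\<bar> \<le> (\<Sum>k=c i..<c (Suc i). \<bar>x (Suc k) - x k\<bar>)"
      by (simp add: sum_abs)
    moreover have "(\<Sum>k<c (Suc i). \<bar>x (Suc k) - x k\<bar>)
        = (\<Sum>k<c i. \<bar>x (Suc k) - x k\<bar>) + (\<Sum>k=c i..<c (Suc i). \<bar>x (Suc k) - x k\<bar>)"
      using lt by (simp add: lessThan_atLeast0 sum.atLeastLessThan_concat)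
    ultimately show ?case using Suc gt by (simp add: algebra_simps)
  qed
  from this[of L] have "real L * e \<le> (\<Sum>k<c L. \<bar>x (Suc k) - x k\<bar>)" by simp
  also have "\<dots> \<le> (\<Sum>k<n. \<bar>x (Suc k) - x k\<bar>)"
    using c(1) by (intro sum_mono2) auto
  finally show ?thesis .
qed

text \<open>
  Only the values of \<open>c\<close> up to \<open>L\<close> matter, which leaves countably many choices of \<open>c\<close>.
\<close>

lemma has_chain_measurable:
  assumes "countable D" and [measurable]: "\<And>t. t \<in> D \<Longrightarrow> X t \<in> borel_measurable M"
  shows "{\<omega> \<in> space M. has_chain (\<lambda>t. X t \<omega>) D e L} \<in> sets M"
proof -
  have eq: "has_chain x D e L \<longleftrightarrow> (\<exists>c\<in>PiE {..L} (\<lambda>_. D). (\<forall>i\<in>{..<L}. c i < c (Suc i) \<and> e < \<bar>x (c (Suc i)) - x (c i)\<bar>))" for x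
  proof
    assume "has_chain x D e L"
    then obtain c where c: "\<forall>i\<le>L. c i \<in> D" "\<forall>i<L. c i < c (Suc i) \<and> e < \<bar>x (c (Suc i)) - x (c i)\<bar>"
      unfolding has_chain_def by blast
    then show "\<exists>c\<in>PiE {..L} (\<lambda>_. D). (\<forall>i\<in>{..<L}. c i < c (Suc i) \<and> e < \<bar>x (c (Suc i)) - x (c i)\<bar>)"
      by (intro bexI[of _ "restrict c {..L}"]) auto
  next
    assume "\<exists>c\<in>PiE {..L} (\<lambda>_. D). (\<forall>i\<in>{..<L}. c i < c (Suc i) \<and> e < \<bar>x (c (Suc i)) - x (c i)\<bar>)"
    then show "has_chain x D e L" unfolding has_chain_def by (auto simp: PiE_iff)
  qed
  have cnt: "countable (PiE {..L} (\<lambda>_. D))" using assms(1) by (intro countable_PiE) auto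
  show ?thesis unfolding eq
    by (intro sets.sets_Collect_countable_Ex'[OF _ cnt] sets.sets_Collect_finite_All)
      (auto simp: PiE_iff intro!: borel_measurable_less)
qed

text \<open>
  If no variable exceeds \<open>H\<close>, the sum coincides with the truncated one, which is within \<open>2 * e\<close> of a
  difference of two processes of small expected variation. Then \<open>L\<close> oscillations of size \<open>5 * e\<close>
  force this difference to have variation at least \<open>L * e\<close>, and Markov's inequality applies.
\<close>

lemma (in prob_space) has_chain_probability_bound:
  fixes \<zeta> :: "'i \<Rightarrow> 'a \<Rightarrow> real" and v1 v2 :: "'i \<Rightarrow> nat \<Rightarrow> real"
  assumes ind: "indep_vars (\<lambda>_. borel) \<zeta> J" and fin: "finite J"
    and mean: "\<And>j. j \<in> J \<Longrightarrow> expectation (\<lambda>\<omega>. \<zeta> j \<omega> * of_bool (\<bar>\<zeta> j \<omega>\<bar> \<le> H)) = 0"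
    and e: "0 < e" and L: "0 < L"
    and v1: "\<And>j. j \<in> J \<Longrightarrow> mono_on {..n} (v1 j) \<and> v1 j ` {..n} \<subseteq> {0..1}"
    and v2: "\<And>j. j \<in> J \<Longrightarrow> mono_on {..n} (v2 j) \<and> v2 j ` {..n} \<subseteq> {0..1}"
  shows "prob {\<omega> \<in> space M. has_chain (\<lambda>k. \<Sum>j\<in>J. (v1 j k - v2 j k) * \<zeta> j \<omega>) {..n} (5 * e) L}
    \<le> (\<Sum>j\<in>J. prob {\<omega> \<in> space M. H < \<bar>\<zeta> j \<omega>\<bar>})
      + 2 * (\<Sum>j\<in>J. expectation (\<lambda>\<omega>. (\<zeta> j \<omega>)\<^sup>2 * of_bool (\<bar>\<zeta> j \<omega>\<bar> \<le> H))) / (e\<^sup>2 * real L)"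
proof -
  have zm[measurable]: "\<zeta> i \<in> borel_measurable M" if "i \<in> J" for i
    using ind that by (auto simp: indep_vars_def)
  define \<eta> where "\<eta> j \<omega> = \<zeta> j \<omega> * of_bool (\<bar>\<zeta> j \<omega>\<bar> \<le> H)" for j \<omega>
  have ind': "indep_vars (\<lambda>_. borel) \<eta> J"
    unfolding \<eta>_def by (rule indep_vars_compose2[OF ind]) simp
  have sqe: "(\<eta> j \<omega>)\<^sup>2 = (\<zeta> j \<omega>)\<^sup>2 * of_bool (\<bar>\<zeta> j \<omega>\<bar> \<le> H)" for j \<omega>
    by (simp add: \<eta>_def power_mult_distrib)
  have sq: "integrable M (\<lambda>\<omega>. (\<eta> j \<omega>)\<^sup>2)" if "j \<in> J" for j
  proof (rule integrable_const_bound[of _ "H\<^sup>2"])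
    show "AE \<omega> in M. norm ((\<eta> j \<omega>)\<^sup>2) \<le> H\<^sup>2"
      by (auto simp: sqe abs_le_square_iff[symmetric] of_bool_def)
    show "(\<lambda>\<omega>. (\<eta> j \<omega>)\<^sup>2) \<in> borel_measurable M" using that unfolding \<eta>_def by measurable
  qed
  have mean': "expectation (\<eta> j) = 0" if "j \<in> J" for j
    using mean[OF that] by (simp add: \<eta>_def[abs_def])
  define K where "K = (\<Sum>j\<in>J. expectation (\<lambda>\<omega>. (\<eta> j \<omega>)\<^sup>2))"
  have K0: "0 \<le> K" unfolding K_def by (intro sum_nonneg) simp
  obtain z1 where z1: "\<And>k. z1 k \<in> borel_measurable M"
    "\<And>k \<omega>. k \<le> n \<Longrightarrow> \<bar>(\<Sum>j\<in>J. v1 j k * \<eta> j \<omega>) - z1 k \<omega>\<bar> \<le> e"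
    "(\<integral>\<^sup>+\<omega>. ennreal (\<Sum>k<n. \<bar>z1 (Suc k) \<omega> - z1 k \<omega>\<bar>) \<partial>M) \<le> ennreal (K / e)"
    using monotone_sum_near_bounded_variation[OF ind' fin sq mean' e, of n v1] v1 unfolding K_def by blast
  obtain z2 where z2: "\<And>k. z2 k \<in> borel_measurable M"
    "\<And>k \<omega>. k \<le> n \<Longrightarrow> \<bar>(\<Sum>j\<in>J. v2 j k * \<eta> j \<omega>) - z2 k \<omega>\<bar> \<le> e"
    "(\<integral>\<^sup>+\<omega>. ennreal (\<Sum>k<n. \<bar>z2 (Suc k) \<omega> - z2 k \<omega>\<bar>) \<partial>M) \<le> ennreal (K / e)"
    using monotone_sum_near_bounded_variation[OF ind' fin sq mean' e, of n v2] v2 unfolding K_def by blast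
  note [measurable] = z1(1) z2(1)
  define U where "U \<omega> = ennreal (\<Sum>k<n. \<bar>z1 (Suc k) \<omega> - z1 k \<omega>\<bar>) + ennreal (\<Sum>k<n. \<bar>z2 (Suc k) \<omega> - z2 k \<omega>\<bar>)" for \<omega>
  have Um[measurable]: "U \<in> borel_measurable M" unfolding U_def by measurable
  define E1 where "E1 = {\<omega> \<in> space M. 1 \<le> ennreal (1 / (real L * e)) * U \<omega>}"
  define E2 where "E2 = (\<Union>j\<in>J. {\<omega> \<in> space M. H < \<bar>\<zeta> j \<omega>\<bar>})"
  have E1m: "E1 \<in> sets M" unfolding E1_def by measurable
  have E2m: "{\<omega> \<in> space M. H < \<bar>\<zeta> j \<omega>\<bar>} \<in> sets M" if "j \<in> J" for j
    using that by measurable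
  have E2s: "E2 \<in> sets M" unfolding E2_def using fin E2m by (intro sets.finite_UN) auto
  have "emeasure M E1 \<le> ennreal (1 / (real L * e)) * (\<integral>\<^sup>+\<omega>. U \<omega> \<partial>M)"
    unfolding E1_def using nn_integral_Markov_inequality[of U "space M" M] by simp
  also have "(\<integral>\<^sup>+\<omega>. U \<omega> \<partial>M) \<le> ennreal (K / e) + ennreal (K / e)"
    unfolding U_def by (subst nn_integral_add) (auto intro!: add_mono z1(3) z2(3))
  also have "ennreal (K / e) + ennreal (K / e) = ennreal (2 * K / e)"
    using K0 e by (simp add: ennreal_plus[symmetric] del: ennreal_plus)
  also have "ennreal (1 / (real L * e)) * ennreal (2 * K / e) = ennreal (2 * K / (e\<^sup>2 * real L))"
    using K0 e L by (simp add: ennreal_mult[symmetric] power2_eq_square mult_ac)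
  finally have p1: "prob E1 \<le> 2 * K / (e\<^sup>2 * real L)"
    using K0 e by (simp add: emeasure_eq_measure mult_left_mono)
  have p2: "prob E2 \<le> (\<Sum>j\<in>J. prob {\<omega> \<in> space M. H < \<bar>\<zeta> j \<omega>\<bar>})"
    unfolding E2_def using E2m fin by (intro finite_measure_subadditive_finite) auto
  have sub: "{\<omega> \<in> space M. has_chain (\<lambda>k. \<Sum>j\<in>J. (v1 j k - v2 j k) * \<zeta> j \<omega>) {..n} (5 * e) L} \<subseteq> E1 \<union> E2"
  proof safe
    fix \<omega> assume \<omega>: "\<omega> \<in> space M" and ch: "has_chain (\<lambda>k. \<Sum>j\<in>J. (v1 j k - v2 j k) * \<zeta> j \<omega>) {..n} (5 * e) L"
      and "\<omega> \<notin> E2"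
    then have "\<zeta> j \<omega> = \<eta> j \<omega>" if "j \<in> J" for j using that by (auto simp: E2_def \<eta>_def)
    then have Xe: "(\<Sum>j\<in>J. (v1 j k - v2 j k) * \<zeta> j \<omega>) = (\<Sum>j\<in>J. v1 j k * \<eta> j \<omega>) - (\<Sum>j\<in>J. v2 j k * \<eta> j \<omega>)" for k
      by (simp add: left_diff_distrib sum_subtractf)
    \<comment> \<open>Both ends of an oscillation move by at most \<open>2 * e\<close>, and \<open>5 * e - 2 * (2 * e) = e\<close>.\<close>
    have "has_chain (\<lambda>k. z1 k \<omega> - z2 k \<omega>) {..n} e L"
    proof (rule has_chain_perturb[OF ch, of _ "2 * e"])
      fix k assume "k \<in> {..n}"
      then show "\<bar>(\<Sum>j\<in>J. (v1 j k - v2 j k) * \<zeta> j \<omega>) - (z1 k \<omega> - z2 k \<omega>)\<bar> \<le> 2 * e"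
        unfolding Xe using z1(2)[of k \<omega>] z2(2)[of k \<omega>] by (simp add: abs_le_iff)
    qed simp
    then have "real L * e \<le> (\<Sum>k<n. \<bar>(z1 (Suc k) \<omega> - z2 (Suc k) \<omega>) - (z1 k \<omega> - z2 k \<omega>)\<bar>)"
      by (rule has_chain_variation)
    also have "\<dots> \<le> (\<Sum>k<n. \<bar>z1 (Suc k) \<omega> - z1 k \<omega>\<bar> + \<bar>z2 (Suc k) \<omega> - z2 k \<omega>\<bar>)"
      by (intro sum_mono) linarith
    finally have "ennreal (real L * e) \<le> U \<omega>"
      unfolding U_def by (simp add: sum.distrib ennreal_plus[symmetric] sum_nonneg ennreal_leI del: ennreal_plus)
    then have "ennreal (1 / (real L * e)) * ennreal (real L * e) \<le> ennreal (1 / (real L * e)) * U \<omega>"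
      by (intro mult_left_mono) auto
    then show "\<omega> \<in> E1"
      using \<omega> e L by (simp add: E1_def ennreal_mult[symmetric])
  qed
  have "prob {\<omega> \<in> space M. has_chain (\<lambda>k. \<Sum>j\<in>J. (v1 j k - v2 j k) * \<zeta> j \<omega>) {..n} (5 * e) L} \<le> prob (E1 \<union> E2)"
    using sub E1m E2s by (intro finite_measure_mono) auto
  also have "\<dots> \<le> prob E1 + prob E2"
    using E1m E2s by (rule measure_Un_le)
  finally show ?thesis using p1 p2 unfolding K_def sqe by simp
qed

section \<open>Tails and truncated moments of symmetric stable variables\<close>

text \<open>
  The parameter \<open>\<mu>\<close> is the power \<open>\<alpha>\<close> of the usual scale parameter, and is therefore additive over
  independent sums.
\<close>

definition (in prob_space) sas_variable :: "real \<Rightarrow> real \<Rightarrow> ('a \<Rightarrow> real) \<Rightarrow> bool" where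
  "sas_variable \<alpha> \<mu> Y \<longleftrightarrow> Y \<in> borel_measurable M \<and>
     (\<forall>\<theta>. char (distr M borel Y) \<theta> = complex_of_real (exp (- (\<mu> * \<bar>\<theta>\<bar> powr \<alpha>))))"

text \<open>
  From \<open>1 - cos y = 2 * sin\<^sup>2 (y / 2)\<close> and \<open>sin u \<ge> u / 2\<close> for small \<open>u \<ge> 0\<close>. It turns values of a characteristic
  function at single frequencies into moment and tail bounds.
\<close>

lemma one_minus_cos_ge:
  fixes y :: real
  assumes "\<bar>y\<bar> \<le> 1"
  shows "y\<^sup>2 / 8 \<le> 1 - cos y"
proof -
  have sin: "u / 2 \<le> sin u" if u: "0 \<le> u" "u \<le> 1/2" for u :: real
  proof (cases "u = 0")
    case False
    have "\<bar>sin u - (\<Sum>m<3. sin_coeff m * u ^ m)\<bar> \<le> inverse (fact 3) * \<bar>u\<bar> ^ 3"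
      by (rule Maclaurin_sin_bound)
    then have "\<bar>sin u - u\<bar> \<le> u ^ 3 / 6"
      using u by (simp add: numeral_3_eq_3 sin_coeff_def fact_numeral)
    then have "u - u ^ 3 / 6 \<le> sin u" by linarith
    moreover have "u ^ 3 \<le> u * 1"
      unfolding power3_eq_cube mult.assoc using u by (intro mult_left_mono mult_le_one) auto
    ultimately show ?thesis using u by simp
  qed simp
  have "(\<bar>y\<bar> / 2 / 2)\<^sup>2 \<le> (sin (\<bar>y\<bar> / 2))\<^sup>2"
    using assms by (intro power_mono sin) auto
  moreover have "1 - cos y = 2 * (sin (\<bar>y\<bar> / 2))\<^sup>2"
    using cos_double_sin[of "\<bar>y\<bar> / 2"] by simp
  moreover have "(\<bar>y\<bar> / 2 / 2)\<^sup>2 = y\<^sup>2 / 16" by (simp add: power2_eq_square)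
  ultimately show ?thesis by simp
qed

lemma (in prob_space) integrable_one_minus_cos:
  fixes Y :: "'a \<Rightarrow> real"
  shows "Y \<in> borel_measurable M \<Longrightarrow> integrable M (\<lambda>\<omega>. 1 - cos (\<theta> * Y \<omega>))"
proof (rule integrable_const_bound[of _ 2])
  have "\<bar>1 - cos u\<bar> \<le> 2" for u :: real
    using cos_le_one[of u] cos_ge_minus_one[of u] by linarith
  then show "AE \<omega> in M. norm (1 - cos (\<theta> * Y \<omega>)) \<le> 2" by simp
qed simp

lemma (in prob_space) sas_variable_cos:
  assumes "sas_variable \<alpha> \<mu> Y"
  shows "expectation (\<lambda>\<omega>. 1 - cos (\<theta> * Y \<omega>)) \<le> \<mu> * \<bar>\<theta>\<bar> powr \<alpha>"
proof -
  have [measurable]: "Y \<in> borel_measurable M" using assms by (simp add: sas_variable_def)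
  have int: "integrable M (\<lambda>\<omega>. iexp (\<theta> * Y \<omega>))"
    by (rule integrable_const_bound[of _ 1]) auto
  have "complex_of_real (exp (- (\<mu> * \<bar>\<theta>\<bar> powr \<alpha>))) = (CLINT \<omega>|M. iexp (\<theta> * Y \<omega>))"
    using assms unfolding sas_variable_def char_def by (subst (asm) integral_distr) auto
  then have "exp (- (\<mu> * \<bar>\<theta>\<bar> powr \<alpha>)) = Re (CLINT \<omega>|M. iexp (\<theta> * Y \<omega>))"
    by (metis Re_complex_of_real)
  also have "\<dots> = expectation (\<lambda>\<omega>. cos (\<theta> * Y \<omega>))"
    using integral_Re[OF int] by (simp add: Re_exp)
  finally have "expectation (\<lambda>\<omega>. cos (\<theta> * Y \<omega>)) = exp (- (\<mu> * \<bar>\<theta>\<bar> powr \<alpha>))" ..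
  moreover have "integrable M (\<lambda>\<omega>. cos (\<theta> * Y \<omega>))"
    by (rule integrable_const_bound[of _ 1]) auto
  ultimately have "expectation (\<lambda>\<omega>. 1 - cos (\<theta> * Y \<omega>)) = 1 - exp (- (\<mu> * \<bar>\<theta>\<bar> powr \<alpha>))"
    by (simp add: prob_space)
  also have "\<dots> \<le> \<mu> * \<bar>\<theta>\<bar> powr \<alpha>"
    using exp_ge_add_one_self[of "- (\<mu> * \<bar>\<theta>\<bar> powr \<alpha>)"] by simp
  finally show ?thesis .
qed


text \<open>
  Test with the frequency \<open>1 / H\<close>: where \<open>\<bar>Y\<bar> \<le> H\<close>, the function \<open>1 - cos (Y / H)\<close> dominates a multiple of
  \<open>Y\<^sup>2 / H\<^sup>2\<close>.
\<close>

lemma (in prob_space) sas_variable_truncated_second_moment: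
  assumes Y: "sas_variable \<alpha> \<mu> Y" and H: "0 < H"
  shows "expectation (\<lambda>\<omega>. (Y \<omega>)\<^sup>2 * of_bool (\<bar>Y \<omega>\<bar> \<le> H)) \<le> 8 * \<mu> * H powr (2 - \<alpha>)"
proof -
  have [measurable]: "Y \<in> borel_measurable M" using Y by (simp add: sas_variable_def)
  have "(Y \<omega>)\<^sup>2 * of_bool (\<bar>Y \<omega>\<bar> \<le> H) \<le> 8 * H\<^sup>2 * (1 - cos (1 / H * Y \<omega>))" for \<omega>
  proof (cases "\<bar>Y \<omega>\<bar> \<le> H")
    case True
    then have "(1 / H * Y \<omega>)\<^sup>2 / 8 \<le> 1 - cos (1 / H * Y \<omega>)"
      using H by (intro one_minus_cos_ge) (simp add: abs_mult)
    then show ?thesis using H True by (simp add: field_simps)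
  qed (use H in simp)
  then have "expectation (\<lambda>\<omega>. (Y \<omega>)\<^sup>2 * of_bool (\<bar>Y \<omega>\<bar> \<le> H)) \<le> expectation (\<lambda>\<omega>. 8 * H\<^sup>2 * (1 - cos (1 / H * Y \<omega>)))"
  proof (intro integral_mono)
    show "integrable M (\<lambda>\<omega>. (Y \<omega>)\<^sup>2 * of_bool (\<bar>Y \<omega>\<bar> \<le> H))"
      by (rule integrable_const_bound[of _ "H\<^sup>2"]) (auto simp: of_bool_def abs_le_square_iff[symmetric])
    show "integrable M (\<lambda>\<omega>. 8 * H\<^sup>2 * (1 - cos (1 / H * Y \<omega>)))"
      by (intro integrable_mult_right integrable_one_minus_cos) simp
  qed
  also have "\<dots> \<le> 8 * H\<^sup>2 * (\<mu> * \<bar>1 / H\<bar> powr \<alpha>)"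
    using sas_variable_cos[OF Y, of "1 / H"] H by (simp add: mult_left_mono)
  also have "\<dots> = 8 * \<mu> * H powr (2 - \<alpha>)"
    using H by (simp add: powr_divide powr_diff field_simps)
  finally show ?thesis .
qed

text \<open>
  The sum of the geometric series \<open>32 * r + 32 * r\<^sup>2 + \<dots>\<close> with \<open>r = 2 powr (- \<alpha>)\<close>, one term for each dyadic
  shell in the next tail estimate.
\<close>

definition tail_const :: "real \<Rightarrow> real" where
  "tail_const \<alpha> = 32 * (2 powr (-\<alpha>) / (1 - 2 powr (-\<alpha>)))"

lemma tail_const_nonneg: "0 < \<alpha> \<Longrightarrow> 0 \<le> tail_const \<alpha>"
  using powr_less_cancel_iff[of 2 "-\<alpha>" 0] unfolding tail_const_def by (intro mult_nonneg_nonneg divide_nonneg_nonneg) auto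

text \<open>
  On the shell \<open>2 ^ k * H < \<bar>Y\<bar> \<le> 2 ^ (k + 1) * H\<close> the cosine of frequency \<open>1 / (2 ^ (k + 1) * H)\<close> stays
  away from 1, so a single value of the characteristic function controls the shell; the
  probabilities of the shells are dominated by a geometric series.
\<close>

lemma (in prob_space) sas_variable_tail:
  assumes Y: "sas_variable \<alpha> \<mu> Y" and H: "0 < H" and \<alpha>: "0 < \<alpha>"
  shows "prob {\<omega> \<in> space M. H < \<bar>Y \<omega>\<bar>} \<le> tail_const \<alpha> * \<mu> * H powr (-\<alpha>)"
proof -
  have [measurable]: "Y \<in> borel_measurable M" using Y by (simp add: sas_variable_def)
  define r where "r = 2 powr (-\<alpha>)"
  have r: "0 < r" "r < 1" using \<alpha> powr_less_cancel_iff[of 2 "-\<alpha>" 0] by (auto simp: r_def)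
  define A where "A k = {\<omega> \<in> space M. 2 ^ k * H < \<bar>Y \<omega>\<bar> \<and> \<bar>Y \<omega>\<bar> \<le> 2 ^ Suc k * H}" for k :: nat
  have Am[measurable]: "A k \<in> sets M" for k unfolding A_def by measurable
  have pA: "prob (A k) \<le> 32 * \<mu> * H powr (-\<alpha>) * r ^ Suc k" for k
  proof -
    define \<theta> where "\<theta> = 1 / (2 ^ Suc k * H)"
    have \<theta>: "0 < \<theta>" using H by (simp add: \<theta>_def)
    have "indicator (A k) \<omega> \<le> 32 * (1 - cos (\<theta> * Y \<omega>))" for \<omega>
    proof (cases "\<omega> \<in> A k")
      case True
      then have b: "1 / 2 \<le> \<bar>\<theta> * Y \<omega>\<bar>" "\<bar>\<theta> * Y \<omega>\<bar> \<le> 1"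
        using H by (auto simp: A_def \<theta>_def abs_mult field_simps)
      have "(1 / 2)\<^sup>2 \<le> (\<bar>\<theta> * Y \<omega>\<bar>)\<^sup>2" using b by (intro power_mono) auto
      then show ?thesis using one_minus_cos_ge[OF b(2)] True by (simp add: power2_eq_square)
    qed simp
    then have "expectation (indicator (A k)) \<le> expectation (\<lambda>\<omega>. 32 * (1 - cos (\<theta> * Y \<omega>)))"
      by (intro integral_mono integrable_mult_right integrable_one_minus_cos integrable_const_bound[of "indicator (A k)" 1])
         (auto simp: indicator_def)
    also have "\<dots> \<le> 32 * (\<mu> * \<bar>\<theta>\<bar> powr \<alpha>)"
      unfolding integral_mult_right_zero using sas_variable_cos[OF Y, of \<theta>] by (rule mult_left_mono) simp
    also have "\<bar>\<theta>\<bar> powr \<alpha> = H powr (-\<alpha>) * r ^ Suc k"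
    proof -
      have "(2 ^ Suc k :: real) = 2 powr real (Suc k)" by (rule powr_realpow[symmetric]) simp
      then have "\<bar>\<theta>\<bar> = 2 powr - real (Suc k) * H powr -1"
        using H by (simp only: powr_minus) (simp add: \<theta>_def field_simps)
      moreover have "r ^ Suc k = 2 powr (- real (Suc k) * \<alpha>)"
        using r by (subst powr_realpow[symmetric]) (simp_all add: r_def powr_powr algebra_simps)
      moreover have "(2 powr - real (Suc k) * H powr -1) powr \<alpha> = 2 powr (- real (Suc k) * \<alpha>) * H powr (-\<alpha>)"
        by (subst powr_mult) (simp_all only: powr_powr mult_minus_left mult_1_left powr_ge_zero)
      ultimately show ?thesis by (simp only: mult.commute)
    qed
    finally show ?thesis by (simp add: mult_ac)
  qed
  have sm: "summable (\<lambda>k. 32 * \<mu> * H powr (-\<alpha>) * r ^ Suc k)"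
    using r by (intro summable_mult) (simp add: summable_geometric summable_mult)
  have smA: "summable (\<lambda>k. prob (A k))"
    by (rule summable_comparison_test_ev[OF _ sm]) (use pA in auto)
  have "{\<omega> \<in> space M. H < \<bar>Y \<omega>\<bar>} \<subseteq> (\<Union>k. A k)"
  proof safe
    fix \<omega> assume \<omega>: "\<omega> \<in> space M" "H < \<bar>Y \<omega>\<bar>"
    obtain n where n: "\<bar>Y \<omega>\<bar> / H < 2 ^ n" using real_arch_pow[of 2] by auto
    then have ex: "\<exists>n. \<bar>Y \<omega>\<bar> \<le> 2 ^ n * H" using H by (intro exI[of _ n]) (simp add: field_simps)
    define n where "n = (LEAST n. \<bar>Y \<omega>\<bar> \<le> 2 ^ n * H)"
    have n: "\<bar>Y \<omega>\<bar> \<le> 2 ^ n * H" unfolding n_def using ex by (rule LeastI_ex)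
    obtain k where k: "n = Suc k" using n \<omega> by (cases n) auto
    have "\<not> \<bar>Y \<omega>\<bar> \<le> 2 ^ k * H" using not_less_Least[of k "\<lambda>n. \<bar>Y \<omega>\<bar> \<le> 2 ^ n * H"] k unfolding n_def by simp
    with n k \<omega> show "\<omega> \<in> (\<Union>k. A k)" by (intro UN_I[of k]) (auto simp: A_def)
  qed
  then have "prob {\<omega> \<in> space M. H < \<bar>Y \<omega>\<bar>} \<le> prob (\<Union>k. A k)"
    by (intro finite_measure_mono) auto
  also have "\<dots> \<le> (\<Sum>k. prob (A k))"
    using smA by (intro finite_measure_subadditive_countably) auto
  also have "\<dots> \<le> (\<Sum>k. 32 * \<mu> * H powr (-\<alpha>) * r ^ Suc k)"
    by (intro suminf_le pA smA sm)
  also have "\<dots> = 32 * \<mu> * H powr (-\<alpha>) * (r * (1 / (1 - r)))"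
    using r by (simp add: suminf_mult summable_geometric suminf_geometric summable_mult)
  finally show ?thesis unfolding tail_const_def r_def by (simp add: field_simps)
qed

text \<open>
  The characteristic function is even, so by uniqueness \<open>Y\<close> and \<open>- Y\<close> have the same law, and
  a bounded odd function of \<open>Y\<close> has mean zero.
\<close>

lemma (in prob_space) sas_variable_truncated_mean:
  assumes Y: "sas_variable \<alpha> \<mu> Y"
  shows "expectation (\<lambda>\<omega>. Y \<omega> * of_bool (\<bar>Y \<omega>\<bar> \<le> H)) = 0"
proof -
  have [measurable]: "Y \<in> borel_measurable M" using Y by (simp add: sas_variable_def)
  have "char (distr M borel (\<lambda>\<omega>. - Y \<omega>)) = char (distr M borel Y)"
  proof
    fix \<theta>
    have "char (distr M borel (\<lambda>\<omega>. - Y \<omega>)) \<theta> = char (distr M borel Y) (- \<theta>)"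
      by (simp add: char_def integral_distr)
    then show "char (distr M borel (\<lambda>\<omega>. - Y \<omega>)) \<theta> = char (distr M borel Y) \<theta>"
      using Y by (simp add: sas_variable_def)
  qed
  then have eq: "distr M borel (\<lambda>\<omega>. - Y \<omega>) = distr M borel Y"
    by (intro Levy_uniqueness real_distribution_distr) auto
  define g :: "real \<Rightarrow> real" where "g y = y * of_bool (\<bar>y\<bar> \<le> H)" for y
  have [measurable]: "g \<in> borel_measurable borel" unfolding g_def by measurable
  have "expectation (\<lambda>\<omega>. g (Y \<omega>)) = expectation (\<lambda>\<omega>. g (- Y \<omega>))"
    using integral_distr[of "\<lambda>\<omega>. - Y \<omega>" M borel g] integral_distr[of Y M borel g] eq by simp
  also have "\<dots> = - expectation (\<lambda>\<omega>. g (Y \<omega>))"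
    by (simp add: g_def)
  finally show ?thesis by (simp add: g_def)
qed

lemma (in prob_space) sas_variable_scale:
  assumes Y: "sas_variable \<alpha> \<mu> Y"
  shows "sas_variable \<alpha> (\<bar>c\<bar> powr \<alpha> * \<mu>) (\<lambda>\<omega>. c * Y \<omega>)"
proof -
  have [measurable]: "Y \<in> borel_measurable M" using Y by (simp add: sas_variable_def)
  have "char (distr M borel (\<lambda>\<omega>. c * Y \<omega>)) \<theta> = char (distr M borel Y) (c * \<theta>)" for \<theta>
    by (simp add: char_def integral_distr mult_ac)
  then show ?thesis
    using Y by (simp add: sas_variable_def abs_mult powr_mult mult_ac)
qed

lemma (in prob_space) sas_variable_sum:
  assumes ind: "indep_vars (\<lambda>_. borel) Y J" and Y: "\<And>j. j \<in> J \<Longrightarrow> sas_variable \<alpha> (\<mu> j) (Y j)"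
  shows "sas_variable \<alpha> (\<Sum>j\<in>J. \<mu> j) (\<lambda>\<omega>. \<Sum>j\<in>J. Y j \<omega>)"
proof -
  have "(\<lambda>\<omega>. \<Sum>j\<in>J. Y j \<omega>) \<in> borel_measurable M"
    using Y by (intro borel_measurable_sum) (auto simp: sas_variable_def)
  moreover have "(\<Prod>j\<in>J. char (distr M borel (Y j)) \<theta>) = complex_of_real (exp (- ((\<Sum>j\<in>J. \<mu> j) * \<bar>\<theta>\<bar> powr \<alpha>)))" for \<theta>
  proof (cases "finite J")
    case True
    have "(\<Prod>j\<in>J. char (distr M borel (Y j)) \<theta>) = (\<Prod>j\<in>J. complex_of_real (exp (- (\<mu> j * \<bar>\<theta>\<bar> powr \<alpha>))))"
      using Y by (intro prod.cong) (auto simp: sas_variable_def)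
    also have "\<dots> = complex_of_real (\<Prod>j\<in>J. exp (- (\<mu> j * \<bar>\<theta>\<bar> powr \<alpha>)))" by simp
    also have "(\<Prod>j\<in>J. exp (- (\<mu> j * \<bar>\<theta>\<bar> powr \<alpha>))) = exp (\<Sum>j\<in>J. - (\<mu> j * \<bar>\<theta>\<bar> powr \<alpha>))"
      using True by (rule exp_sum[symmetric])
    finally show ?thesis by (simp add: sum_negf sum_distrib_right)
  qed simp
  ultimately show ?thesis
    unfolding sas_variable_def using char_distr_sum[OF ind] by simp
qed

section \<open>Finite additivity and integrals of simple functions\<close>

locale stable_measure = prob_space P
  for P :: "'w measure" and \<alpha> :: real and m :: "'e measure" and M :: "'e set \<Rightarrow> 'w \<Rightarrow> real" +
  assumes alpha_pos: "0 < \<alpha>" and random_measure: "sas_random_measure P \<alpha> m M"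
begin

abbreviation "E\<^sub>0 \<equiv> finite_measure_sets m"

lemma random_measure_measurable [measurable]: "A \<in> E\<^sub>0 \<Longrightarrow> M A \<in> borel_measurable P"
  using random_measure by (simp add: sas_random_measure_def)

lemma random_measure_sas: "A \<in> E\<^sub>0 \<Longrightarrow> sas_variable \<alpha> (measure m A) (M A)"
  using random_measure by (simp add: sas_random_measure_def sas_variable_def)

lemma random_measure_sums:
  "range A \<subseteq> E\<^sub>0 \<Longrightarrow> disjoint_family A \<Longrightarrow> emeasure m (\<Union>n. A n) < \<infinity> \<Longrightarrow>
    AE \<omega> in P. (\<lambda>n. M (A n) \<omega>) sums M (\<Union>n. A n) \<omega>"
  using random_measure unfolding sas_random_measure_def by blast

lemma random_measure_indep_sequence:
  "range A \<subseteq> E\<^sub>0 \<Longrightarrow> disjoint_family A \<Longrightarrow> indep_vars (\<lambda>_. borel) (\<lambda>n::nat. M (A n)) UNIV"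
  using random_measure unfolding sas_random_measure_def by blast

lemma empty_finite_measure_set [simp]: "{} \<in> E\<^sub>0"
  by (simp add: finite_measure_sets_def)

text \<open>
  Additivity for the constant sequence of empty sets: a series with constant terms converges only if
  the terms are zero.
\<close>

lemma random_measure_empty: "AE \<omega> in P. M {} \<omega> = 0"
proof -
  have "AE \<omega> in P. (\<lambda>n::nat. M {} \<omega>) sums M {} \<omega>"
    using random_measure_sums[of "\<lambda>_. {}"] by (simp add: disjoint_family_on_def)
  then show ?thesis
  proof eventually_elim
    case (elim \<omega>)
    then have "(\<lambda>n::nat. M {} \<omega>) \<longlonglongrightarrow> 0" by (intro summable_LIMSEQ_zero) (rule sums_summable)
    then show ?case by (simp add: LIMSEQ_const_iff)
  qed
qed

lemma random_measure_finite_union: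
  assumes "finite J" and B: "\<And>j. j \<in> J \<Longrightarrow> B j \<in> E\<^sub>0" and disj: "disjoint_family_on B J"
  shows "AE \<omega> in P. M (\<Union>j\<in>J. B j) \<omega> = (\<Sum>j\<in>J. M (B j) \<omega>)"
proof -
  obtain h where h: "bij_betw h {0..<card J} J"
    using ex_bij_betw_nat_finite[OF assms(1)] by blast
  define A where "A i = (if i < card J then B (h i) else {})" for i
  have hJ: "h i \<in> J" if "i < card J" for i using h that by (auto simp: bij_betw_def)
  have A: "range A \<subseteq> E\<^sub>0" using B hJ by (auto simp: A_def)
  have dA: "disjoint_family A"
    unfolding disjoint_family_on_def
  proof (intro ballI impI)
    fix i k :: nat assume "i \<noteq> k"
    show "A i \<inter> A k = {}"
    proof (cases "i < card J \<and> k < card J")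
      case True
      then have "h i \<noteq> h k" using h \<open>i \<noteq> k\<close> by (auto simp: bij_betw_def inj_on_def)
      then show ?thesis using True disj hJ by (auto simp: A_def disjoint_family_on_def)
    qed (auto simp: A_def)
  qed
  have U: "(\<Union>n. A n) = (\<Union>j\<in>J. B j)"
  proof -
    have "(\<Union>n. A n) = (\<Union>i\<in>{0..<card J}. B (h i))" by (auto simp: A_def split: if_splits)
    also have "\<dots> = (\<Union>j\<in>h ` {0..<card J}. B j)" by simp
    also have "h ` {0..<card J} = J" using h by (simp add: bij_betw_def)
    finally show ?thesis .
  qed
  have "emeasure m (\<Union>j\<in>J. B j) \<le> (\<Sum>j\<in>J. emeasure m (B j))"
    using assms(1) B by (intro emeasure_subadditive_finite) (auto simp: finite_measure_sets_def)
  also have "\<dots> < \<infinity>" using assms(1) B by (simp add: finite_measure_sets_def)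
  finally have "AE \<omega> in P. (\<lambda>n. M (A n) \<omega>) sums M (\<Union>j\<in>J. B j) \<omega>"
    using random_measure_sums[OF A dA] U by simp
  with random_measure_empty show ?thesis
  proof eventually_elim
    case (elim \<omega>)
    have "(\<lambda>n. M (A n) \<omega>) sums (\<Sum>i\<in>{0..<card J}. M (A i) \<omega>)"
      using elim(1) by (intro sums_finite) (auto simp: A_def)
    with elim(2) have "M (\<Union>j\<in>J. B j) \<omega> = (\<Sum>i\<in>{0..<card J}. M (A i) \<omega>)"
      by (rule sums_unique2)
    also have "\<dots> = (\<Sum>i\<in>{0..<card J}. M (B (h i)) \<omega>)" by (intro sum.cong) (auto simp: A_def)
    also have "\<dots> = (\<Sum>j\<in>J. M (B j) \<omega>)" by (rule sum.reindex_bij_betw[OF h])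
    finally show ?case .
  qed
qed

lemma random_measure_indep:
  fixes n :: nat
  assumes A: "\<And>i. i < n \<Longrightarrow> A i \<in> E\<^sub>0" and disj: "disjoint_family_on A {..<n}"
  shows "indep_vars (\<lambda>_. borel) (\<lambda>i. M (A i)) {..<n}"
proof -
  define A' where "A' i = (if i < n then A i else {})" for i
  have "indep_vars (\<lambda>_. borel) (\<lambda>i. M (A' i)) UNIV"
    using A disj by (intro random_measure_indep_sequence) (auto simp: A'_def disjoint_family_on_def)
  then have "indep_vars (\<lambda>_. borel) (\<lambda>i. M (A' i)) {..<n}"
    by (rule indep_vars_subset) simp
  then show ?thesis
    by (subst indep_vars_cong) (auto simp: A'_def)
qed

end

definition finitely_supported_simple :: "'e measure \<Rightarrow> ('e \<Rightarrow> real) \<Rightarrow> bool" where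
  "finitely_supported_simple m s \<longleftrightarrow> simple_function m s \<and> emeasure m {x \<in> space m. s x \<noteq> 0} < \<infinity>"

text \<open>
  Stated pointwise rather than as a sum of indicators, so that several functions on the same sets can
  be compared coefficient by coefficient.
\<close>

definition carried_by :: "'e measure \<Rightarrow> nat \<Rightarrow> (nat \<Rightarrow> 'e set) \<Rightarrow> ('e \<Rightarrow> real) \<Rightarrow> (nat \<Rightarrow> real) \<Rightarrow> bool" where
  "carried_by m n A s v \<longleftrightarrow> (\<forall>i<n. \<forall>x\<in>A i. s x = v i) \<and> (\<forall>x\<in>space m - (\<Union>i<n. A i). s x = 0)"

text \<open>
  The sets are the level sets of the vector-valued function \<open>x \<mapsto> (s k x)\<^sub>k\<close>, except that of the zero
  vector, whose measure may be infinite. They are nonempty, so the coefficients inherit pointwise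
  properties of the \<open>s k\<close>, in particular monotonicity in \<open>k\<close>.
\<close>

lemma common_partition:
  fixes s :: "'k \<Rightarrow> 'e \<Rightarrow> real"
  assumes K: "finite K" and s: "\<And>k. k \<in> K \<Longrightarrow> finitely_supported_simple m (s k)"
  obtains n :: nat and A v where "\<And>i. i < n \<Longrightarrow> A i \<in> finite_measure_sets m"
    "\<And>i. i < n \<Longrightarrow> A i \<noteq> {}" "disjoint_family_on A {..<n}"
    "\<And>k. k \<in> K \<Longrightarrow> carried_by m n A (s k) (\<lambda>i. v i k)"
    "\<And>i. i < n \<Longrightarrow> \<exists>k\<in>K. v i k \<noteq> 0"
proof -
  define p where "p x = (\<lambda>k\<in>K. s k x)" for x
  have sf: "simple_function m (s k)" if "k \<in> K" for k
    using s[OF that] by (simp add: finitely_supported_simple_def)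
  have "p ` space m \<subseteq> PiE K (\<lambda>k. s k ` space m)" by (auto simp: p_def)
  moreover have "finite (PiE K (\<lambda>k. s k ` space m))"
    using K sf by (intro finite_PiE) (auto simp: simple_function_def)
  ultimately have fin: "finite (p ` space m)" by (rule finite_subset)
  define J where "J = p ` space m - {\<lambda>k\<in>K. 0}"
  have finJ: "finite J" using fin by (simp add: J_def)
  obtain h where h: "bij_betw h {0..<card J} J"
    using ex_bij_betw_nat_finite[OF finJ] by blast
  define A where "A i = p -` {h i} \<inter> space m" for i
  have hJ: "h i \<in> J" if "i < card J" for i using h that by (auto simp: bij_betw_def)
  have ex: "\<exists>k\<in>K. h i k \<noteq> 0" if i: "i < card J" for i
  proof (rule ccontr)
    assume *: "\<not> ?thesis"
    obtain x where x: "h i = p x" and ne: "h i \<noteq> (\<lambda>k\<in>K. 0)" using hJ[OF i] by (auto simp: J_def)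
    have "h i = (\<lambda>k\<in>K. 0)" using * unfolding x by (auto simp: p_def fun_eq_iff)
    with ne show False by simp
  qed
  show ?thesis
  proof (rule that[of "card J" A h])
    fix i assume i: "i < card J"
    show "\<exists>k\<in>K. h i k \<noteq> 0" by (rule ex[OF i])
    then obtain k where k: "k \<in> K" "h i k \<noteq> 0" by blast
    show "A i \<noteq> {}" using hJ[OF i] by (auto simp: A_def J_def)
    have Ai: "A i = space m \<inter> (\<Inter>k\<in>K. s k -` {h i k} \<inter> space m)"
    proof -
      have "p x = h i \<longleftrightarrow> (\<forall>k\<in>K. s k x = h i k)" if "x \<in> space m" for x
      proof -
        obtain y where y: "h i = p y" using hJ[OF i] by (auto simp: J_def)
        show ?thesis unfolding y by (auto simp: p_def fun_eq_iff restrict_def)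
      qed
      then show ?thesis by (auto simp: A_def)
    qed
    have "A i = (\<Inter>k\<in>K. s k -` {h i k} \<inter> space m)" using Ai k by auto
    also have "\<dots> \<in> sets m"
      using K k sf by (intro sets.finite_INT) (auto intro: simple_functionD)
    finally have As: "A i \<in> sets m" .
    have "{x \<in> space m. s k x \<noteq> 0} = s k -` (- {0}) \<inter> space m" by auto
    then have "{x \<in> space m. s k x \<noteq> 0} \<in> sets m" using simple_functionD(2)[OF sf[OF k(1)]] by simp
    then have "emeasure m (A i) \<le> emeasure m {x \<in> space m. s k x \<noteq> 0}"
      using k by (intro emeasure_mono) (auto simp: Ai)
    also have "\<dots> < \<infinity>" using s[OF k(1)] by (simp add: finitely_supported_simple_def)
    finally show "A i \<in> finite_measure_sets m" using As by (simp add: finite_measure_sets_def)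
  next
    show "disjoint_family_on A {..<card J}"
      using h by (auto simp: disjoint_family_on_def A_def bij_betw_def inj_on_def)
  next
    fix k assume k: "k \<in> K"
    show "carried_by m (card J) A (s k) (\<lambda>i. h i k)"
      unfolding carried_by_def
    proof (intro conjI allI impI ballI)
      fix i x assume "i < card J" "x \<in> A i"
      then have "p x k = h i k" by (simp add: A_def)
      then show "s k x = h i k" using k by (simp add: p_def)
    next
      fix x assume x: "x \<in> space m - (\<Union>i<card J. A i)"
      have "p x \<notin> J"
      proof
        assume "p x \<in> J"
        then have "p x \<in> h ` {0..<card J}" using h by (simp add: bij_betw_def)
        then obtain i where i: "i < card J" "h i = p x" by force
        then have "x \<in> A i" using x by (simp add: A_def)
        with x i(1) show False by blast
      qed
      then have "p x = (\<lambda>k\<in>K. 0)" using x by (auto simp: J_def)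
      then have "p x k = 0" using k by simp
      then show "s k x = 0" using k by (simp add: p_def)
    qed
  qed
qed

lemma carried_by_linear:
  "carried_by m n A s v \<Longrightarrow> carried_by m n A s' v' \<Longrightarrow>
    carried_by m n A (\<lambda>x. a * s x + b * s' x) (\<lambda>i. a * v i + b * v' i)"
  by (auto simp: carried_by_def)

lemma carried_by_nn_integral:
  assumes A: "\<And>i. i < n \<Longrightarrow> A i \<in> finite_measure_sets m" and disj: "disjoint_family_on A {..<n}"
    and s: "carried_by m n A s v" and g: "g 0 = 0" "\<And>y. 0 \<le> g y"
  shows "(\<integral>\<^sup>+x. ennreal (g (s x)) \<partial>m) = ennreal (\<Sum>i<n. g (v i) * measure m (A i))"
proof -
  have Am: "A i \<in> sets m" "emeasure m (A i) = ennreal (measure m (A i))" if "i < n" for i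
    using A[OF that] by (auto simp: finite_measure_sets_def emeasure_eq_ennreal_measure)
  have pt: "ennreal (g (s x)) = (\<Sum>i<n. ennreal (g (v i)) * indicator (A i) x)" if x: "x \<in> space m" for x
  proof (cases "\<exists>i<n. x \<in> A i")
    case True
    then obtain i where i: "i < n" "x \<in> A i" by blast
    have "x \<notin> A j" if "j < n" "j \<noteq> i" for j
      using disj i that by (auto simp: disjoint_family_on_def)
    then have "(\<Sum>i<n. ennreal (g (v i)) * indicator (A i) x) = (\<Sum>j\<in>{i}. ennreal (g (v j)) * indicator (A j) x)"
      using i by (intro sum.mono_neutral_right) auto
    also have "\<dots> = ennreal (g (s x))" using i s by (simp add: carried_by_def)
    finally show ?thesis ..
  next
    case False
    then have "s x = 0" using s x by (auto simp: carried_by_def)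
    with False g show ?thesis by (auto intro!: sum.neutral[symmetric])
  qed
  have "(\<integral>\<^sup>+x. ennreal (g (s x)) \<partial>m) = (\<integral>\<^sup>+x. (\<Sum>i<n. ennreal (g (v i)) * indicator (A i) x) \<partial>m)"
    by (intro nn_integral_cong pt)
  also have "\<dots> = (\<Sum>i<n. ennreal (g (v i)) * emeasure m (A i))"
    using Am by (subst nn_integral_sum) (auto simp: nn_integral_cmult)
  also have "\<dots> = (\<Sum>i<n. ennreal (g (v i) * measure m (A i)))"
    using Am g by (intro sum.cong) (auto simp: ennreal_mult)
  also have "\<dots> = ennreal (\<Sum>i<n. g (v i) * measure m (A i))"
    using g by (intro sum_ennreal) simp
  finally show ?thesis .
qed

context stable_measure
begin

abbreviation "I \<equiv> simple_stable_integral m M"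

lemma simple_stable_integral_measurable [measurable]:
  assumes "finitely_supported_simple m s"
  shows "I s \<in> borel_measurable P"
proof -
  have "s -` {c} \<inter> space m \<in> E\<^sub>0" if "c \<noteq> 0" for c
  proof -
    have sf: "simple_function m s" using assms by (simp add: finitely_supported_simple_def)
    have "{x \<in> space m. s x \<noteq> 0} = s -` (- {0}) \<inter> space m" by auto
    then have "{x \<in> space m. s x \<noteq> 0} \<in> sets m" using simple_functionD(2)[OF sf] by simp
    then have "emeasure m (s -` {c} \<inter> space m) \<le> emeasure m {x \<in> space m. s x \<noteq> 0}"
      using that by (intro emeasure_mono) auto
    also have "\<dots> < \<infinity>" using assms by (simp add: finitely_supported_simple_def)
    finally show ?thesis using simple_functionD(2)[OF sf] by (simp add: finite_measure_sets_def)
  qed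
  then show ?thesis unfolding simple_stable_integral_def[abs_def]
    by (intro borel_measurable_sum borel_measurable_times borel_measurable_const random_measure_measurable) auto
qed

text \<open>
  The level sets in the definition of the integral are finite unions of the sets \<open>A i\<close>, so additivity
  of the random measure splits them. In this form the integral is linear: functions given on a
  common partition may be added coefficientwise.
\<close>

lemma simple_stable_integral_carried_by:
  assumes A: "\<And>i. i < n \<Longrightarrow> A i \<in> E\<^sub>0" "\<And>i. i < n \<Longrightarrow> A i \<noteq> {}" and disj: "disjoint_family_on A {..<n}"
    and s: "carried_by m n A s v"
  shows "AE \<omega> in P. I s \<omega> = (\<Sum>i<n. v i * M (A i) \<omega>)"
proof -
  have Asp: "A i \<subseteq> space m" if "i < n" for i
    using A(1)[OF that] sets.sets_into_space by (auto simp: finite_measure_sets_def)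
  have sv: "s x = v i" if "i < n" "x \<in> A i" for i x using s that by (auto simp: carried_by_def)
  have s0: "\<exists>i<n. x \<in> A i" if "x \<in> space m" "s x \<noteq> 0" for x using s that by (auto simp: carried_by_def)
  define S where "S = s ` space m - {0}"
  define J where "J c = {i\<in>{..<n}. v i = c}" for c
  have lev: "s -` {c} \<inter> space m = (\<Union>i\<in>J c. A i)" if "c \<in> S" for c
  proof (rule set_eqI)
    fix x
    have c: "c \<noteq> 0" using that by (simp add: S_def)
    show "x \<in> s -` {c} \<inter> space m \<longleftrightarrow> x \<in> (\<Union>i\<in>J c. A i)"
    proof
      assume x: "x \<in> s -` {c} \<inter> space m"
      then obtain i where "i < n" "x \<in> A i" using s0[of x] c by auto
      with x sv show "x \<in> (\<Union>i\<in>J c. A i)" by (auto simp: J_def)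
    next
      assume "x \<in> (\<Union>i\<in>J c. A i)"
      then obtain i where "i < n" "v i = c" "x \<in> A i" by (auto simp: J_def)
      with sv[of i x] Asp[of i] show "x \<in> s -` {c} \<inter> space m" by auto
    qed
  qed
  have S_eq: "S = v ` {i\<in>{..<n}. v i \<noteq> 0}"
  proof safe
    fix c assume "c \<in> S"
    then obtain x where x: "x \<in> space m" "s x = c" "c \<noteq> 0" by (auto simp: S_def)
    then obtain i where "i < n" "x \<in> A i" using s0 by blast
    with x sv show "c \<in> v ` {i\<in>{..<n}. v i \<noteq> 0}" by auto
  next
    fix i assume i: "i < n" "v i \<noteq> 0"
    then obtain x where x: "x \<in> A i" using A(2) by blast
    then have "x \<in> space m" "s x = v i" using i sv[of i x] Asp[of i] by auto
    then show "v i \<in> S" using i unfolding S_def by force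
  qed
  have "AE \<omega> in P. \<forall>c\<in>S. M (\<Union>i\<in>J c. A i) \<omega> = (\<Sum>i\<in>J c. M (A i) \<omega>)"
  proof (intro AE_finite_allI random_measure_finite_union)
    show "finite S" unfolding S_eq by simp
    fix c
    show "finite (J c)" by (simp add: J_def)
    show "disjoint_family_on A (J c)" using disj by (auto simp: disjoint_family_on_def J_def)
    show "A i \<in> E\<^sub>0" if "i \<in> J c" for i using A that by (auto simp: J_def)
  qed
  then show ?thesis
  proof eventually_elim
    case (elim \<omega>)
    have "I s \<omega> = (\<Sum>c\<in>S. c * (\<Sum>i\<in>J c. M (A i) \<omega>))"
      unfolding simple_stable_integral_def S_def[symmetric] using elim by (intro sum.cong) (auto simp: lev)
    also have "\<dots> = (\<Sum>c\<in>S. \<Sum>i\<in>{i\<in>{i\<in>{..<n}. v i \<noteq> 0}. v i = c}. v i * M (A i) \<omega>)"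
      unfolding sum_distrib_left by (intro sum.cong) (auto simp: J_def S_def)
    also have "\<dots> = (\<Sum>i\<in>{i\<in>{..<n}. v i \<noteq> 0}. v i * M (A i) \<omega>)"
      unfolding S_eq by (rule sum.image_gen[symmetric]) simp
    also have "\<dots> = (\<Sum>i<n. v i * M (A i) \<omega>)"
      by (intro sum.mono_neutral_left) auto
    finally show ?case .
  qed
qed

text \<open>
  On a common partition the difference is a sum of independent stable variables whose parameters add
  up to the integral on the right.
\<close>

lemma simple_stable_integral_tail:
  assumes s: "finitely_supported_simple m s" and s': "finitely_supported_simple m s'" and r: "0 < r"
  shows "ennreal (prob {\<omega> \<in> space P. r < \<bar>I s \<omega> - I s' \<omega>\<bar>})
    \<le> ennreal (tail_const \<alpha> * r powr (-\<alpha>)) * (\<integral>\<^sup>+x. ennreal (\<bar>s x - s' x\<bar> powr \<alpha>) \<partial>m)"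
proof -
  define ss where "ss b = (if b then s else s')" for b
  obtain n A v where A: "\<And>i. i < n \<Longrightarrow> A i \<in> E\<^sub>0" "\<And>i. i < n \<Longrightarrow> A i \<noteq> {}"
    and disj: "disjoint_family_on A {..<n::nat}" and c: "\<And>b. b \<in> UNIV \<Longrightarrow> carried_by m n A (ss b) (\<lambda>i. v i b)"
    by (rule common_partition[of UNIV m ss]) (use s s' in \<open>auto simp: ss_def\<close>)
  have cs: "carried_by m n A s (\<lambda>i. v i True)" "carried_by m n A s' (\<lambda>i. v i False)"
    using c[of True] c[of False] by (simp_all add: ss_def)
  define w where "w i = v i True - v i False" for i
  have cw: "carried_by m n A (\<lambda>x. s x - s' x) w"
    using carried_by_linear[OF cs, of 1 "-1"] by (simp add: w_def[abs_def])
  define Y where "Y \<omega> = (\<Sum>i<n. w i * M (A i) \<omega>)" for \<omega>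
  define \<mu> where "\<mu> = (\<Sum>i<n. \<bar>w i\<bar> powr \<alpha> * measure m (A i))"
  have Y: "sas_variable \<alpha> \<mu> Y"
    unfolding Y_def \<mu>_def
  proof (intro sas_variable_sum sas_variable_scale random_measure_sas)
    show "indep_vars (\<lambda>_. borel) (\<lambda>j \<omega>. w j * M (A j) \<omega>) {..<n}"
      by (rule indep_vars_compose2[OF random_measure_indep[OF A(1) disj]]) auto
  qed (use A in auto)
  then have [measurable]: "Y \<in> borel_measurable P" by (simp add: sas_variable_def)
  note [measurable] = simple_stable_integral_measurable[OF s] simple_stable_integral_measurable[OF s']
  have I1: "AE \<omega> in P. I s \<omega> = (\<Sum>i<n. v i True * M (A i) \<omega>)"
    by (rule simple_stable_integral_carried_by[OF A disj cs(1)])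
  have I2: "AE \<omega> in P. I s' \<omega> = (\<Sum>i<n. v i False * M (A i) \<omega>)"
    by (rule simple_stable_integral_carried_by[OF A disj cs(2)])
  have "AE \<omega> in P. I s \<omega> - I s' \<omega> = Y \<omega>"
    using I1 I2 by eventually_elim (simp add: Y_def w_def left_diff_distrib sum_subtractf)
  then have "prob {\<omega> \<in> space P. r < \<bar>I s \<omega> - I s' \<omega>\<bar>} = prob {\<omega> \<in> space P. r < \<bar>Y \<omega>\<bar>}"
    by (intro measure_eq_AE) auto
  also have "\<dots> \<le> tail_const \<alpha> * \<mu> * r powr (-\<alpha>)"
    by (rule sas_variable_tail[OF Y r alpha_pos])
  finally have "ennreal (prob {\<omega> \<in> space P. r < \<bar>I s \<omega> - I s' \<omega>\<bar>})
      \<le> ennreal ((tail_const \<alpha> * r powr (-\<alpha>)) * \<mu>)" by (intro ennreal_leI) (simp add: mult_ac)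
  also have "\<dots> = ennreal (tail_const \<alpha> * r powr (-\<alpha>)) * ennreal \<mu>"
    using tail_const_nonneg[OF alpha_pos] by (intro ennreal_mult) (auto simp: \<mu>_def intro!: sum_nonneg)
  also have "ennreal \<mu> = (\<integral>\<^sup>+x. ennreal (\<bar>s x - s' x\<bar> powr \<alpha>) \<partial>m)"
    unfolding \<mu>_def
    by (rule carried_by_nn_integral[OF A(1) disj cw, of "\<lambda>y. \<bar>y\<bar> powr \<alpha>", symmetric]) auto
  finally show ?thesis .
qed

end

section \<open>Dependence of the stable integral on the integrand\<close>

text \<open>
  A substitute for the triangle inequality that holds for every positive exponent.
\<close>

lemma powr_abs_sum3_le:
  fixes u v w \<alpha> :: real
  assumes "0 < \<alpha>"
  shows "\<bar>u + v + w\<bar> powr \<alpha> \<le> 3 powr \<alpha> * (\<bar>u\<bar> powr \<alpha> + \<bar>v\<bar> powr \<alpha> + \<bar>w\<bar> powr \<alpha>)"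
proof -
  define b where "b = max \<bar>u\<bar> (max \<bar>v\<bar> \<bar>w\<bar>)"
  have "\<bar>u + v + w\<bar> \<le> 3 * b" unfolding b_def by linarith
  then have "\<bar>u + v + w\<bar> powr \<alpha> \<le> (3 * b) powr \<alpha>"
    using assms by (intro powr_mono2) auto
  also have "\<dots> = 3 powr \<alpha> * b powr \<alpha>" by (simp add: powr_mult b_def)
  also have "b powr \<alpha> \<le> \<bar>u\<bar> powr \<alpha> + \<bar>v\<bar> powr \<alpha> + \<bar>w\<bar> powr \<alpha>"
    unfolding b_def by (auto simp: max_def)
  finally show ?thesis by (simp add: mult_left_mono)
qed

lemma nn_integral_powr_sum3_le:
  fixes u v w :: "'e \<Rightarrow> real"
  assumes [measurable]: "u \<in> borel_measurable m" "v \<in> borel_measurable m" "w \<in> borel_measurable m"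
    and "0 < \<alpha>"
  shows "(\<integral>\<^sup>+x. ennreal (\<bar>u x + v x + w x\<bar> powr \<alpha>) \<partial>m)
    \<le> ennreal (3 powr \<alpha>) * ((\<integral>\<^sup>+x. ennreal (\<bar>u x\<bar> powr \<alpha>) \<partial>m) + (\<integral>\<^sup>+x. ennreal (\<bar>v x\<bar> powr \<alpha>) \<partial>m)
        + (\<integral>\<^sup>+x. ennreal (\<bar>w x\<bar> powr \<alpha>) \<partial>m))"
proof -
  have "(\<integral>\<^sup>+x. ennreal (\<bar>u x + v x + w x\<bar> powr \<alpha>) \<partial>m)
    \<le> (\<integral>\<^sup>+x. ennreal (3 powr \<alpha>) * (ennreal (\<bar>u x\<bar> powr \<alpha>) + ennreal (\<bar>v x\<bar> powr \<alpha>) + ennreal (\<bar>w x\<bar> powr \<alpha>)) \<partial>m)"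
    using powr_abs_sum3_le[OF assms(4)]
    by (intro nn_integral_mono) (simp add: ennreal_plus[symmetric] ennreal_mult[symmetric] ennreal_leI del: ennreal_plus)
  also have "\<dots> = ennreal (3 powr \<alpha>) * ((\<integral>\<^sup>+x. ennreal (\<bar>u x\<bar> powr \<alpha>) \<partial>m) + (\<integral>\<^sup>+x. ennreal (\<bar>v x\<bar> powr \<alpha>) \<partial>m)
        + (\<integral>\<^sup>+x. ennreal (\<bar>w x\<bar> powr \<alpha>) \<partial>m))"
    by (simp add: nn_integral_cmult nn_integral_add)
  finally show ?thesis .
qed

context stable_measure
begin

abbreviation "stable_int \<equiv> has_stable_integral P \<alpha> m M"

lemma stable_integral_measurable: "stable_int g Y \<Longrightarrow> Y \<in> borel_measurable P"
  by (simp add: has_stable_integral_def)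

lemma stable_integral_approximation:
  assumes "stable_int g Y"
  obtains s where "\<And>n. finitely_supported_simple m (s n)"
    "(\<lambda>n::nat. \<integral>\<^sup>+x. ennreal (\<bar>s n x - g x\<bar> powr \<alpha>) \<partial>m) \<longlonglongrightarrow> 0"
    "\<And>r. 0 < r \<Longrightarrow> (\<lambda>n. prob {\<omega> \<in> space P. r < \<bar>I (s n) \<omega> - Y \<omega>\<bar>}) \<longlonglongrightarrow> 0"
  using assms unfolding has_stable_integral_def conv_in_probability_def finitely_supported_simple_def
  by blast

lemma finitely_supported_simple_measurable:
  "finitely_supported_simple m s \<Longrightarrow> s \<in> borel_measurable m"
  by (simp add: finitely_supported_simple_def borel_measurable_simple_function)

text \<open>
  The constant of \<open>simple_stable_integral_tail\<close> at the level \<open>r / 3\<close>, times the constant \<open>3 powr \<alpha>\<close> of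
  \<open>nn_integral_powr_sum3_le\<close>: the difference below is split into three parts.
\<close>

definition difference_const :: "real \<Rightarrow> real" where
  "difference_const r = tail_const \<alpha> * (r / 3) powr (-\<alpha>) * 3 powr \<alpha>"

text \<open>
  Compare both integrals with simple approximations and let these converge; only the comparison of the
  two simple functions survives in the limit. The estimate gives both the uniqueness of the integral
  up to null sets and its continuity in the integrand.
\<close>

lemma stable_integral_difference_tail:
  assumes Y: "stable_int g Y" and Y': "stable_int g' Y'" and r: "0 < r"
  shows "ennreal (prob {\<omega> \<in> space P. r < \<bar>Y \<omega> - Y' \<omega>\<bar>})
    \<le> ennreal (difference_const r) * (\<integral>\<^sup>+x. ennreal (\<bar>g x - g' x\<bar> powr \<alpha>) \<partial>m)"
proof -
  obtain s where s: "\<And>n. finitely_supported_simple m (s n)"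
    "(\<lambda>n::nat. \<integral>\<^sup>+x. ennreal (\<bar>s n x - g x\<bar> powr \<alpha>) \<partial>m) \<longlonglongrightarrow> 0"
    "\<And>r. 0 < r \<Longrightarrow> (\<lambda>n. prob {\<omega> \<in> space P. r < \<bar>I (s n) \<omega> - Y \<omega>\<bar>}) \<longlonglongrightarrow> 0"
    using stable_integral_approximation[OF Y] by blast
  obtain s' where s': "\<And>n. finitely_supported_simple m (s' n)"
    "(\<lambda>n::nat. \<integral>\<^sup>+x. ennreal (\<bar>s' n x - g' x\<bar> powr \<alpha>) \<partial>m) \<longlonglongrightarrow> 0"
    "\<And>r. 0 < r \<Longrightarrow> (\<lambda>n. prob {\<omega> \<in> space P. r < \<bar>I (s' n) \<omega> - Y' \<omega>\<bar>}) \<longlonglongrightarrow> 0"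
    using stable_integral_approximation[OF Y'] by blast
  have [measurable]: "g \<in> borel_measurable m" "g' \<in> borel_measurable m"
    "Y \<in> borel_measurable P" "Y' \<in> borel_measurable P"
    using Y Y' by (auto simp: has_stable_integral_def)
  note [measurable] = s(1)[THEN finitely_supported_simple_measurable] s'(1)[THEN finitely_supported_simple_measurable]
    s(1)[THEN simple_stable_integral_measurable] s'(1)[THEN simple_stable_integral_measurable]
  let ?a = "\<lambda>n. \<integral>\<^sup>+x. ennreal (\<bar>s n x - g x\<bar> powr \<alpha>) \<partial>m"
  let ?a' = "\<lambda>n. \<integral>\<^sup>+x. ennreal (\<bar>s' n x - g' x\<bar> powr \<alpha>) \<partial>m"
  let ?G = "\<integral>\<^sup>+x. ennreal (\<bar>g x - g' x\<bar> powr \<alpha>) \<partial>m"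
  define p where "p n = prob {\<omega> \<in> space P. r / 3 < \<bar>I (s n) \<omega> - Y \<omega>\<bar>}" for n
  define p' where "p' n = prob {\<omega> \<in> space P. r / 3 < \<bar>I (s' n) \<omega> - Y' \<omega>\<bar>}" for n
  define D where "D = ennreal (tail_const \<alpha> * (r / 3) powr (-\<alpha>))"
  have "ennreal (prob {\<omega> \<in> space P. r < \<bar>Y \<omega> - Y' \<omega>\<bar>})
      \<le> ennreal (p n) + ennreal (p' n) + D * (ennreal (3 powr \<alpha>) * (?a n + ?a' n + ?G))" for n
  proof -
    define q where "q = prob {\<omega> \<in> space P. r / 3 < \<bar>I (s n) \<omega> - I (s' n) \<omega>\<bar>}"
    have "prob {\<omega> \<in> space P. r < \<bar>Y \<omega> - Y' \<omega>\<bar>}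
      \<le> prob ({\<omega> \<in> space P. r / 3 < \<bar>I (s n) \<omega> - Y \<omega>\<bar>} \<union> {\<omega> \<in> space P. r / 3 < \<bar>I (s' n) \<omega> - Y' \<omega>\<bar>}
          \<union> {\<omega> \<in> space P. r / 3 < \<bar>I (s n) \<omega> - I (s' n) \<omega>\<bar>})"
    proof (intro finite_measure_mono subsetI)
      fix \<omega> assume "\<omega> \<in> {\<omega> \<in> space P. r < \<bar>Y \<omega> - Y' \<omega>\<bar>}"
      then have "\<omega> \<in> space P" "r < \<bar>Y \<omega> - Y' \<omega>\<bar>" by auto
      moreover have "r / 3 < \<bar>I (s n) \<omega> - Y \<omega>\<bar> \<or> r / 3 < \<bar>I (s' n) \<omega> - Y' \<omega>\<bar> \<or> r / 3 < \<bar>I (s n) \<omega> - I (s' n) \<omega>\<bar>"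
        using calculation(2) by linarith
      ultimately show "\<omega> \<in> {\<omega> \<in> space P. r / 3 < \<bar>I (s n) \<omega> - Y \<omega>\<bar>} \<union> {\<omega> \<in> space P. r / 3 < \<bar>I (s' n) \<omega> - Y' \<omega>\<bar>}
          \<union> {\<omega> \<in> space P. r / 3 < \<bar>I (s n) \<omega> - I (s' n) \<omega>\<bar>}" by auto
    qed measurable
    also have "\<dots> \<le> p n + p' n + q"
      unfolding p_def p'_def q_def
      by (intro order_trans[OF measure_Un_le] add_mono order_refl) measurable
    finally have "ennreal (prob {\<omega> \<in> space P. r < \<bar>Y \<omega> - Y' \<omega>\<bar>}) \<le> ennreal (p n + p' n + q)"
      by (rule ennreal_leI)
    also have "\<dots> = ennreal (p n) + ennreal (p' n) + ennreal q"
      by (simp add: p_def p'_def q_def)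
    also have "ennreal q \<le> D * (\<integral>\<^sup>+x. ennreal (\<bar>s n x - s' n x\<bar> powr \<alpha>) \<partial>m)"
      unfolding q_def D_def using r by (intro simple_stable_integral_tail s s') simp
    also have "(\<integral>\<^sup>+x. ennreal (\<bar>s n x - s' n x\<bar> powr \<alpha>) \<partial>m)
        = (\<integral>\<^sup>+x. ennreal (\<bar>(s n x - g x) + (g' x - s' n x) + (g x - g' x)\<bar> powr \<alpha>) \<partial>m)"
      by (intro nn_integral_cong arg_cong[where f=ennreal] arg_cong[where f="\<lambda>y. \<bar>y\<bar> powr \<alpha>"]) simp
    also have "\<dots> \<le> ennreal (3 powr \<alpha>) * (?a n + (\<integral>\<^sup>+x. ennreal (\<bar>g' x - s' n x\<bar> powr \<alpha>) \<partial>m) + ?G)"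
      by (rule nn_integral_powr_sum3_le[OF _ _ _ alpha_pos]) measurable
    finally show ?thesis
      by (simp add: add_left_mono mult_left_mono abs_minus_commute)
  qed
  moreover have "(\<lambda>n. ennreal (p n) + ennreal (p' n) + D * (ennreal (3 powr \<alpha>) * (?a n + ?a' n + ?G)))
      \<longlonglongrightarrow> ennreal 0 + ennreal 0 + D * (ennreal (3 powr \<alpha>) * (0 + 0 + ?G))"
    using s(2) s'(2) s(3)[of "r / 3"] s'(3)[of "r / 3"] r unfolding p_def p'_def D_def
    by (intro tendsto_add ennreal_tendsto_cmult tendsto_ennrealI tendsto_const) auto
  ultimately have "ennreal (prob {\<omega> \<in> space P. r < \<bar>Y \<omega> - Y' \<omega>\<bar>})
      \<le> ennreal 0 + ennreal 0 + D * (ennreal (3 powr \<alpha>) * (0 + 0 + ?G))"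
    by (intro tendsto_lowerbound[OF _ always_eventually]) auto
  then show ?thesis
    using tail_const_nonneg[OF alpha_pos] by (simp add: D_def difference_const_def ennreal_mult mult.assoc)
qed

lemma stable_integral_conv_in_probability:
  assumes Y: "\<And>n. stable_int (g n) (Y n)" and Y': "stable_int g' Y'"
    and lim: "(\<lambda>n. \<integral>\<^sup>+x. ennreal (\<bar>g n x - g' x\<bar> powr \<alpha>) \<partial>m) \<longlonglongrightarrow> 0"
  shows "conv_in_probability P Y Y'"
  unfolding conv_in_probability_def
proof (intro allI impI)
  fix r :: real assume r: "0 < r"
  have "(\<lambda>n. ennreal (difference_const r) * (\<integral>\<^sup>+x. ennreal (\<bar>g n x - g' x\<bar> powr \<alpha>) \<partial>m)) \<longlonglongrightarrow> ennreal (difference_const r) * 0"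
    by (intro ennreal_tendsto_cmult lim) simp
  then have "(\<lambda>n. ennreal (prob {\<omega> \<in> space P. r < \<bar>Y n \<omega> - Y' \<omega>\<bar>})) \<longlonglongrightarrow> ennreal 0"
    using stable_integral_difference_tail[OF Y Y' r]
    by (intro tendsto_sandwich[where f = "\<lambda>_. 0" and g = "\<lambda>n. ennreal (prob {\<omega> \<in> space P. r < \<bar>Y n \<omega> - Y' \<omega>\<bar>})"
          and h = "\<lambda>n. ennreal (difference_const r) * (\<integral>\<^sup>+x. ennreal (\<bar>g n x - g' x\<bar> powr \<alpha>) \<partial>m)"])
       (auto intro!: always_eventually)
  then show "(\<lambda>n. prob {\<omega> \<in> space P. r < \<bar>Y n \<omega> - Y' \<omega>\<bar>}) \<longlonglongrightarrow> 0"
    by (subst (asm) tendsto_ennreal_iff) auto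
qed

lemma stable_integral_AE_cong:
  assumes Y: "stable_int g Y" and ae: "AE x in m. g x = g' x" and [measurable]: "g' \<in> borel_measurable m"
  shows "stable_int g' Y"
proof -
  have [measurable]: "g \<in> borel_measurable m" using Y by (simp add: has_stable_integral_def)
  have "(\<integral>\<^sup>+x. ennreal (\<bar>g x\<bar> powr \<alpha>) \<partial>m) = (\<integral>\<^sup>+x. ennreal (\<bar>g' x\<bar> powr \<alpha>) \<partial>m)"
    using ae by (intro nn_integral_cong_AE) auto
  moreover have "(\<integral>\<^sup>+x. ennreal (\<bar>s n x - g x\<bar> powr \<alpha>) \<partial>m) = (\<integral>\<^sup>+x. ennreal (\<bar>s n x - g' x\<bar> powr \<alpha>) \<partial>m)"
    for s :: "nat \<Rightarrow> 'e \<Rightarrow> real" and n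
    using ae by (intro nn_integral_cong_AE) auto
  ultimately show ?thesis using Y by (simp add: has_stable_integral_def)
qed

lemma stable_integral_simple:
  assumes s: "finitely_supported_simple m s" and fin: "(\<integral>\<^sup>+x. ennreal (\<bar>s x\<bar> powr \<alpha>) \<partial>m) < \<infinity>"
  shows "stable_int s (I s)"
  unfolding has_stable_integral_def
proof (intro conjI)
  show "\<exists>sa. (\<forall>n. simple_function m (sa n)) \<and> (\<forall>n. emeasure m {x \<in> space m. sa n x \<noteq> 0} < \<infinity>) \<and>
    (\<lambda>n::nat. \<integral>\<^sup>+x. ennreal (\<bar>sa n x - s x\<bar> powr \<alpha>) \<partial>m) \<longlonglongrightarrow> 0 \<and>
    conv_in_probability P (\<lambda>n. I (sa n)) (I s)"
    using s by (intro exI[of _ "\<lambda>_. s"]) (simp add: finitely_supported_simple_def conv_in_probability_def)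
qed (use s fin in \<open>auto intro: finitely_supported_simple_measurable simple_stable_integral_measurable\<close>)

end

section \<open>Dyadic approximation and existence of the integral\<close>

text \<open>
  Rounding down to multiples of \<open>2 ^ (- n)\<close>, capped at \<open>n\<close>. Being increasing in \<open>u\<close>, it turns families
  of functions that are nondecreasing in time into such families of simple functions.
\<close>

definition dyadic_floor :: "nat \<Rightarrow> real \<Rightarrow> real" where
  "dyadic_floor n u = min (real n) (real_of_int \<lfloor>2 ^ n * u\<rfloor> / 2 ^ n)"

lemma dyadic_floor_nonneg: "0 \<le> u \<Longrightarrow> 0 \<le> dyadic_floor n u"
  by (simp add: dyadic_floor_def)

lemma dyadic_floor_le: "dyadic_floor n u \<le> u"
proof -
  have "real_of_int \<lfloor>2 ^ n * u\<rfloor> \<le> 2 ^ n * u" by (rule of_int_floor_le)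
  then have "real_of_int \<lfloor>2 ^ n * u\<rfloor> / 2 ^ n \<le> u" by (simp add: field_simps)
  then show ?thesis by (simp add: dyadic_floor_def)
qed

lemma dyadic_floor_mono: "u \<le> u' \<Longrightarrow> dyadic_floor n u \<le> dyadic_floor n u'"
  unfolding dyadic_floor_def by (intro min.mono divide_right_mono) (auto intro!: floor_mono)

lemma dyadic_floor_nonzero: "0 \<le> u \<Longrightarrow> dyadic_floor n u \<noteq> 0 \<Longrightarrow> 1 \<le> 2 ^ n * u"
proof (rule ccontr)
  assume u: "0 \<le> u" "dyadic_floor n u \<noteq> 0" "\<not> 1 \<le> 2 ^ n * u"
  then have "\<lfloor>2 ^ n * u\<rfloor> = 0" by (intro floor_unique) auto
  with u show False by (simp add: dyadic_floor_def)
qed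

lemma dyadic_floor_tendsto: "(\<lambda>n. dyadic_floor n u) \<longlonglongrightarrow> u"
proof (rule tendsto_sandwich[OF _ _ _ tendsto_const])
  show "\<forall>\<^sub>F n in sequentially. u - (1 / 2) ^ n \<le> dyadic_floor n u"
  proof (rule eventually_sequentiallyI[of "nat \<lceil>u\<rceil>"])
    fix n assume "nat \<lceil>u\<rceil> \<le> n"
    then have "u \<le> real n" by linarith
    moreover have "2 ^ n * u - 1 \<le> real_of_int \<lfloor>2 ^ n * u\<rfloor>" by linarith
    then have "(2 ^ n * u - 1) / 2 ^ n \<le> real_of_int \<lfloor>2 ^ n * u\<rfloor> / 2 ^ n"
      by (rule divide_right_mono) simp
    then have "u - (1 / 2) ^ n \<le> real_of_int \<lfloor>2 ^ n * u\<rfloor> / 2 ^ n"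
      by (simp add: diff_divide_distrib power_one_over)
    moreover have "(0::real) \<le> (1 / 2) ^ n" by simp
    ultimately show "u - (1 / 2) ^ n \<le> dyadic_floor n u"
      unfolding dyadic_floor_def by linarith
  qed
  have "(\<lambda>n. u - (1 / 2) ^ n) \<longlonglongrightarrow> u - 0"
    by (intro tendsto_diff tendsto_const LIMSEQ_power_zero) simp
  then show "(\<lambda>n. u - (1 / 2) ^ n) \<longlonglongrightarrow> u" by simp
qed (auto intro!: always_eventually dyadic_floor_le)

lemma dyadic_floor_range: "0 \<le> u \<Longrightarrow> dyadic_floor n u \<in> (\<lambda>k. real k / 2 ^ n) ` {..n * 2 ^ n}"
proof -
  assume u: "0 \<le> u"
  define k where "k = nat \<lfloor>2 ^ n * u\<rfloor>"
  have k: "real_of_int \<lfloor>2 ^ n * u\<rfloor> = real k" using u by (simp add: k_def)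
  have "dyadic_floor n u = real (min (n * 2 ^ n) k) / 2 ^ n"
    using of_nat_le_iff[of "n * 2 ^ n" k, where 'a = real]
    unfolding dyadic_floor_def k by (auto simp: min_def field_simps)
  then show ?thesis by auto
qed

lemma dyadic_floor_measurable [measurable]: "dyadic_floor n \<in> borel_measurable borel"
  unfolding dyadic_floor_def[abs_def] by measurable

text \<open>
  The support lies in the set where \<open>g \<ge> 2 ^ (- n)\<close>, which has finite measure by Markov's inequality.
\<close>

lemma finitely_supported_simple_dyadic_floor:
  assumes [measurable]: "g \<in> borel_measurable m" and g: "\<And>x. x \<in> space m \<Longrightarrow> 0 \<le> g x"
    and \<alpha>: "0 < \<alpha>" and fin: "(\<integral>\<^sup>+x. ennreal (\<bar>g x\<bar> powr \<alpha>) \<partial>m) < \<infinity>"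
  shows "finitely_supported_simple m (\<lambda>x. dyadic_floor n (g x))"
  unfolding finitely_supported_simple_def
proof
  have "(\<lambda>x. dyadic_floor n (g x)) ` space m \<subseteq> (\<lambda>k. real k / 2 ^ n) ` {..n * 2 ^ n}"
    using g dyadic_floor_range by blast
  then have "finite ((\<lambda>x. dyadic_floor n (g x)) ` space m)" by (rule finite_subset) simp
  then show "simple_function m (\<lambda>x. dyadic_floor n (g x))"
    by (intro simple_function_borel_measurable) measurable
  have "emeasure m {x \<in> space m. dyadic_floor n (g x) \<noteq> 0}
      \<le> emeasure m {x \<in> space m. 1 \<le> ennreal ((2 ^ n) powr \<alpha>) * ennreal (\<bar>g x\<bar> powr \<alpha>)}"
  proof (intro emeasure_mono subsetI)
    fix x assume "x \<in> {x \<in> space m. dyadic_floor n (g x) \<noteq> 0}"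
    then have x: "x \<in> space m" "1 \<le> 2 ^ n * g x" "0 \<le> g x" using g dyadic_floor_nonzero by auto
    then have "1 powr \<alpha> \<le> (2 ^ n * g x) powr \<alpha>" using \<alpha> by (intro powr_mono2) auto
    then have "1 \<le> (2 ^ n) powr \<alpha> * \<bar>g x\<bar> powr \<alpha>" using x by (simp add: powr_mult)
    then have "ennreal 1 \<le> ennreal ((2 ^ n) powr \<alpha> * \<bar>g x\<bar> powr \<alpha>)" by (rule ennreal_leI)
    then show "x \<in> {x \<in> space m. 1 \<le> ennreal ((2 ^ n) powr \<alpha>) * ennreal (\<bar>g x\<bar> powr \<alpha>)}"
      using x by (simp add: ennreal_mult)
  qed measurable
  also have "\<dots> \<le> ennreal ((2 ^ n) powr \<alpha>) * (\<integral>\<^sup>+x. ennreal (\<bar>g x\<bar> powr \<alpha>) \<partial>m)"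
    using nn_integral_Markov_inequality[of "\<lambda>x. ennreal (\<bar>g x\<bar> powr \<alpha>)" "space m" m "ennreal ((2 ^ n) powr \<alpha>)"]
    by simp
  also have "\<dots> < \<infinity>" using fin by (simp add: ennreal_mult_less_top)
  finally show "emeasure m {x \<in> space m. dyadic_floor n (g x) \<noteq> 0} < \<infinity>" .
qed

lemma finitely_supported_simple_diff:
  assumes s: "finitely_supported_simple m s" and s': "finitely_supported_simple m s'"
  shows "finitely_supported_simple m (\<lambda>x. s x - s' x)"
  unfolding finitely_supported_simple_def
proof
  have sf: "simple_function m s" "simple_function m s'" using s s' by (auto simp: finitely_supported_simple_def)
  note [measurable] = sf[THEN borel_measurable_simple_function]
  show "simple_function m (\<lambda>x. s x - s' x)" using sf by (rule simple_function_diff)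
  have "emeasure m {x \<in> space m. s x - s' x \<noteq> 0} \<le> emeasure m ({x \<in> space m. s x \<noteq> 0} \<union> {x \<in> space m. s' x \<noteq> 0})"
    by (intro emeasure_mono) auto
  also have "\<dots> \<le> emeasure m {x \<in> space m. s x \<noteq> 0} + emeasure m {x \<in> space m. s' x \<noteq> 0}"
    by (intro emeasure_subadditive) auto
  also have "\<dots> < \<infinity>" using s s' by (simp add: finitely_supported_simple_def)
  finally show "emeasure m {x \<in> space m. s x - s' x \<noteq> 0} < \<infinity>" .
qed

lemma dyadic_floor_difference_bounds:
  fixes g1 g2 :: real
  assumes "0 \<le> g1" "0 \<le> g2"
  shows "\<bar>(dyadic_floor n g1 - dyadic_floor n g2) - (g1 - g2)\<bar> \<le> g1 + g2"
    and "\<bar>dyadic_floor n g1 - dyadic_floor n g2\<bar> \<le> g1 + g2"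
  using assms dyadic_floor_nonneg[of g1 n] dyadic_floor_nonneg[of g2 n] dyadic_floor_le[of n g1] dyadic_floor_le[of n g2]
  by linarith+

lemma dyadic_floor_converges_in_powr:
  fixes g1 g2 :: "'e \<Rightarrow> real"
  assumes [measurable]: "g1 \<in> borel_measurable m" "g2 \<in> borel_measurable m"
    and nn: "\<And>x. x \<in> space m \<Longrightarrow> 0 \<le> g1 x" "\<And>x. x \<in> space m \<Longrightarrow> 0 \<le> g2 x"
    and \<alpha>: "0 < \<alpha>" and fin: "(\<integral>\<^sup>+x. ennreal ((g1 x + g2 x) powr \<alpha>) \<partial>m) < \<infinity>"
  shows "(\<lambda>n. \<integral>\<^sup>+x. ennreal (\<bar>(dyadic_floor n (g1 x) - dyadic_floor n (g2 x)) - (g1 x - g2 x)\<bar> powr \<alpha>) \<partial>m) \<longlonglongrightarrow> 0"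
proof -
  have "(\<lambda>n. \<integral>\<^sup>+x. ennreal (\<bar>(dyadic_floor n (g1 x) - dyadic_floor n (g2 x)) - (g1 x - g2 x)\<bar> powr \<alpha>) \<partial>m)
    \<longlonglongrightarrow> (\<integral>\<^sup>+x. 0 \<partial>m)"
  proof (rule nn_integral_dominated_convergence[where w = "\<lambda>x. ennreal ((g1 x + g2 x) powr \<alpha>)"])
    show "AE x in m. ennreal (\<bar>(dyadic_floor n (g1 x) - dyadic_floor n (g2 x)) - (g1 x - g2 x)\<bar> powr \<alpha>)
        \<le> ennreal ((g1 x + g2 x) powr \<alpha>)" for n
      using nn \<alpha> by (intro AE_I2 ennreal_leI powr_mono2 dyadic_floor_difference_bounds) auto
    show "AE x in m. (\<lambda>n. ennreal (\<bar>(dyadic_floor n (g1 x) - dyadic_floor n (g2 x)) - (g1 x - g2 x)\<bar> powr \<alpha>)) \<longlonglongrightarrow> 0"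
    proof (intro AE_I2)
      fix x
      have "(\<lambda>n. \<bar>(dyadic_floor n (g1 x) - dyadic_floor n (g2 x)) - (g1 x - g2 x)\<bar>) \<longlonglongrightarrow> \<bar>(g1 x - g2 x) - (g1 x - g2 x)\<bar>"
        by (intro tendsto_intros dyadic_floor_tendsto)
      then have "(\<lambda>n. \<bar>(dyadic_floor n (g1 x) - dyadic_floor n (g2 x)) - (g1 x - g2 x)\<bar> powr \<alpha>) \<longlonglongrightarrow> 0 powr \<alpha>"
        using \<alpha> by (intro tendsto_powr' tendsto_const) auto
      then have "(\<lambda>n. ennreal (\<bar>(dyadic_floor n (g1 x) - dyadic_floor n (g2 x)) - (g1 x - g2 x)\<bar> powr \<alpha>)) \<longlonglongrightarrow> ennreal (0 powr \<alpha>)"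
        by (rule tendsto_ennrealI)
      then show "(\<lambda>n. ennreal (\<bar>(dyadic_floor n (g1 x) - dyadic_floor n (g2 x)) - (g1 x - g2 x)\<bar> powr \<alpha>)) \<longlonglongrightarrow> 0"
        by simp
    qed
    show "(\<integral>\<^sup>+x. ennreal ((g1 x + g2 x) powr \<alpha>) \<partial>m) < \<infinity>" by (rule fin)
  qed measurable
  then show ?thesis by simp
qed

context stable_measure
begin

lemma AE_tendsto_imp_conv_in_probability:
  assumes [measurable]: "\<And>n. Z n \<in> borel_measurable P" "Y \<in> borel_measurable P"
    and lim: "AE \<omega> in P. (\<lambda>n. Z n \<omega>) \<longlonglongrightarrow> Y \<omega>"
  shows "conv_in_probability P Z Y"
  unfolding conv_in_probability_def
proof (intro allI impI)
  fix r :: real assume r: "0 < r"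
  let ?E = "\<lambda>n. {\<omega> \<in> space P. r < \<bar>Z n \<omega> - Y \<omega>\<bar>}"
  have "(\<lambda>n. \<integral>\<omega>. indicator (?E n) \<omega> \<partial>P) \<longlonglongrightarrow> (\<integral>\<omega>. (0::real) \<partial>P)"
  proof (rule integral_dominated_convergence[where w = "\<lambda>_. 1"])
    show "AE \<omega> in P. (\<lambda>n. indicator (?E n) \<omega>) \<longlonglongrightarrow> (0::real)"
      using lim
    proof eventually_elim
      case (elim \<omega>)
      then have "\<forall>\<^sub>F n in sequentially. dist (Z n \<omega>) (Y \<omega>) < r" using r by (rule tendstoD)
      then have "\<forall>\<^sub>F n in sequentially. indicator (?E n) \<omega> = (0::real)"
        by eventually_elim (auto simp: dist_real_def indicator_def)
      then show ?case by (rule tendsto_eventually)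
    qed
  qed (auto simp: indicator_def)
  then show "(\<lambda>n. prob (?E n)) \<longlonglongrightarrow> 0" by simp
qed

text \<open>
  Along a subsequence whose approximation errors decrease fast enough, the simple integrals converge
  almost surely by the Borel-Cantelli lemma. The subsequence is itself an admissible approximating
  sequence.
\<close>

lemma stable_integral_exists_of_approximation:
  assumes [measurable]: "g \<in> borel_measurable m" and fin: "(\<integral>\<^sup>+x. ennreal (\<bar>g x\<bar> powr \<alpha>) \<partial>m) < \<infinity>"
    and q: "\<And>n. finitely_supported_simple m (q n)"
    and lim: "(\<lambda>n::nat. \<integral>\<^sup>+x. ennreal (\<bar>q n x - g x\<bar> powr \<alpha>) \<partial>m) \<longlonglongrightarrow> 0"
  shows "\<exists>Y. stable_int g Y"
proof -
  \<comment> \<open>The second factor compensates the threshold \<open>(1/2) ^ k\<close> in the tail bound, leaving summable probabilities.\<close>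
  define \<delta> where "\<delta> k = (1/2) ^ k * ((1/2) ^ k) powr \<alpha>" for k :: nat
  have \<delta>: "0 < \<delta> k" for k by (simp add: \<delta>_def)
  define d where "d n = (\<integral>\<^sup>+x. ennreal (\<bar>q n x - g x\<bar> powr \<alpha>) \<partial>m)" for n
  have "\<exists>n. d n < ennreal (\<delta> k) \<and> k \<le> n" for k
  proof -
    have "\<forall>\<^sub>F n in sequentially. d n < ennreal (\<delta> k)"
      using lim \<delta>[of k] unfolding d_def by (intro order_tendstoD(2)) auto
    then have "\<forall>\<^sub>F n in sequentially. d n < ennreal (\<delta> k) \<and> k \<le> n"
      using eventually_ge_at_top by (rule eventually_conj)
    then show ?thesis by (auto dest: eventually_happens)
  qed
  then obtain \<rho> where \<rho>: "\<And>k. d (\<rho> k) < ennreal (\<delta> k)" "\<And>k. k \<le> \<rho> k" by metis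
  define s where "s k = q (\<rho> k)" for k
  have s: "finitely_supported_simple m (s k)" for k using q by (simp add: s_def)
  note [measurable] = s[THEN simple_stable_integral_measurable] s[THEN finitely_supported_simple_measurable]
  have lims: "(\<lambda>n::nat. \<integral>\<^sup>+x. ennreal (\<bar>s n x - g x\<bar> powr \<alpha>) \<partial>m) \<longlonglongrightarrow> 0"
  proof -
    have "filterlim \<rho> at_top sequentially"
      using \<rho>(2) by (intro filterlim_at_top_mono[OF filterlim_ident]) auto
    then show ?thesis unfolding s_def by (rule filterlim_compose[OF lim])
  qed
  define A where "A k = {\<omega> \<in> space P. (1/2) ^ k < \<bar>I (s (Suc k)) \<omega> - I (s k) \<omega>\<bar>}" for k
  define C where "C = tail_const \<alpha> * (3 powr \<alpha> * 2)"
  have C: "0 \<le> C" using tail_const_nonneg[OF alpha_pos] by (simp add: C_def)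
  have pA: "prob (A k) \<le> C * (1/2) ^ k" for k
  proof -
    have "(\<integral>\<^sup>+x. ennreal (\<bar>s (Suc k) x - s k x\<bar> powr \<alpha>) \<partial>m)
      = (\<integral>\<^sup>+x. ennreal (\<bar>(s (Suc k) x - g x) + (g x - s k x) + 0\<bar> powr \<alpha>) \<partial>m)"
      by simp
    also have "\<dots> \<le> ennreal (3 powr \<alpha>) * ((\<integral>\<^sup>+x. ennreal (\<bar>s (Suc k) x - g x\<bar> powr \<alpha>) \<partial>m)
        + (\<integral>\<^sup>+x. ennreal (\<bar>g x - s k x\<bar> powr \<alpha>) \<partial>m) + (\<integral>\<^sup>+x. ennreal (\<bar>0\<bar> powr \<alpha>) \<partial>m))"
      by (rule nn_integral_powr_sum3_le[OF _ _ _ alpha_pos]) measurable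
    also have "\<dots> = ennreal (3 powr \<alpha>) * (d (\<rho> (Suc k)) + d (\<rho> k))"
      by (simp add: d_def s_def abs_minus_commute)
    also have "\<dots> \<le> ennreal (3 powr \<alpha>) * (ennreal (\<delta> k) + ennreal (\<delta> k))"
    proof (intro mult_left_mono add_mono)
      have "\<delta> (Suc k) \<le> \<delta> k"
        unfolding \<delta>_def using alpha_pos by (intro mult_mono powr_mono2) auto
      then show "d (\<rho> (Suc k)) \<le> ennreal (\<delta> k)"
        using \<rho>(1)[of "Suc k"] by (meson ennreal_leI less_imp_le order_trans)
      show "d (\<rho> k) \<le> ennreal (\<delta> k)" using \<rho>(1)[of k] by simp
    qed simp
    also have "\<dots> = ennreal (3 powr \<alpha> * 2 * \<delta> k)"
      using \<delta>[of k] by (simp add: ennreal_plus[symmetric] ennreal_mult[symmetric] mult_ac del: ennreal_plus)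
    finally have i: "(\<integral>\<^sup>+x. ennreal (\<bar>s (Suc k) x - s k x\<bar> powr \<alpha>) \<partial>m) \<le> ennreal (3 powr \<alpha> * 2 * \<delta> k)" .
    have "ennreal (prob (A k)) \<le> ennreal (tail_const \<alpha> * ((1/2) ^ k) powr (-\<alpha>)) * (\<integral>\<^sup>+x. ennreal (\<bar>s (Suc k) x - s k x\<bar> powr \<alpha>) \<partial>m)"
      unfolding A_def by (intro simple_stable_integral_tail s) simp
    also have "\<dots> \<le> ennreal (tail_const \<alpha> * ((1/2) ^ k) powr (-\<alpha>)) * ennreal (3 powr \<alpha> * 2 * \<delta> k)"
      using i by (rule mult_left_mono) simp
    also have "\<dots> = ennreal (C * (1/2) ^ k)"
      using tail_const_nonneg[OF alpha_pos] \<delta>[of k]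
      by (subst ennreal_mult[symmetric]) (auto simp: C_def \<delta>_def powr_minus field_simps)
    finally show ?thesis using C by simp
  qed
  have "AE \<omega> in P. \<forall>\<^sub>F k in sequentially. \<omega> \<in> space P - A k"
  proof (rule borel_cantelli_AE1)
    show "A k \<in> events" for k unfolding A_def by measurable
    show "summable (\<lambda>k. prob (A k))"
      by (rule summable_comparison_test_ev[of _ "\<lambda>k. C * (1/2) ^ k"])
         (use pA in \<open>auto intro!: summable_mult summable_geometric\<close>)
  qed (simp add: emeasure_eq_measure)
  then have conv: "AE \<omega> in P. convergent (\<lambda>k. I (s k) \<omega>)"
  proof eventually_elim
    case (elim \<omega>)
    then have "\<forall>\<^sub>F k in sequentially. norm (I (s (Suc k)) \<omega> - I (s k) \<omega>) \<le> (1/2) ^ k"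
      by eventually_elim (auto simp: A_def)
    then have "summable (\<lambda>k. I (s (Suc k)) \<omega> - I (s k) \<omega>)"
      by (rule summable_comparison_test_ev) (simp add: summable_geometric)
    then have "convergent (\<lambda>n. \<Sum>k<n. I (s (Suc k)) \<omega> - I (s k) \<omega>)"
      by (simp add: summable_iff_convergent)
    then have "convergent (\<lambda>n. (I (s n) \<omega> - I (s 0) \<omega>) + I (s 0) \<omega>)"
      unfolding sum_lessThan_telescope[of "\<lambda>k. I (s k) \<omega>"] by (intro convergent_add convergent_const)
    then show ?case by simp
  qed
  define Y where "Y \<omega> = lim (\<lambda>k. I (s k) \<omega>)" for \<omega>
  have Ym[measurable]: "Y \<in> borel_measurable P" unfolding Y_def[abs_def] by measurable
  have "AE \<omega> in P. (\<lambda>k. I (s k) \<omega>) \<longlonglongrightarrow> Y \<omega>"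
    using conv by eventually_elim (simp add: Y_def convergent_LIMSEQ_iff)
  then have "conv_in_probability P (\<lambda>k. I (s k)) Y"
    by (intro AE_tendsto_imp_conv_in_probability) auto
  then have "stable_int g Y"
    using fin lims s unfolding has_stable_integral_def finitely_supported_simple_def
    by (intro conjI exI[of _ s]) auto
  then show ?thesis by blast
qed

end

section \<open>Chains of stable integrals\<close>

context stable_measure
begin

text \<open>
  Here \<open>H\<close> is the level of truncation. The first term pays for values beyond \<open>H\<close>; in the second,
  \<open>16 = 2 * 8\<close> comes from two monotone families of weights and from the constant 8 in the bound for
  the truncated second moment.
\<close>

definition chain_const :: "real \<Rightarrow> real \<Rightarrow> nat \<Rightarrow> real" where
  "chain_const H e L = tail_const \<alpha> * H powr (-\<alpha>) + 16 * H powr (2 - \<alpha>) / (e\<^sup>2 * real L)"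

text \<open>
  With \<open>c i\<close> the total of both coefficients at the last time, the variables \<open>\<zeta> i = c i * M (A i)\<close> have
  parameters that add up to the integral of \<open>(q1 n + q2 n) powr \<alpha>\<close>, and the weights \<open>u1 i k / c i\<close>,
  \<open>u2 i k / c i\<close> are nondecreasing in \<open>k\<close> with values in \<open>[0,1]\<close>. So the bound depends neither on the
  partition nor on the number of times.
\<close>

lemma simple_integral_chain_probability:
  fixes q1 q2 :: "nat \<Rightarrow> 'e \<Rightarrow> real"
  assumes q1: "\<And>k. k \<le> n \<Longrightarrow> finitely_supported_simple m (q1 k)" "\<And>k x. k \<le> n \<Longrightarrow> x \<in> space m \<Longrightarrow> 0 \<le> q1 k x"
      "\<And>x. x \<in> space m \<Longrightarrow> mono_on {..n} (\<lambda>k. q1 k x)"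
    and q2: "\<And>k. k \<le> n \<Longrightarrow> finitely_supported_simple m (q2 k)" "\<And>k x. k \<le> n \<Longrightarrow> x \<in> space m \<Longrightarrow> 0 \<le> q2 k x"
      "\<And>x. x \<in> space m \<Longrightarrow> mono_on {..n} (\<lambda>k. q2 k x)"
    and \<sigma>: "(\<integral>\<^sup>+x. ennreal ((q1 n x + q2 n x) powr \<alpha>) \<partial>m) \<le> ennreal \<sigma>" "0 \<le> \<sigma>"
    and pos: "0 < e" "0 < H" "0 < L"
  shows "prob {\<omega> \<in> space P. has_chain (\<lambda>k. I (\<lambda>x. q1 k x - q2 k x) \<omega>) {..n} (5 * e) L} \<le> \<sigma> * chain_const H e L"
proof -
  define K where "K = {..n} \<times> (UNIV :: bool set)"
  define ss where "ss = (\<lambda>(k, b). if b then q1 k else q2 k)"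
  have fK: "finite K" by (simp add: K_def)
  have fss: "finitely_supported_simple m (ss k)" if "k \<in> K" for k
    using that q1(1) q2(1) by (auto simp: K_def ss_def split: prod.splits)
  obtain N A v where A: "\<And>i. i < N \<Longrightarrow> A i \<in> E\<^sub>0" "\<And>i. i < N \<Longrightarrow> A i \<noteq> {}"
    and disj: "disjoint_family_on A {..<N::nat}" and cK: "\<And>k. k \<in> K \<Longrightarrow> carried_by m N A (ss k) (\<lambda>i. v i k)"
    and ne: "\<And>i. i < N \<Longrightarrow> \<exists>k\<in>K. v i k \<noteq> 0"
    by (rule common_partition[of K m ss, OF fK fss]) auto
  define u1 where "u1 i k = v i (k, True)" for i k
  define u2 where "u2 i k = v i (k, False)" for i k
  have c1: "carried_by m N A (q1 k) (\<lambda>i. u1 i k)" and c2: "carried_by m N A (q2 k) (\<lambda>i. u2 i k)" if "k \<le> n" for k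
    using cK[of "(k, True)"] cK[of "(k, False)"] that by (auto simp: K_def ss_def u1_def u2_def)
  have u: "mono_on {..n} (u1 i)" "\<And>k. k \<le> n \<Longrightarrow> 0 \<le> u1 i k" "mono_on {..n} (u2 i)" "\<And>k. k \<le> n \<Longrightarrow> 0 \<le> u2 i k"
    if i: "i < N" for i
  proof -
    obtain x where x: "x \<in> A i" using A(2)[OF i] by blast
    then have xm: "x \<in> space m" using A(1)[OF i] sets.sets_into_space by (auto simp: finite_measure_sets_def)
    have e1: "u1 i k = q1 k x" and e2: "u2 i k = q2 k x" if "k \<le> n" for k
      using c1[OF that] c2[OF that] i x by (auto simp: carried_by_def)
    show "0 \<le> u1 i k" "0 \<le> u2 i k" if "k \<le> n" for k
      using q1(2)[OF that xm] q2(2)[OF that xm] e1 e2 that by auto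
    show "mono_on {..n} (u1 i)" using q1(3)[OF xm] e1 by (auto simp: mono_on_def)
    show "mono_on {..n} (u2 i)" using q2(3)[OF xm] e2 by (auto simp: mono_on_def)
  qed
  define c where "c i = u1 i n + u2 i n" for i
  have le: "u1 i k \<le> c i" "u2 i k \<le> c i" if "i < N" "k \<le> n" for i k
    using u(2,4)[OF that(1), of n] mono_onD[OF u(1)[OF that(1)], of k n] mono_onD[OF u(3)[OF that(1)], of k n] that
    by (auto simp: c_def)
  have cpos: "0 < c i" if i: "i < N" for i
  proof -
    obtain k b where k: "k \<le> n" "v i (k, b) \<noteq> 0" using ne[OF i] by (auto simp: K_def)
    then have "u1 i k \<noteq> 0 \<or> u2 i k \<noteq> 0" by (cases b) (auto simp: u1_def u2_def)
    then have "0 < u1 i k \<or> 0 < u2 i k" using u(2,4)[OF i k(1)] by auto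
    then show ?thesis using le[OF i k(1)] by auto
  qed
  define \<zeta> where "\<zeta> i \<omega> = c i * M (A i) \<omega>" for i \<omega>
  define \<mu> where "\<mu> i = \<bar>c i\<bar> powr \<alpha> * measure m (A i)" for i
  have ind: "indep_vars (\<lambda>_. borel) \<zeta> {..<N}"
    unfolding \<zeta>_def by (rule indep_vars_compose2[OF random_measure_indep[OF A(1) disj]]) auto
  have sas: "sas_variable \<alpha> (\<mu> i) (\<zeta> i)" if "i < N" for i
    unfolding \<mu>_def \<zeta>_def by (intro sas_variable_scale random_measure_sas A that)
  define X where "X \<omega> k = (\<Sum>i<N. (u1 i k / c i - u2 i k / c i) * \<zeta> i \<omega>)" for \<omega> k
  have s\<mu>: "(\<Sum>i<N. \<mu> i) \<le> \<sigma>"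
  proof -
    have "carried_by m N A (\<lambda>x. q1 n x + q2 n x) c"
      using carried_by_linear[OF c1[of n] c2[of n], of 1 1] by (simp add: c_def[abs_def])
    then have "ennreal (\<Sum>i<N. \<mu> i) = (\<integral>\<^sup>+x. ennreal (\<bar>q1 n x + q2 n x\<bar> powr \<alpha>) \<partial>m)"
      unfolding \<mu>_def by (intro carried_by_nn_integral[OF A(1) disj, of _ _ "\<lambda>y. \<bar>y\<bar> powr \<alpha>", symmetric]) auto
    also have "\<dots> = (\<integral>\<^sup>+x. ennreal ((q1 n x + q2 n x) powr \<alpha>) \<partial>m)"
      using q1(2) q2(2) by (intro nn_integral_cong) simp
    finally have "ennreal (\<Sum>i<N. \<mu> i) \<le> ennreal \<sigma>" using \<sigma>(1) by simp
    then show ?thesis using \<sigma>(2) by (simp add: ennreal_le_iff)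
  qed
  have sm: "finitely_supported_simple m (\<lambda>x. q1 k x - q2 k x)" if "k \<le> n" for k
    using q1(1) q2(1) that by (intro finitely_supported_simple_diff)
  have [measurable]: "I (\<lambda>x. q1 k x - q2 k x) \<in> borel_measurable P" if "k \<le> n" for k
    using sm[OF that] by (rule simple_stable_integral_measurable)
  have \<zeta>m: "\<zeta> i \<in> borel_measurable P" if "i < N" for i
    using sas[OF that] by (simp add: sas_variable_def)
  have Xm: "(\<lambda>\<omega>. X \<omega> k) \<in> borel_measurable P" for k
    unfolding X_def using \<zeta>m by (intro borel_measurable_sum borel_measurable_times) auto
  have "AE \<omega> in P. \<forall>k\<in>{..n}. I (\<lambda>x. q1 k x - q2 k x) \<omega> = X \<omega> k"
  proof (intro AE_finite_allI)
    fix k assume "k \<in> {..n}"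
    then have k: "k \<le> n" by simp
    have "carried_by m N A (\<lambda>x. q1 k x - q2 k x) (\<lambda>i. u1 i k - u2 i k)"
      using carried_by_linear[OF c1[OF k] c2[OF k], of 1 "-1"] by simp
    from simple_stable_integral_carried_by[OF A disj this]
    have "AE \<omega> in P. I (\<lambda>x. q1 k x - q2 k x) \<omega> = (\<Sum>i<N. (u1 i k - u2 i k) * M (A i) \<omega>)" by simp
    moreover have "(\<Sum>i<N. (u1 i k - u2 i k) * M (A i) \<omega>) = X \<omega> k" for \<omega>
      unfolding X_def \<zeta>_def
    proof (intro sum.cong refl)
      fix i assume "i \<in> {..<N}"
      then have "c i \<noteq> 0" using cpos[of i] by simp
      then show "(u1 i k - u2 i k) * M (A i) \<omega> = (u1 i k / c i - u2 i k / c i) * (c i * M (A i) \<omega>)"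
        by (simp add: diff_divide_distrib[symmetric])
    qed
    ultimately show "AE \<omega> in P. I (\<lambda>x. q1 k x - q2 k x) \<omega> = X \<omega> k" by simp
  qed simp
  then have "AE \<omega> in P. has_chain (\<lambda>k. I (\<lambda>x. q1 k x - q2 k x) \<omega>) {..n} (5 * e) L \<longleftrightarrow> has_chain (X \<omega>) {..n} (5 * e) L"
  proof eventually_elim
    case (elim \<omega>)
    then show ?case by (auto intro: has_chain_perturb[where d = 0])
  qed
  then have "prob {\<omega> \<in> space P. has_chain (\<lambda>k. I (\<lambda>x. q1 k x - q2 k x) \<omega>) {..n} (5 * e) L}
      = prob {\<omega> \<in> space P. has_chain (X \<omega>) {..n} (5 * e) L}"
  proof (intro measure_eq_AE)
    show "{\<omega> \<in> space P. has_chain (\<lambda>k. I (\<lambda>x. q1 k x - q2 k x) \<omega>) {..n} (5 * e) L} \<in> events"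
      by (intro has_chain_measurable) auto
    show "{\<omega> \<in> space P. has_chain (X \<omega>) {..n} (5 * e) L} \<in> events"
      by (intro has_chain_measurable Xm) auto
  qed auto
  also have "\<dots> \<le> (\<Sum>i<N. prob {\<omega> \<in> space P. H < \<bar>\<zeta> i \<omega>\<bar>})
      + 2 * (\<Sum>i<N. expectation (\<lambda>\<omega>. (\<zeta> i \<omega>)\<^sup>2 * of_bool (\<bar>\<zeta> i \<omega>\<bar> \<le> H))) / (e\<^sup>2 * real L)"
    unfolding X_def
  proof (intro has_chain_probability_bound[OF ind])
    fix i assume "i \<in> {..<N}"
    then have i: "i < N" by simp
    show "expectation (\<lambda>\<omega>. \<zeta> i \<omega> * of_bool (\<bar>\<zeta> i \<omega>\<bar> \<le> H)) = 0"
      by (rule sas_variable_truncated_mean[OF sas[OF i]])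
    show "mono_on {..n} (\<lambda>k. u1 i k / c i) \<and> (\<lambda>k. u1 i k / c i) ` {..n} \<subseteq> {0..1}"
      using u(1,2)[OF i] le[OF i] cpos[OF i] by (auto simp: mono_on_def divide_right_mono)
    show "mono_on {..n} (\<lambda>k. u2 i k / c i) \<and> (\<lambda>k. u2 i k / c i) ` {..n} \<subseteq> {0..1}"
      using u(3,4)[OF i] le[OF i] cpos[OF i] by (auto simp: mono_on_def divide_right_mono)
  qed (use pos in auto)
  also have "\<dots> \<le> (\<Sum>i<N. tail_const \<alpha> * \<mu> i * H powr (-\<alpha>)) + 2 * (\<Sum>i<N. 8 * \<mu> i * H powr (2 - \<alpha>)) / (e\<^sup>2 * real L)"
    using pos alpha_pos sas
    by (intro add_mono divide_right_mono mult_left_mono sum_mono sas_variable_tail sas_variable_truncated_second_moment) auto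
  also have "\<dots> = (\<Sum>i<N. \<mu> i) * chain_const H e L"
    by (simp add: chain_const_def sum_distrib_left[symmetric] sum_distrib_right[symmetric] algebra_simps)
  also have "\<dots> \<le> \<sigma> * chain_const H e L"
    using s\<mu> tail_const_nonneg[OF alpha_pos] pos by (intro mult_right_mono) (auto simp: chain_const_def)
  finally show ?thesis .
qed

text \<open>
  The dyadic roundings of the integrands keep all monotonicity hypotheses. The step from \<open>5 * e\<close> to
  \<open>6 * e\<close> leaves room for an approximation error \<open>e / 2\<close> at both ends of each oscillation; the
  probability of a larger error vanishes in the limit.
\<close>

lemma stable_integral_chain_probability:
  fixes g1 g2 :: "nat \<Rightarrow> 'e \<Rightarrow> real"
  assumes g1: "\<And>k. k \<le> n \<Longrightarrow> g1 k \<in> borel_measurable m" "\<And>k x. k \<le> n \<Longrightarrow> x \<in> space m \<Longrightarrow> 0 \<le> g1 k x"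
      "\<And>x. x \<in> space m \<Longrightarrow> mono_on {..n} (\<lambda>k. g1 k x)"
    and g2: "\<And>k. k \<le> n \<Longrightarrow> g2 k \<in> borel_measurable m" "\<And>k x. k \<le> n \<Longrightarrow> x \<in> space m \<Longrightarrow> 0 \<le> g2 k x"
      "\<And>x. x \<in> space m \<Longrightarrow> mono_on {..n} (\<lambda>k. g2 k x)"
    and \<sigma>: "(\<integral>\<^sup>+x. ennreal ((g1 n x + g2 n x) powr \<alpha>) \<partial>m) \<le> ennreal \<sigma>" "0 \<le> \<sigma>"
    and Y: "\<And>k. k \<le> n \<Longrightarrow> stable_int (\<lambda>x. g1 k x - g2 k x) (Y k)"
    and pos: "0 < e" "0 < H" "0 < L"
  shows "prob {\<omega> \<in> space P. has_chain (\<lambda>k. Y k \<omega>) {..n} (6 * e) L} \<le> \<sigma> * chain_const H e L"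
proof -
  define q1 where "q1 N k x = dyadic_floor N (g1 k x)" for N k x
  define q2 where "q2 N k x = dyadic_floor N (g2 k x)" for N k x
  have le: "g1 k x \<le> g1 n x" "g2 k x \<le> g2 n x" if "k \<le> n" "x \<in> space m" for k x
    using mono_onD[OF g1(3)[OF that(2)], of k n] mono_onD[OF g2(3)[OF that(2)], of k n] that by auto
  have \<sigma>k: "(\<integral>\<^sup>+x. ennreal (\<bar>h x\<bar> powr \<alpha>) \<partial>m) < \<infinity>"
    if h: "\<And>x. x \<in> space m \<Longrightarrow> \<bar>h x\<bar> \<le> g1 k x + g2 k x" and k: "k \<le> n" for h k
  proof -
    have "(\<integral>\<^sup>+x. ennreal (\<bar>h x\<bar> powr \<alpha>) \<partial>m) \<le> (\<integral>\<^sup>+x. ennreal ((g1 n x + g2 n x) powr \<alpha>) \<partial>m)"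
    proof (intro nn_integral_mono ennreal_leI powr_mono2)
      fix x assume "x \<in> space m"
      then show "\<bar>h x\<bar> \<le> g1 n x + g2 n x" using h[of x] le[OF k, of x] by linarith
    qed (use alpha_pos in auto)
    also have "\<dots> < \<infinity>" using \<sigma> by (auto simp: order_le_less_trans)
    finally show ?thesis .
  qed
  have q1f: "finitely_supported_simple m (q1 N k)" if "k \<le> n" for N k
    unfolding q1_def using g1 g2(2) that alpha_pos
    by (intro finitely_supported_simple_dyadic_floor[OF _ _ alpha_pos] \<sigma>k[OF _ that]) auto
  have q2f: "finitely_supported_simple m (q2 N k)" if "k \<le> n" for N k
    unfolding q2_def using g2 g1(2) that alpha_pos
    by (intro finitely_supported_simple_dyadic_floor[OF _ _ alpha_pos] \<sigma>k[OF _ that]) auto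
  have qf: "finitely_supported_simple m (\<lambda>x. q1 N k x - q2 N k x)" if "k \<le> n" for N k
    using q1f[OF that] q2f[OF that] by (rule finitely_supported_simple_diff)
  have Im[measurable]: "I (\<lambda>x. q1 N k x - q2 N k x) \<in> borel_measurable P" if "k \<le> n" for N k
    using qf[OF that] by (rule simple_stable_integral_measurable)
  have Ym[measurable]: "Y k \<in> borel_measurable P" if "k \<le> n" for k
    using Y[OF that] by (rule stable_integral_measurable)
  have conv: "conv_in_probability P (\<lambda>N. I (\<lambda>x. q1 N k x - q2 N k x)) (Y k)" if k: "k \<le> n" for k
  proof (rule stable_integral_conv_in_probability[OF _ Y[OF k]])
    show "stable_int (\<lambda>x. q1 N k x - q2 N k x) (I (\<lambda>x. q1 N k x - q2 N k x))" for N
      using g1(2)[OF k] g2(2)[OF k]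
      by (intro stable_integral_simple qf k \<sigma>k[OF _ k]) (auto simp: q1_def q2_def intro: dyadic_floor_difference_bounds)
    show "(\<lambda>N. \<integral>\<^sup>+x. ennreal (\<bar>q1 N k x - q2 N k x - (g1 k x - g2 k x)\<bar> powr \<alpha>) \<partial>m) \<longlonglongrightarrow> 0"
      unfolding q1_def q2_def
    proof (rule dyadic_floor_converges_in_powr)
      have "(\<integral>\<^sup>+x. ennreal (\<bar>g1 k x + g2 k x\<bar> powr \<alpha>) \<partial>m) < \<infinity>"
        using g1(2)[OF k] g2(2)[OF k] by (intro \<sigma>k[OF _ k]) auto
      also have "(\<integral>\<^sup>+x. ennreal (\<bar>g1 k x + g2 k x\<bar> powr \<alpha>) \<partial>m) = (\<integral>\<^sup>+x. ennreal ((g1 k x + g2 k x) powr \<alpha>) \<partial>m)"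
        using g1(2)[OF k] g2(2)[OF k] by (intro nn_integral_cong) simp
      finally show "(\<integral>\<^sup>+x. ennreal ((g1 k x + g2 k x) powr \<alpha>) \<partial>m) < \<infinity>" .
    qed (use g1 g2 k alpha_pos in auto)
  qed
  let ?C = "{\<omega> \<in> space P. has_chain (\<lambda>k. Y k \<omega>) {..n} (6 * e) L}"
  let ?F = "\<lambda>N k. {\<omega> \<in> space P. e / 2 < \<bar>I (\<lambda>x. q1 N k x - q2 N k x) \<omega> - Y k \<omega>\<bar>}"
  have bound: "prob ?C \<le> \<sigma> * chain_const H e L + (\<Sum>k\<le>n. prob (?F N k))" for N
  proof -
    let ?D = "{\<omega> \<in> space P. has_chain (\<lambda>k. I (\<lambda>x. q1 N k x - q2 N k x) \<omega>) {..n} (5 * e) L}"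
    have Dm: "?D \<in> events" by (intro has_chain_measurable) auto
    have Fm: "?F N k \<in> events" if "k \<in> {..n}" for k
    proof -
      have [measurable]: "I (\<lambda>x. q1 N k x - q2 N k x) \<in> borel_measurable P" "Y k \<in> borel_measurable P"
        using that by (auto intro: Im Ym)
      show ?thesis by measurable
    qed
    have "?C \<subseteq> ?D \<union> (\<Union>k\<in>{..n}. ?F N k)"
    proof
      fix \<omega> assume \<omega>: "\<omega> \<in> ?C"
      show "\<omega> \<in> ?D \<union> (\<Union>k\<in>{..n}. ?F N k)"
      proof (cases "\<omega> \<in> (\<Union>k\<in>{..n}. ?F N k)")
        case False
        then have cl: "\<bar>Y k \<omega> - I (\<lambda>x. q1 N k x - q2 N k x) \<omega>\<bar> \<le> e / 2" if "k \<in> {..n}" for k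
          using that \<omega> by (auto simp: abs_minus_commute not_less)
        have "has_chain (\<lambda>k. I (\<lambda>x. q1 N k x - q2 N k x) \<omega>) {..n} (5 * e) L"
          by (rule has_chain_perturb[of "\<lambda>k. Y k \<omega>" _ "6 * e" _ _ "e / 2"]) (use \<omega> cl in auto)
        then show ?thesis using \<omega> by simp
      qed simp
    qed
    then have "prob ?C \<le> prob (?D \<union> (\<Union>k\<in>{..n}. ?F N k))"
      using Dm Fm by (intro finite_measure_mono sets.Un sets.finite_UN) auto
    also have "\<dots> \<le> prob ?D + prob (\<Union>k\<in>{..n}. ?F N k)"
      using Dm Fm by (intro measure_Un_le sets.finite_UN) auto
    also have "prob (\<Union>k\<in>{..n}. ?F N k) \<le> (\<Sum>k\<le>n. prob (?F N k))"
      using Fm by (intro finite_measure_subadditive_finite) auto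
    also have "prob ?D \<le> \<sigma> * chain_const H e L"
    proof (rule simple_integral_chain_probability)
      show "0 \<le> q1 N k x" "0 \<le> q2 N k x" if "k \<le> n" "x \<in> space m" for k x
        using g1(2) g2(2) that by (auto simp: q1_def q2_def intro: dyadic_floor_nonneg)
      show "mono_on {..n} (\<lambda>k. q1 N k x)" "mono_on {..n} (\<lambda>k. q2 N k x)" if "x \<in> space m" for x
        using g1(3) g2(3) that by (auto simp: q1_def q2_def mono_on_def intro: dyadic_floor_mono)
      have "(\<integral>\<^sup>+x. ennreal ((q1 N n x + q2 N n x) powr \<alpha>) \<partial>m) \<le> (\<integral>\<^sup>+x. ennreal ((g1 n x + g2 n x) powr \<alpha>) \<partial>m)"
        using g1(2) g2(2) alpha_pos
        by (intro nn_integral_mono ennreal_leI powr_mono2)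
           (auto simp: q1_def q2_def intro!: add_mono dyadic_floor_le add_nonneg_nonneg dyadic_floor_nonneg)
      then show "(\<integral>\<^sup>+x. ennreal ((q1 N n x + q2 N n x) powr \<alpha>) \<partial>m) \<le> ennreal \<sigma>"
        using \<sigma> by (blast intro: order_trans)
    qed (use q1f q2f \<sigma> pos in auto)
    finally show ?thesis by simp
  qed
  have "(\<lambda>N. \<sigma> * chain_const H e L + (\<Sum>k\<le>n. prob (?F N k))) \<longlonglongrightarrow> \<sigma> * chain_const H e L + (\<Sum>k\<le>n. 0)"
    using pos by (intro tendsto_add tendsto_const tendsto_sum conv[unfolded conv_in_probability_def, rule_format]) auto
  then have "prob ?C \<le> \<sigma> * chain_const H e L + (\<Sum>k\<le>n. 0)"
    by (rule LIMSEQ_le_const) (use bound in auto)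
  then show ?thesis by simp
qed

end

section \<open>Bounded chains and one-sided limits\<close>

lemma has_chain_subset: "has_chain x D e L \<Longrightarrow> D \<subseteq> D' \<Longrightarrow> has_chain x D' e L"
  unfolding has_chain_def by blast

lemma has_chain_reindex:
  fixes g :: "'s::linorder \<Rightarrow> 't::order"
  assumes "has_chain x (g ` D) e L" and g: "strict_mono_on D g"
  shows "has_chain (\<lambda>k. x (g k)) D e L"
proof -
  from assms(1) obtain c where c: "\<forall>i\<le>L. c i \<in> g ` D" "\<forall>i<L. c i < c (Suc i) \<and> e < \<bar>x (c (Suc i)) - x (c i)\<bar>"
    unfolding has_chain_def by blast
  then have "\<forall>i. \<exists>k. i \<le> L \<longrightarrow> k \<in> D \<and> c i = g k" by blast
  then obtain b where b: "\<And>i. i \<le> L \<Longrightarrow> b i \<in> D \<and> c i = g (b i)" by metis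
  have "b i < b (Suc i)" if "i < L" for i
  proof (rule ccontr)
    assume "\<not> b i < b (Suc i)"
    then have "b (Suc i) = b i \<or> b (Suc i) < b i" by auto
    then have "g (b (Suc i)) \<le> g (b i)"
      using strict_mono_onD[OF g, of "b (Suc i)" "b i"] b[of i] b[of "Suc i"] that by (auto simp: less_imp_le)
    moreover have "g (b i) < g (b (Suc i))" using c(2) b[of i] b[of "Suc i"] that by auto
    ultimately show False by simp
  qed
  then show ?thesis unfolding has_chain_def using c b by (intro exI[of _ b]) auto
qed

lemma has_chain_incseq_UN:
  assumes "has_chain x (\<Union>n. F n) e L" and F: "incseq F"
  shows "\<exists>n. has_chain x (F n) e L"
proof -
  from assms(1) obtain c where c: "\<forall>i\<le>L. c i \<in> (\<Union>n. F n)" "\<forall>i<L. c i < c (Suc i) \<and> e < \<bar>x (c (Suc i)) - x (c i)\<bar>"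
    unfolding has_chain_def by blast
  then have "\<forall>i. \<exists>n. i \<le> L \<longrightarrow> c i \<in> F n" by blast
  then obtain b where b: "\<And>i. i \<le> L \<Longrightarrow> c i \<in> F (b i)" by metis
  have "c i \<in> F (Max (b ` {..L}))" if "i \<le> L" for i
    using b[OF that] incseqD[OF F, of "b i" "Max (b ` {..L})"] that by auto
  then show ?thesis unfolding has_chain_def using c(2) by blast
qed

definition bounded_chains :: "(real \<Rightarrow> real) \<Rightarrow> real set \<Rightarrow> bool" where
  "bounded_chains x D \<longleftrightarrow> (\<forall>e>0. \<exists>L. \<not> has_chain x D e L)"

text \<open>
  A chain read backwards is a chain for the reflected function.
\<close>

lemma bounded_chains_uminus:
  assumes "bounded_chains x D"
  shows "bounded_chains (\<lambda>s. x (- s)) (uminus ` D)"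
proof -
  have "has_chain x D e L" if "has_chain (\<lambda>s. x (- s)) (uminus ` D) e L" for e L
  proof -
    from that obtain c where c: "\<forall>i\<le>L. c i \<in> uminus ` D" "\<forall>i<L. c i < c (Suc i) \<and> e < \<bar>x (- c (Suc i)) - x (- c i)\<bar>"
      unfolding has_chain_def by blast
    have "- c (L - i) \<in> D" if "i \<le> L" for i using c(1)[rule_format, of "L - i"] by auto
    moreover have "- c (L - i) < - c (L - Suc i) \<and> e < \<bar>x (- c (L - Suc i)) - x (- c (L - i))\<bar>" if "i < L" for i
      using c(2)[rule_format, of "L - Suc i"] that by (simp add: Suc_diff_Suc abs_minus_commute)
    ultimately show ?thesis unfolding has_chain_def by (intro exI[of _ "\<lambda>i. - c (L - i)"]) auto
  qed
  then show ?thesis using assms unfolding bounded_chains_def by blast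
qed

text \<open>
  If the Cauchy property failed at \<open>t\<close>, then from each point of \<open>D\<close> to the right of \<open>t\<close> one could step
  to a point of \<open>D\<close> closer to \<open>t\<close> whose value differs by more than \<open>e\<close>. Initial pieces of the
  resulting infinite decreasing sequence, read backwards, would be chains of every length.
\<close>

lemma bounded_chains_right_limit:
  assumes bc: "bounded_chains x D" and dense: "\<And>\<delta>. 0 < \<delta> \<Longrightarrow> \<exists>s\<in>D. t < s \<and> s < t + \<delta>"
  shows "\<exists>l. \<forall>e>0. \<exists>\<delta>>0. \<forall>s\<in>D. t < s \<and> s < t + \<delta> \<longrightarrow> \<bar>x s - l\<bar> < e"
proof -
  have cauchy: "\<exists>\<delta>>0. \<forall>s\<in>D. \<forall>s'\<in>D. t < s \<and> s < t + \<delta> \<and> t < s' \<and> s' < t + \<delta> \<longrightarrow> \<bar>x s - x s'\<bar> \<le> 2 * e"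
    if e: "0 < e" for e
  proof (rule ccontr)
    assume not: "\<not> ?thesis"
    have step: "\<exists>w. w \<in> D \<and> t < w \<and> w < u \<and> e < \<bar>x w - x u\<bar>" if u: "u \<in> D" "t < u" for u
    proof -
      have "0 < u - t" using u by simp
      with not have "\<not> (\<forall>s\<in>D. \<forall>s'\<in>D. t < s \<and> s < t + (u - t) \<and> t < s' \<and> s' < t + (u - t) \<longrightarrow> \<bar>x s - x s'\<bar> \<le> 2 * e)"
        by blast
      then obtain s s' where s: "s \<in> D" "s' \<in> D" "t < s" "s < u" "t < s'" "s' < u" "2 * e < \<bar>x s - x s'\<bar>"
        by (auto simp: not_le)
      then have "e < \<bar>x s - x u\<bar> \<or> e < \<bar>x s' - x u\<bar>" by linarith
      with s show ?thesis by blast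
    qed
    obtain u0 where u0: "u0 \<in> D" "t < u0" using dense[of 1] by auto
    have "\<exists>u. \<forall>i. (u i \<in> D \<and> t < u i) \<and> u (Suc i) < u i \<and> e < \<bar>x (u (Suc i)) - x (u i)\<bar>"
    proof (rule dependent_nat_choice)
      show "\<exists>u. u \<in> D \<and> t < u" using u0 by blast
      show "\<exists>w. (w \<in> D \<and> t < w) \<and> w < u \<and> e < \<bar>x w - x u\<bar>" if "u \<in> D \<and> t < u" for u
        using step[of u] that by blast
    qed
    then obtain u where u: "\<And>i. u i \<in> D" "\<And>i. u (Suc i) < u i" "\<And>i::nat. e < \<bar>x (u (Suc i)) - x (u i)\<bar>" by blast
    have "has_chain x D e L" for L
    proof -
      have "u (L - i) < u (L - Suc i) \<and> e < \<bar>x (u (L - Suc i)) - x (u (L - i))\<bar>" if "i < L" for i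
        using u(2,3)[of "L - Suc i"] that by (simp add: Suc_diff_Suc abs_minus_commute)
      then show ?thesis unfolding has_chain_def using u(1) by (intro exI[of _ "\<lambda>i. u (L - i)"]) auto
    qed
    with bc e show False unfolding bounded_chains_def by blast
  qed
  have "\<exists>s\<in>D. t < s \<and> s < t + inverse (real (Suc n))" for n
    by (rule dense) simp
  then obtain s where s: "\<And>n. s n \<in> D" "\<And>n. t < s n" "\<And>n. s n < t + inverse (real (Suc n))" by metis
  have close: "\<exists>N. \<forall>n\<ge>N. s n < t + \<delta>" if \<delta>: "0 < \<delta>" for \<delta>
  proof -
    obtain N where N: "inverse (real (Suc N)) < \<delta>" using reals_Archimedean[OF \<delta>] by blast
    have "s n < t + \<delta>" if "N \<le> n" for n
    proof -
      have "inverse (real (Suc n)) \<le> inverse (real (Suc N))" using that by (intro le_imp_inverse_le) auto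
      with s(3)[of n] N show ?thesis by linarith
    qed
    then show ?thesis by blast
  qed
  have "Cauchy (\<lambda>n. x (s n))"
  proof (rule CauchyI)
    fix e :: real assume "0 < e"
    then obtain \<delta> where \<delta>: "0 < \<delta>" "\<And>s s'. s \<in> D \<Longrightarrow> s' \<in> D \<Longrightarrow> t < s \<Longrightarrow> s < t + \<delta> \<Longrightarrow> t < s' \<Longrightarrow> s' < t + \<delta> \<Longrightarrow> \<bar>x s - x s'\<bar> \<le> 2 * (e / 4)"
      using cauchy[of "e / 4"] by auto
    obtain N where N: "\<And>n. N \<le> n \<Longrightarrow> s n < t + \<delta>" using close[OF \<delta>(1)] by blast
    have "norm (x (s p) - x (s q)) < e" if "N \<le> p" "N \<le> q" for p q
      using \<delta>(2)[OF s(1)[of p] s(1)[of q] s(2) N[OF that(1)] s(2) N[OF that(2)]] \<open>0 < e\<close> by simp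
    then show "\<exists>M. \<forall>p\<ge>M. \<forall>q\<ge>M. norm (x (s p) - x (s q)) < e" by blast
  qed
  then obtain l where l: "(\<lambda>n. x (s n)) \<longlonglongrightarrow> l" using convergentI by (auto simp: Cauchy_convergent_iff convergent_def)
  have "\<exists>\<delta>>0. \<forall>u\<in>D. t < u \<and> u < t + \<delta> \<longrightarrow> \<bar>x u - l\<bar> < e" if e: "0 < e" for e
  proof -
    obtain \<delta> where \<delta>: "0 < \<delta>" "\<And>s s'. s \<in> D \<Longrightarrow> s' \<in> D \<Longrightarrow> t < s \<Longrightarrow> s < t + \<delta> \<Longrightarrow> t < s' \<Longrightarrow> s' < t + \<delta> \<Longrightarrow> \<bar>x s - x s'\<bar> \<le> 2 * (e / 4)"
      using cauchy[of "e / 4"] e by auto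
    obtain N where N: "\<And>n. N \<le> n \<Longrightarrow> s n < t + \<delta>" using close[OF \<delta>(1)] by blast
    have "\<bar>x u - l\<bar> \<le> e / 2" if u: "u \<in> D" "t < u" "u < t + \<delta>" for u
    proof -
      have "(\<lambda>n. \<bar>x u - x (s n)\<bar>) \<longlonglongrightarrow> \<bar>x u - l\<bar>" by (intro tendsto_intros l)
      then show ?thesis
        by (rule LIMSEQ_le_const2) (use \<delta>(2)[OF u(1) s(1) u(2,3) s(2)] N in \<open>auto intro!: exI[of _ N]\<close>)
    qed
    then have "\<bar>x u - l\<bar> < e" if "u \<in> D" "t < u" "u < t + \<delta>" for u
      using that e by fastforce
    then show ?thesis using \<delta>(1) by blast
  qed
  then show ?thesis by blast
qed

lemma bounded_chains_left_limit:
  assumes bc: "bounded_chains x D" and dense: "\<And>\<delta>. 0 < \<delta> \<Longrightarrow> \<exists>s\<in>D. t - \<delta> < s \<and> s < t"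
  shows "\<exists>l. \<forall>e>0. \<exists>\<delta>>0. \<forall>s\<in>D. t - \<delta> < s \<and> s < t \<longrightarrow> \<bar>x s - l\<bar> < e"
proof -
  have "\<exists>l. \<forall>e>0. \<exists>\<delta>>0. \<forall>s\<in>uminus ` D. - t < s \<and> s < - t + \<delta> \<longrightarrow> \<bar>x (- s) - l\<bar> < e"
  proof (rule bounded_chains_right_limit[OF bounded_chains_uminus[OF bc]])
    fix \<delta> :: real assume "0 < \<delta>"
    then obtain s where "s \<in> D" "t - \<delta> < s" "s < t" using dense by blast
    then show "\<exists>s\<in>uminus ` D. - t < s \<and> s < - t + \<delta>" by (intro bexI[of _ "- s"]) auto
  qed
  then obtain l where l: "\<And>e. 0 < e \<Longrightarrow> \<exists>\<delta>>0. \<forall>s\<in>D. - t < - s \<and> - s < - t + \<delta> \<longrightarrow> \<bar>x (- (- s)) - l\<bar> < e"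
    by (auto simp del: minus_minus)
  have "\<exists>\<delta>>0. \<forall>s\<in>D. t - \<delta> < s \<and> s < t \<longrightarrow> \<bar>x s - l\<bar> < e" if "0 < e" for e
    using l[OF that] by (force simp: algebra_simps)
  then show ?thesis by blast
qed

text \<open>
  Each value \<open>y u\<close> is nearly attained by \<open>x\<close> at points of \<open>D\<close> slightly to the right of \<open>u\<close>, so right
  and left limits of \<open>x\<close> along \<open>D\<close> carry over to \<open>y\<close>.
\<close>

lemma cadlag_on_right_limits:
  assumes bc: "bounded_chains x D"
    and dense: "\<And>t \<delta>. 0 \<le> t \<Longrightarrow> t < a \<Longrightarrow> 0 < \<delta> \<Longrightarrow> \<exists>s\<in>D. t < s \<and> s < t + \<delta>"
    and y: "\<And>t e. 0 \<le> t \<Longrightarrow> t < a \<Longrightarrow> 0 < e \<Longrightarrow> \<exists>\<delta>>0. \<forall>s\<in>D. t < s \<and> s < t + \<delta> \<longrightarrow> \<bar>x s - y t\<bar> < e"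
  shows "cadlag_on 0 a y"
proof -
  have near: "\<exists>s\<in>D. u < s \<and> s < b \<and> \<bar>x s - y u\<bar> < e" if u: "0 \<le> u" "u < a" and ub: "u < b" and e: "0 < e" for u b e
  proof -
    obtain \<delta> where \<delta>: "0 < \<delta>" "\<forall>s\<in>D. u < s \<and> s < u + \<delta> \<longrightarrow> \<bar>x s - y u\<bar> < e" using y[OF u e] by blast
    obtain s where "s \<in> D" "u < s" "s < u + min \<delta> (b - u)"
      using dense[OF u, of "min \<delta> (b - u)"] \<delta>(1) ub by auto
    then show ?thesis using \<delta>(2) by (intro bexI[of _ s]) auto
  qed
  show ?thesis
    unfolding cadlag_on_def
  proof (intro conjI allI impI)
    fix t assume t: "0 \<le> t \<and> t < a"
    show "(y \<longlongrightarrow> y t) (at_right t)"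
    proof (rule tendstoI)
      fix e :: real assume e: "0 < e"
      obtain \<delta> where \<delta>: "0 < \<delta>" "\<forall>s\<in>D. t < s \<and> s < t + \<delta> \<longrightarrow> \<bar>x s - y t\<bar> < e / 2"
        using y[of t "e / 2"] t e by auto
      have "dist (y u) (y t) < e" if u: "t < u" "u < min a (t + \<delta>)" for u
      proof -
        obtain s where s: "s \<in> D" "u < s" "s < t + \<delta>" "\<bar>x s - y u\<bar> < e / 2"
          using near[of u "t + \<delta>" "e / 2"] t u e by auto
        then have "\<bar>x s - y t\<bar> < e / 2" using \<delta>(2) u by auto
        with s(4) show ?thesis unfolding dist_real_def by linarith
      qed
      then show "\<forall>\<^sub>F u in at_right t. dist (y u) (y t) < e"
        unfolding eventually_at_right_field using t \<delta>(1) by (intro exI[of _ "min a (t + \<delta>)"]) auto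
    qed
  next
    fix t assume t: "0 < t \<and> t \<le> a"
    have "\<exists>l. \<forall>e>0. \<exists>\<delta>>0. \<forall>s\<in>D. t - \<delta> < s \<and> s < t \<longrightarrow> \<bar>x s - l\<bar> < e"
    proof (rule bounded_chains_left_limit[OF bc])
      fix \<delta> :: real assume "0 < \<delta>"
      then show "\<exists>s\<in>D. t - \<delta> < s \<and> s < t"
        using dense[of "max 0 (t - \<delta>)" "t - max 0 (t - \<delta>)"] t by fastforce
    qed
    then obtain l where l: "\<And>e. 0 < e \<Longrightarrow> \<exists>\<delta>>0. \<forall>s\<in>D. t - \<delta> < s \<and> s < t \<longrightarrow> \<bar>x s - l\<bar> < e" by blast
    have "(y \<longlongrightarrow> l) (at_left t)"
    proof (rule tendstoI)
      fix e :: real assume e: "0 < e"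
      obtain \<delta> where \<delta>: "0 < \<delta>" "\<forall>s\<in>D. t - \<delta> < s \<and> s < t \<longrightarrow> \<bar>x s - l\<bar> < e / 2"
        using l[of "e / 2"] e by auto
      have "dist (y u) l < e" if u: "max 0 (t - \<delta>) < u" "u < t" for u
      proof -
        obtain s where s: "s \<in> D" "u < s" "s < t" "\<bar>x s - y u\<bar> < e / 2"
          using near[of u t "e / 2"] t u e by auto
        then have "\<bar>x s - l\<bar> < e / 2" using \<delta>(2) u by auto
        with s(4) show ?thesis unfolding dist_real_def by linarith
      qed
      then show "\<forall>\<^sub>F u in at_left t. dist (y u) l < e"
        unfolding eventually_at_left_field using t \<delta>(1) by (intro exI[of _ "max 0 (t - \<delta>)"]) auto
    qed
    then show "\<exists>l. (y \<longlongrightarrow> l) (at_left t)" by blast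
  qed
qed

section \<open>Dyadic times and the modification\<close>

definition dyadic_grid :: "real \<Rightarrow> nat \<Rightarrow> real set" where
  "dyadic_grid a N = (\<lambda>k. a * real k / 2 ^ N) ` {..2 ^ N}"

lemma dyadic_grid_subset: "0 < a \<Longrightarrow> dyadic_grid a N \<subseteq> {0..a}"
  by (auto simp: dyadic_grid_def field_simps)

lemma incseq_dyadic_grid: "incseq (dyadic_grid a)"
proof (rule incseq_SucI)
  fix N
  show "dyadic_grid a N \<subseteq> dyadic_grid a (Suc N)"
  proof
    fix t assume "t \<in> dyadic_grid a N"
    then obtain k where "k \<le> 2 ^ N" "t = a * real k / 2 ^ N" by (auto simp: dyadic_grid_def)
    then show "t \<in> dyadic_grid a (Suc N)"
      unfolding dyadic_grid_def by (intro image_eqI[of _ _ "2 * k"]) auto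
  qed
qed

lemma dyadic_grid_dense:
  assumes t: "0 \<le> t" "t < a" and \<delta>: "0 < \<delta>"
  shows "\<exists>s\<in>(\<Union>N. dyadic_grid a N). t < s \<and> s < t + \<delta>"
proof -
  have a: "0 < a" using t by simp
  obtain N where N: "a / \<delta> < 2 ^ N" using real_arch_pow[of 2] by auto
  define k where "k = nat \<lfloor>t * 2 ^ N / a\<rfloor> + 1"
  have k: "real k = real_of_int \<lfloor>t * 2 ^ N / a\<rfloor> + 1" using t a by (simp add: k_def)
  have k1: "t * 2 ^ N / a < real k" and k2: "real k \<le> t * 2 ^ N / a + 1"
    unfolding k by linarith+
  have "t * 2 ^ N / a < 2 ^ N" using t a by (simp add: field_simps)
  then have "\<lfloor>t * 2 ^ N / a\<rfloor> < int (2 ^ N)" by (simp add: floor_less_iff)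
  moreover have "0 \<le> \<lfloor>t * 2 ^ N / a\<rfloor>" using t a by simp
  ultimately have kN: "k \<le> 2 ^ N" unfolding k_def by linarith
  have "t < a * real k / 2 ^ N" using k1 a by (simp add: field_simps)
  moreover have "a * real k / 2 ^ N < t + \<delta>"
  proof -
    have "a * real k / 2 ^ N \<le> a * (t * 2 ^ N / a + 1) / 2 ^ N"
      using k2 a by (intro divide_right_mono mult_left_mono) auto
    also have "\<dots> = t + a / 2 ^ N" using a by (simp add: field_simps)
    also have "\<dots> < t + \<delta>" using N \<delta> by (simp add: field_simps)
    finally show ?thesis .
  qed
  ultimately show ?thesis using kN unfolding dyadic_grid_def by blast
qed

lemma bounded_chains_countable:
  "bounded_chains x D \<longleftrightarrow> (\<forall>j::nat. \<exists>L. \<not> has_chain x D (inverse (real (Suc j))) L)"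
proof
  assume R: "\<forall>j. \<exists>L. \<not> has_chain x D (inverse (real (Suc j))) L"
  show "bounded_chains x D"
    unfolding bounded_chains_def
  proof (intro allI impI)
    fix e :: real assume "0 < e"
    then obtain j where j: "inverse (real (Suc j)) < e" using reals_Archimedean by blast
    obtain L where "\<not> has_chain x D (inverse (real (Suc j))) L" using R by blast
    then have "\<not> has_chain x D e L"
      using has_chain_perturb[of x D e L x 0 "inverse (real (Suc j))"] j by auto
    then show "\<exists>L. \<not> has_chain x D e L" ..
  qed
qed (auto simp: bounded_chains_def)

lemma bounded_chains_measurable:
  assumes D: "countable D" "\<And>t. t \<in> D \<Longrightarrow> X t \<in> borel_measurable M"
  shows "{\<omega> \<in> space M. bounded_chains (\<lambda>t. X t \<omega>) D} \<in> sets M"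
  unfolding bounded_chains_countable
  by (intro sets.sets_Collect_countable_All sets.sets_Collect_countable_Ex sets.sets_Collect_neg has_chain_measurable D)

context stable_measure
begin

lemma stable_integral_exists:
  fixes g1 g2 :: "'e \<Rightarrow> real"
  assumes [measurable]: "g1 \<in> borel_measurable m" "g2 \<in> borel_measurable m"
    and nn: "\<And>x. x \<in> space m \<Longrightarrow> 0 \<le> g1 x" "\<And>x. x \<in> space m \<Longrightarrow> 0 \<le> g2 x"
    and fin: "(\<integral>\<^sup>+x. ennreal ((g1 x + g2 x) powr \<alpha>) \<partial>m) < \<infinity>"
  shows "\<exists>Y. stable_int (\<lambda>x. g1 x - g2 x) Y"
proof -
  have le: "(\<integral>\<^sup>+x. ennreal (\<bar>h x\<bar> powr \<alpha>) \<partial>m) < \<infinity>"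
    if h: "\<And>x. x \<in> space m \<Longrightarrow> \<bar>h x\<bar> \<le> g1 x + g2 x" for h
    using h alpha_pos by (intro le_less_trans[OF _ fin] nn_integral_mono ennreal_leI powr_mono2) auto
  show ?thesis
  proof (rule stable_integral_exists_of_approximation)
    show "(\<integral>\<^sup>+x. ennreal (\<bar>g1 x - g2 x\<bar> powr \<alpha>) \<partial>m) < \<infinity>"
      using nn by (intro le) (simp add: abs_le_iff)
    show "finitely_supported_simple m (\<lambda>x. dyadic_floor n (g1 x) - dyadic_floor n (g2 x))" for n
      using nn by (intro finitely_supported_simple_diff finitely_supported_simple_dyadic_floor[OF _ _ alpha_pos] le) auto
    show "(\<lambda>n. \<integral>\<^sup>+x. ennreal (\<bar>(dyadic_floor n (g1 x) - dyadic_floor n (g2 x)) - (g1 x - g2 x)\<bar> powr \<alpha>) \<partial>m) \<longlonglongrightarrow> 0"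
      by (rule dyadic_floor_converges_in_powr[OF _ _ nn alpha_pos fin]) auto
  qed measurable
qed

lemma conv_in_probability_unique:
  assumes [measurable]: "\<And>n. Z n \<in> borel_measurable P" "Y \<in> borel_measurable P" "Y' \<in> borel_measurable P"
    and Y: "conv_in_probability P Z Y" and Y': "conv_in_probability P Z Y'"
  shows "AE \<omega> in P. Y \<omega> = Y' \<omega>"
proof -
  have "prob {\<omega> \<in> space P. r < \<bar>Y \<omega> - Y' \<omega>\<bar>} = 0" if r: "0 < r" for r
  proof -
    let ?E = "{\<omega> \<in> space P. r < \<bar>Y \<omega> - Y' \<omega>\<bar>}"
    have "prob ?E \<le> prob {\<omega> \<in> space P. r / 2 < \<bar>Z n \<omega> - Y \<omega>\<bar>} + prob {\<omega> \<in> space P. r / 2 < \<bar>Z n \<omega> - Y' \<omega>\<bar>}" for n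
    proof -
      have "?E \<subseteq> {\<omega> \<in> space P. r / 2 < \<bar>Z n \<omega> - Y \<omega>\<bar>} \<union> {\<omega> \<in> space P. r / 2 < \<bar>Z n \<omega> - Y' \<omega>\<bar>}"
      proof
        fix \<omega> assume "\<omega> \<in> ?E"
        then have "\<omega> \<in> space P" and "r < \<bar>Y \<omega> - Y' \<omega>\<bar>" by auto
        moreover from this(2) have "r / 2 < \<bar>Z n \<omega> - Y \<omega>\<bar> \<or> r / 2 < \<bar>Z n \<omega> - Y' \<omega>\<bar>" by linarith
        ultimately show "\<omega> \<in> {\<omega> \<in> space P. r / 2 < \<bar>Z n \<omega> - Y \<omega>\<bar>} \<union> {\<omega> \<in> space P. r / 2 < \<bar>Z n \<omega> - Y' \<omega>\<bar>}" by auto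
      qed
      then have "prob ?E \<le> prob ({\<omega> \<in> space P. r / 2 < \<bar>Z n \<omega> - Y \<omega>\<bar>} \<union> {\<omega> \<in> space P. r / 2 < \<bar>Z n \<omega> - Y' \<omega>\<bar>})"
        by (intro finite_measure_mono) measurable
      also have "\<dots> \<le> prob {\<omega> \<in> space P. r / 2 < \<bar>Z n \<omega> - Y \<omega>\<bar>} + prob {\<omega> \<in> space P. r / 2 < \<bar>Z n \<omega> - Y' \<omega>\<bar>}"
        by (intro measure_Un_le) measurable
      finally show ?thesis .
    qed
    moreover have "(\<lambda>n. prob {\<omega> \<in> space P. r / 2 < \<bar>Z n \<omega> - Y \<omega>\<bar>} + prob {\<omega> \<in> space P. r / 2 < \<bar>Z n \<omega> - Y' \<omega>\<bar>}) \<longlonglongrightarrow> 0 + 0"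
      using r by (intro tendsto_add Y[unfolded conv_in_probability_def, rule_format] Y'[unfolded conv_in_probability_def, rule_format]) auto
    ultimately have "prob ?E \<le> 0 + 0" by (intro LIMSEQ_le_const) auto
    then show ?thesis by (simp add: measure_le_0_iff)
  qed
  then have "AE \<omega> in P. \<not> inverse (real (Suc j)) < \<bar>Y \<omega> - Y' \<omega>\<bar>" for j
    by (intro AE_I'[of "{\<omega> \<in> space P. inverse (real (Suc j)) < \<bar>Y \<omega> - Y' \<omega>\<bar>}"]) (auto simp: null_sets_def emeasure_eq_measure)
  then have "AE \<omega> in P. \<forall>j. \<not> inverse (real (Suc j)) < \<bar>Y \<omega> - Y' \<omega>\<bar>"
    unfolding AE_all_countable by blast
  then show ?thesis
  proof eventually_elim
    case (elim \<omega>)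
    then show ?case using reals_Archimedean[of "\<bar>Y \<omega> - Y' \<omega>\<bar>"] by auto
  qed
qed

context
  fixes a :: real and g1 g2 :: "real \<Rightarrow> 'e \<Rightarrow> real" and X :: "real \<Rightarrow> 'w \<Rightarrow> real"
  assumes a: "0 < a"
    and g1: "\<And>t. t \<in> {0..a} \<Longrightarrow> g1 t \<in> borel_measurable m"
      "\<And>t x. t \<in> {0..a} \<Longrightarrow> x \<in> space m \<Longrightarrow> 0 \<le> g1 t x" "\<And>x. x \<in> space m \<Longrightarrow> mono_on {0..a} (\<lambda>t. g1 t x)"
    and g2: "\<And>t. t \<in> {0..a} \<Longrightarrow> g2 t \<in> borel_measurable m"
      "\<And>t x. t \<in> {0..a} \<Longrightarrow> x \<in> space m \<Longrightarrow> 0 \<le> g2 t x" "\<And>x. x \<in> space m \<Longrightarrow> mono_on {0..a} (\<lambda>t. g2 t x)"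
    and fin: "(\<integral>\<^sup>+x. ennreal ((g1 a x + g2 a x) powr \<alpha>) \<partial>m) < \<infinity>"
    and X: "\<And>t. t \<in> {0..a} \<Longrightarrow> stable_int (\<lambda>x. g1 t x - g2 t x) (X t)"
begin

abbreviation "D \<equiv> (\<Union>N. dyadic_grid a N)"

lemma dyadics_countable: "countable D"
  by (auto simp: dyadic_grid_def)

lemma dyadics_subset: "D \<subseteq> {0..a}"
  using dyadic_grid_subset[OF a] by blast

lemma process_measurable: "t \<in> {0..a} \<Longrightarrow> X t \<in> borel_measurable P"
  using X by (rule stable_integral_measurable)

lemma process_measurable_dyadics: "t \<in> D \<Longrightarrow> X t \<in> borel_measurable P"
  using dyadics_subset by (blast intro: process_measurable)

text \<open>
  The bounds for the finite grids do not depend on the grid, and a chain uses finitely many points, so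
  continuity from below gives the same bound for all dyadic points at once.
\<close>

lemma dyadic_chain_probability:
  assumes pos: "0 < e" "0 < H" "0 < L"
  shows "prob {\<omega> \<in> space P. has_chain (\<lambda>t. X t \<omega>) D (6 * e) L}
    \<le> enn2real (\<integral>\<^sup>+x. ennreal ((g1 a x + g2 a x) powr \<alpha>) \<partial>m) * chain_const H e L"
proof -
  define \<sigma> where "\<sigma> = enn2real (\<integral>\<^sup>+x. ennreal ((g1 a x + g2 a x) powr \<alpha>) \<partial>m)"
  define A where "A F = {\<omega> \<in> space P. has_chain (\<lambda>t. X t \<omega>) F (6 * e) L}" for F
  have Am: "A F \<in> events" if "F \<subseteq> D" for F
    unfolding A_def using that dyadics_countable
    by (intro has_chain_measurable process_measurable_dyadics) (blast intro: countable_subset)+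
  have bound: "prob (A (dyadic_grid a N)) \<le> \<sigma> * chain_const H e L" for N
  proof -
    define \<tau> where "\<tau> k = a * real k / 2 ^ N" for k :: nat
    have \<tau>: "\<tau> k \<in> {0..a}" if "k \<le> 2 ^ N" for k
      using that dyadic_grid_subset[OF a, of N] by (auto simp: \<tau>_def dyadic_grid_def)
    have \<tau>mono: "k \<le> l \<Longrightarrow> \<tau> k \<le> \<tau> l" for k l using a by (simp add: \<tau>_def divide_right_mono)
    have "strict_mono_on {..2 ^ N} \<tau>"
      using a by (auto simp: strict_mono_on_def \<tau>_def divide_strict_right_mono)
    then have "A (dyadic_grid a N) \<subseteq> {\<omega> \<in> space P. has_chain (\<lambda>k. X (\<tau> k) \<omega>) {..2 ^ N} (6 * e) L}"
      by (auto simp: A_def dyadic_grid_def \<tau>_def[abs_def] dest: has_chain_reindex)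
    then have "prob (A (dyadic_grid a N)) \<le> prob {\<omega> \<in> space P. has_chain (\<lambda>k. X (\<tau> k) \<omega>) {..2 ^ N} (6 * e) L}"
      by (intro finite_measure_mono has_chain_measurable process_measurable \<tau>) auto
    also have "\<dots> \<le> \<sigma> * chain_const H e L"
    proof (rule stable_integral_chain_probability)
      fix k :: nat assume k: "k \<le> 2 ^ N"
      show "g1 (\<tau> k) \<in> borel_measurable m" "g2 (\<tau> k) \<in> borel_measurable m"
        using g1(1) g2(1) \<tau>[OF k] by auto
      show "stable_int (\<lambda>x. g1 (\<tau> k) x - g2 (\<tau> k) x) (X (\<tau> k))" using X \<tau>[OF k] by auto
      fix x assume "x \<in> space m"
      then show "0 \<le> g1 (\<tau> k) x" "0 \<le> g2 (\<tau> k) x" using g1(2) g2(2) \<tau>[OF k] by auto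
    next
      fix x assume x: "x \<in> space m"
      show "mono_on {..2 ^ N} (\<lambda>k. g1 (\<tau> k) x)" "mono_on {..2 ^ N} (\<lambda>k. g2 (\<tau> k) x)"
        using g1(3)[OF x] g2(3)[OF x] \<tau> \<tau>mono by (auto simp: mono_on_def)
    next
      show "(\<integral>\<^sup>+x. ennreal ((g1 (\<tau> (2 ^ N)) x + g2 (\<tau> (2 ^ N)) x) powr \<alpha>) \<partial>m) \<le> ennreal \<sigma>"
        using fin by (simp add: \<tau>_def \<sigma>_def)
    qed (use pos in \<open>auto simp: \<sigma>_def\<close>)
    finally show ?thesis .
  qed
  have "A D = (\<Union>N. A (dyadic_grid a N))"
    unfolding A_def using has_chain_incseq_UN[OF _ incseq_dyadic_grid] by (auto intro: has_chain_subset)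
  moreover have "(\<lambda>N. prob (A (dyadic_grid a N))) \<longlonglongrightarrow> prob (\<Union>N. A (dyadic_grid a N))"
  proof (rule finite_Lim_measure_incseq)
    show "range (\<lambda>N. A (dyadic_grid a N)) \<subseteq> events" using Am by blast
    show "incseq (\<lambda>N. A (dyadic_grid a N))"
      using incseq_dyadic_grid[of a] by (auto simp: incseq_def A_def intro: has_chain_subset)
  qed
  ultimately have "prob (A D) \<le> \<sigma> * chain_const H e L"
    using bound by (auto intro: LIMSEQ_le_const2)
  then show ?thesis by (simp add: A_def \<sigma>_def)
qed

text \<open>
  Chains of every length have probability at most \<open>\<sigma> * chain_const H e L\<close> for all \<open>H\<close> and \<open>L\<close>. The second
  term of \<open>chain_const\<close> disappears as \<open>L\<close> grows with \<open>H\<close> fixed, the first one as \<open>H\<close> grows.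
\<close>

lemma AE_bounded_chains: "AE \<omega> in P. bounded_chains (\<lambda>t. X t \<omega>) D"
proof -
  define \<sigma> where "\<sigma> = enn2real (\<integral>\<^sup>+x. ennreal ((g1 a x + g2 a x) powr \<alpha>) \<partial>m)"
  have "AE \<omega> in P. \<exists>L. \<not> has_chain (\<lambda>t. X t \<omega>) D r L" if r: "0 < r" for r
  proof -
    define e where "e = r / 6"
    have e: "0 < e" "r = 6 * e" using r by (auto simp: e_def)
    define B where "B = {\<omega> \<in> space P. \<forall>L. has_chain (\<lambda>t. X t \<omega>) D r L}"
    have cm: "{\<omega> \<in> space P. has_chain (\<lambda>t. X t \<omega>) D r L} \<in> events" for L
      using dyadics_countable by (intro has_chain_measurable process_measurable_dyadics)
    have Bm: "B \<in> events" unfolding B_def by (intro sets.sets_Collect_countable_All cm)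
    have B1: "prob B \<le> \<sigma> * chain_const H e L" if "0 < H" "0 < L" for H L
    proof -
      have "prob B \<le> prob {\<omega> \<in> space P. has_chain (\<lambda>t. X t \<omega>) D r L}"
        by (intro finite_measure_mono cm) (auto simp: B_def)
      also have "\<dots> \<le> \<sigma> * chain_const H e L"
        unfolding e(2) \<sigma>_def by (rule dyadic_chain_probability[OF e(1) that])
      finally show ?thesis .
    qed
    have B2: "prob B \<le> \<sigma> * (tail_const \<alpha> * H powr (-\<alpha>))" if H: "0 < H" for H
    proof (rule LIMSEQ_le_const)
      have "(\<lambda>L. \<sigma> * (tail_const \<alpha> * H powr (-\<alpha>) + (16 * H powr (2 - \<alpha>) / e\<^sup>2) / real L))
          \<longlonglongrightarrow> \<sigma> * (tail_const \<alpha> * H powr (-\<alpha>) + 0)"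
        by (intro tendsto_intros lim_const_over_n)
      then show "(\<lambda>L. \<sigma> * chain_const H e L) \<longlonglongrightarrow> \<sigma> * (tail_const \<alpha> * H powr (-\<alpha>))"
        by (simp add: chain_const_def)
      show "\<exists>N. \<forall>L\<ge>N. prob B \<le> \<sigma> * chain_const H e L" using B1[OF H] by (intro exI[of _ 1]) auto
    qed
    have "prob B \<le> \<sigma> * (tail_const \<alpha> * 0)"
    proof (rule LIMSEQ_le_const)
      show "(\<lambda>n. \<sigma> * (tail_const \<alpha> * real n powr (-\<alpha>))) \<longlonglongrightarrow> \<sigma> * (tail_const \<alpha> * 0)"
        using alpha_pos by (intro tendsto_intros tendsto_neg_powr filterlim_real_sequentially) auto
      show "\<exists>N. \<forall>n\<ge>N. prob B \<le> \<sigma> * (tail_const \<alpha> * real n powr (-\<alpha>))" using B2 by (intro exI[of _ 1]) auto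
    qed
    then have "B \<in> null_sets P" using Bm by (auto simp: null_sets_def emeasure_eq_measure measure_le_0_iff)
    then show ?thesis by (rule AE_I') (auto simp: B_def)
  qed
  then have "AE \<omega> in P. \<forall>j. \<exists>L. \<not> has_chain (\<lambda>t. X t \<omega>) D (inverse (real (Suc j))) L"
    unfolding AE_all_countable by simp
  then show ?thesis unfolding bounded_chains_countable .
qed

text \<open>
  The increments of the integrand are dominated by \<open>g1 a + g2 a\<close> because of monotonicity, so they tend to
  zero in the sense required by \<open>stable_integral_conv_in_probability\<close>.
\<close>

lemma process_right_continuous_in_probability:
  assumes rc1: "\<And>t x. 0 \<le> t \<Longrightarrow> t < a \<Longrightarrow> x \<in> space m \<Longrightarrow> ((\<lambda>s. g1 s x) \<longlongrightarrow> g1 t x) (at_right t)"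
    and rc2: "\<And>t x. 0 \<le> t \<Longrightarrow> t < a \<Longrightarrow> x \<in> space m \<Longrightarrow> ((\<lambda>s. g2 s x) \<longlongrightarrow> g2 t x) (at_right t)"
    and t: "0 \<le> t" "t < a" and s: "\<And>n. s n \<in> {0..a}" "\<And>n. t < s n" "s \<longlonglongrightarrow> t"
  shows "conv_in_probability P (\<lambda>n. X (s n)) (X t)"
proof (rule stable_integral_conv_in_probability[OF X[OF s(1)] X])
  show ta: "t \<in> {0..a}" using t by simp
  let ?h = "\<lambda>n x. \<bar>(g1 (s n) x - g2 (s n) x) - (g1 t x - g2 t x)\<bar> powr \<alpha>"
  have aa: "a \<in> {0..a}" using a by simp
  note [measurable] = g1(1)[OF s(1)] g2(1)[OF s(1)] g1(1)[OF ta] g2(1)[OF ta] g1(1)[OF aa] g2(1)[OF aa]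
  have sr: "filterlim s (at_right t) sequentially"
    using s by (intro filterlim_at[THEN iffD2] conjI always_eventually) auto
  have "(\<lambda>n. \<integral>\<^sup>+x. ennreal (?h n x) \<partial>m) \<longlonglongrightarrow> (\<integral>\<^sup>+x. 0 \<partial>m)"
  proof (rule nn_integral_dominated_convergence[where w = "\<lambda>x. ennreal ((g1 a x + g2 a x) powr \<alpha>)"])
    show "AE x in m. ennreal (?h n x) \<le> ennreal ((g1 a x + g2 a x) powr \<alpha>)" for n
    proof (intro AE_I2 ennreal_leI powr_mono2)
      fix x assume x: "x \<in> space m"
      have "0 \<le> g1 t x" "0 \<le> g2 t x" using g1(2) g2(2) ta x by auto
      moreover have "g1 t x \<le> g1 (s n) x" "g2 t x \<le> g2 (s n) x" "g1 (s n) x \<le> g1 a x" "g2 (s n) x \<le> g2 a x"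
        using mono_onD[OF g1(3)[OF x]] mono_onD[OF g2(3)[OF x]] ta aa s(1)[of n] s(2)[of n] by auto
      ultimately show "\<bar>(g1 (s n) x - g2 (s n) x) - (g1 t x - g2 t x)\<bar> \<le> g1 a x + g2 a x" by linarith
    qed (use alpha_pos in auto)
    show "AE x in m. (\<lambda>n. ennreal (?h n x)) \<longlonglongrightarrow> 0"
    proof (intro AE_I2)
      fix x assume x: "x \<in> space m"
      have "(\<lambda>n. \<bar>(g1 (s n) x - g2 (s n) x) - (g1 t x - g2 t x)\<bar>) \<longlonglongrightarrow> \<bar>(g1 t x - g2 t x) - (g1 t x - g2 t x)\<bar>"
        by (intro tendsto_intros filterlim_compose[OF rc1[OF t x] sr] filterlim_compose[OF rc2[OF t x] sr])
      then have "(\<lambda>n. ?h n x) \<longlonglongrightarrow> 0 powr \<alpha>"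
        using alpha_pos by (intro tendsto_powr' tendsto_const) auto
      then have "(\<lambda>n. ennreal (?h n x)) \<longlonglongrightarrow> ennreal (0 powr \<alpha>)" by (rule tendsto_ennrealI)
      then show "(\<lambda>n. ennreal (?h n x)) \<longlonglongrightarrow> 0" by simp
    qed
  qed (use fin in measurable)
  then show "(\<lambda>n. \<integral>\<^sup>+x. ennreal (?h n x) \<partial>m) \<longlonglongrightarrow> 0" by simp
qed

text \<open>
  The modification is the right limit along the dyadic points. At the end point \<open>a\<close>, where no time is to
  the right, the original variable is kept; where chains are unbounded the path is set to zero,
  which keeps the modification measurable and all of its paths cadlag.
\<close>

lemma cadlag_modification:
  assumes rc1: "\<And>t x. 0 \<le> t \<Longrightarrow> t < a \<Longrightarrow> x \<in> space m \<Longrightarrow> ((\<lambda>s. g1 s x) \<longlongrightarrow> g1 t x) (at_right t)"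
    and rc2: "\<And>t x. 0 \<le> t \<Longrightarrow> t < a \<Longrightarrow> x \<in> space m \<Longrightarrow> ((\<lambda>s. g2 s x) \<longlongrightarrow> g2 t x) (at_right t)"
  shows "has_cadlag_modification P 0 a X"
proof -
  \<comment> \<open>Sequences that do not depend on \<open>\<omega>\<close>, so that the right limits are limits of random variables.\<close>
  define s where "s t n = (SOME u. u \<in> D \<and> t < u \<and> u < t + inverse (real (Suc n)))" for t and n :: nat
  have s_all: "s t n \<in> D \<and> t < s t n \<and> s t n < t + inverse (real (Suc n))" if t: "0 \<le> t" "t < a" for t n
  proof -
    have "0 < inverse (real (Suc n))" by simp
    then have "\<exists>u. u \<in> D \<and> t < u \<and> u < t + inverse (real (Suc n))"
      using dyadic_grid_dense[OF t, of "inverse (real (Suc n))"] by blast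
    then show ?thesis unfolding s_def by (rule someI_ex)
  qed
  have s: "s t n \<in> D" "t < s t n" "s t n < t + inverse (real (Suc n))" if "0 \<le> t" "t < a" for t n
    using s_all[OF that] by blast+
  have slim: "s t \<longlonglongrightarrow> t" if t: "0 \<le> t" "t < a" for t
  proof (rule tendsto_sandwich[OF _ _ tendsto_const])
    show "\<forall>\<^sub>F n in sequentially. t \<le> s t n" using s(2)[OF t] by (auto intro: always_eventually less_imp_le)
    show "\<forall>\<^sub>F n in sequentially. s t n \<le> t + inverse (real (Suc n))" using s(3)[OF t] by (auto intro: always_eventually less_imp_le)
    show "(\<lambda>n. t + inverse (real (Suc n))) \<longlonglongrightarrow> t" by (rule LIMSEQ_inverse_real_of_nat_add)
  qed
  have sD: "s t n \<in> {0..a}" if "0 \<le> t" "t < a" for t n using s(1)[OF that] dyadics_subset by blast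
  define Y where "Y t \<omega> = (if bounded_chains (\<lambda>t. X t \<omega>) D then (if t < a then lim (\<lambda>n. X (s t n) \<omega>) else X t \<omega>) else 0)" for t \<omega>
  have bm: "{\<omega> \<in> space P. bounded_chains (\<lambda>t. X t \<omega>) D} \<in> events"
    using dyadics_countable by (intro bounded_chains_measurable process_measurable_dyadics)
  have Ym: "Y t \<in> borel_measurable P" if t: "t \<in> {0..a}" for t
  proof -
    have "(\<lambda>\<omega>. if t < a then lim (\<lambda>n. X (s t n) \<omega>) else X t \<omega>) \<in> borel_measurable P"
    proof (cases "t < a")
      case True
      then have [measurable]: "X (s t n) \<in> borel_measurable P" for n
        using t by (intro process_measurable sD) auto
      show ?thesis using True by simp
    qed (use process_measurable[OF t] in simp)
    then show ?thesis unfolding Y_def[abs_def] by (rule measurable_If[OF _ measurable_const bm]) simp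
  qed
  have lims: "\<exists>\<delta>>0. \<forall>u\<in>D. t < u \<and> u < t + \<delta> \<longrightarrow> \<bar>X u \<omega> - Y t \<omega>\<bar> < e"
    and Xlim: "(\<lambda>n. X (s t n) \<omega>) \<longlonglongrightarrow> Y t \<omega>"
    if good: "bounded_chains (\<lambda>t. X t \<omega>) D" and t: "0 \<le> t" "t < a" and e: "0 < e" for \<omega> t e
  proof -
    obtain l where l: "\<And>e. 0 < e \<Longrightarrow> \<exists>\<delta>>0. \<forall>u\<in>D. t < u \<and> u < t + \<delta> \<longrightarrow> \<bar>X u \<omega> - l\<bar> < e"
      using bounded_chains_right_limit[OF good dyadic_grid_dense[OF t]] by blast
    have lim: "(\<lambda>n. X (s t n) \<omega>) \<longlonglongrightarrow> l"
    proof (rule tendstoI)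
      fix r :: real assume "0 < r"
      then obtain \<delta> where \<delta>: "0 < \<delta>" "\<forall>u\<in>D. t < u \<and> u < t + \<delta> \<longrightarrow> \<bar>X u \<omega> - l\<bar> < r" using l by blast
      have "\<forall>\<^sub>F n in sequentially. s t n < t + \<delta>" using slim[OF t] \<delta>(1) by (intro order_tendstoD(2)) auto
      then show "\<forall>\<^sub>F n in sequentially. dist (X (s t n) \<omega>) l < r"
      proof eventually_elim
        case (elim n)
        then show ?case using \<delta>(2) s(1)[OF t, of n] s(2)[OF t, of n] unfolding dist_real_def by blast
      qed
    qed
    then have "Y t \<omega> = l" using good t by (simp add: Y_def limI)
    then show "\<exists>\<delta>>0. \<forall>u\<in>D. t < u \<and> u < t + \<delta> \<longrightarrow> \<bar>X u \<omega> - Y t \<omega>\<bar> < e"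
      and "(\<lambda>n. X (s t n) \<omega>) \<longlonglongrightarrow> Y t \<omega>" using l[OF e] lim by auto
  qed
  have "AE \<omega> in P. X t \<omega> = Y t \<omega>" if t: "t \<in> {0..a}" for t
  proof (cases "t < a")
    case True
    then have ta: "0 \<le> t" "t < a" using t by auto
    have Xsm: "X (s t n) \<in> borel_measurable P" for n using sD[OF ta] by (rule process_measurable)
    have "AE \<omega> in P. (\<lambda>n. X (s t n) \<omega>) \<longlonglongrightarrow> Y t \<omega>"
      using AE_bounded_chains by eventually_elim (rule Xlim[OF _ ta zero_less_one])
    then have "conv_in_probability P (\<lambda>n. X (s t n)) (Y t)"
      by (intro AE_tendsto_imp_conv_in_probability Xsm Ym[OF t])
    moreover have "conv_in_probability P (\<lambda>n. X (s t n)) (X t)"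
      by (rule process_right_continuous_in_probability[OF rc1 rc2 ta sD[OF ta] s(2)[OF ta] slim[OF ta]])
    ultimately show ?thesis
      by (intro conv_in_probability_unique[OF Xsm process_measurable[OF t] Ym[OF t]])
  next
    case False
    show ?thesis using AE_bounded_chains by eventually_elim (use False in \<open>simp add: Y_def\<close>)
  qed
  moreover have "cadlag_on 0 a (\<lambda>t. Y t \<omega>)" for \<omega>
  proof (cases "bounded_chains (\<lambda>t. X t \<omega>) D")
    case True
    show ?thesis
      by (rule cadlag_on_right_limits[OF True dyadic_grid_dense lims[OF True]])
  next
    case False
    then show ?thesis by (auto simp: Y_def cadlag_on_def)
  qed
  ultimately show ?thesis
    unfolding has_cadlag_modification_def is_modification_def using Ym by (intro exI[of _ Y]) auto
qed

end

end

theorem theorem5p1: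
  fixes P :: "'w measure" and m :: "'e measure"
    and M :: "'e set \<Rightarrow> 'w \<Rightarrow> real"
    and \<alpha> a :: real
    and f f1 f2 :: "real \<Rightarrow> 'e \<Rightarrow> real"
    and N :: "'e set"
    and X :: "real \<Rightarrow> 'w \<Rightarrow> real"
  assumes "prob_space P"
    and "0 < \<alpha>" and "\<alpha> < 2"
    and "sigma_finite_measure m"
    and "sas_random_measure P \<alpha> m M"
    and "0 < a"
    and "\<And>t x. t \<in> {0..a} \<Longrightarrow> x \<in> space m \<Longrightarrow> f t x = f1 t x - f2 t x"
    and "\<And>t x. t \<in> {0..a} \<Longrightarrow> x \<in> space m \<Longrightarrow> 0 \<le> f1 t x"
    and "\<And>t x. t \<in> {0..a} \<Longrightarrow> x \<in> space m \<Longrightarrow> 0 \<le> f2 t x"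
    and "(\<lambda>(t, x). f1 t x) \<in> borel_measurable (restrict_space borel {0..a} \<Otimes>\<^sub>M m)"
    and "(\<lambda>(t, x). f2 t x) \<in> borel_measurable (restrict_space borel {0..a} \<Otimes>\<^sub>M m)"
    and "N \<in> sets m" and "emeasure m N = 0"
    and "\<And>x. x \<in> space m - N \<Longrightarrow> cadlag_on 0 a (\<lambda>t. f1 t x) \<and> mono_on {0..a} (\<lambda>t. f1 t x)"
    and "\<And>x. x \<in> space m - N \<Longrightarrow> cadlag_on 0 a (\<lambda>t. f2 t x) \<and> mono_on {0..a} (\<lambda>t. f2 t x)"
    and "(\<integral>\<^sup>+x. ennreal (\<bar>f1 a x\<bar> powr \<alpha>) \<partial>m) < \<infinity>"
    and "(\<integral>\<^sup>+x. ennreal (\<bar>f2 a x\<bar> powr \<alpha>) \<partial>m) < \<infinity>"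
    and "\<And>t. t \<in> {0..a} \<Longrightarrow> X t = stable_integral P \<alpha> m M (f t)"
  shows "has_cadlag_modification P 0 a X"
proof -
  interpret prob_space P by fact
  interpret stable_measure P \<alpha> m M by unfold_locales fact+
  note [measurable] = \<open>N \<in> sets m\<close>
  have aa: "a \<in> {0..a}" using \<open>0 < a\<close> by simp
  have sec: "h t \<in> borel_measurable m"
    if "(\<lambda>(t, x). h t x) \<in> borel_measurable (restrict_space borel {0..a} \<Otimes>\<^sub>M m)" "t \<in> {0..a}"
    for h :: "real \<Rightarrow> 'e \<Rightarrow> real" and t
    using measurable_compose[OF measurable_Pair1'[of t "restrict_space borel {0..a}" m] that(1)] that(2)
    by (simp add: space_restrict_space)
  note f1m = sec[OF assms(10)] and f2m = sec[OF assms(11)]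
  \<comment> \<open>Set to zero on \<open>N\<close>, the integrands are monotone and right-continuous for every \<open>x\<close>.\<close>
  define g1 where "g1 t x = (if x \<in> N then 0 else f1 t x)" for t x
  define g2 where "g2 t x = (if x \<in> N then 0 else f2 t x)" for t x
  have g1m: "g1 t \<in> borel_measurable m" if "t \<in> {0..a}" for t
    using f1m[OF that] unfolding g1_def[abs_def] by measurable
  have g2m: "g2 t \<in> borel_measurable m" if "t \<in> {0..a}" for t
    using f2m[OF that] unfolding g2_def[abs_def] by measurable
  have g1nn: "0 \<le> g1 t x" and g2nn: "0 \<le> g2 t x" if "t \<in> {0..a}" "x \<in> space m" for t x
    using assms(8,9) that by (auto simp: g1_def g2_def)
  have g1mono: "mono_on {0..a} (\<lambda>t. g1 t x)" and g2mono: "mono_on {0..a} (\<lambda>t. g2 t x)" if "x \<in> space m" for x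
    using assms(14)[of x] assms(15)[of x] that by (auto simp: g1_def g2_def mono_on_def)
  have rc: "((\<lambda>s. g1 s x) \<longlongrightarrow> g1 t x) (at_right t)" "((\<lambda>s. g2 s x) \<longlongrightarrow> g2 t x) (at_right t)"
    if "0 \<le> t" "t < a" "x \<in> space m" for t x
    using assms(14)[of x] assms(15)[of x] that by (auto simp: g1_def g2_def cadlag_on_def)
  have fin: "(\<integral>\<^sup>+x. ennreal ((g1 a x + g2 a x) powr \<alpha>) \<partial>m) < \<infinity>"
  proof -
    have "(\<integral>\<^sup>+x. ennreal ((g1 a x + g2 a x) powr \<alpha>) \<partial>m) \<le> (\<integral>\<^sup>+x. ennreal (\<bar>f1 a x + f2 a x + 0\<bar> powr \<alpha>) \<partial>m)"
      using assms(8,9)[OF aa] \<open>0 < \<alpha>\<close>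
      by (intro nn_integral_mono ennreal_leI powr_mono2) (auto simp: g1_def g2_def)
    also have "\<dots> \<le> ennreal (3 powr \<alpha>) * ((\<integral>\<^sup>+x. ennreal (\<bar>f1 a x\<bar> powr \<alpha>) \<partial>m)
        + (\<integral>\<^sup>+x. ennreal (\<bar>f2 a x\<bar> powr \<alpha>) \<partial>m) + (\<integral>\<^sup>+x. ennreal (\<bar>0\<bar> powr \<alpha>) \<partial>m))"
      by (rule nn_integral_powr_sum3_le[OF f1m[OF aa] f2m[OF aa] _ \<open>0 < \<alpha>\<close>]) simp
    also have "\<dots> < \<infinity>" using assms(16,17) by (simp add: ennreal_mult_less_top)
    finally show ?thesis .
  qed
  have X: "stable_int (\<lambda>x. g1 t x - g2 t x) (X t)" if t: "t \<in> {0..a}" for t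
  proof -
    have fm: "f t \<in> borel_measurable m"
      using f1m[OF t] f2m[OF t] assms(7)[OF t] by (subst measurable_cong[of m _ "\<lambda>x. f1 t x - f2 t x"]) auto
    have "AE x in m. x \<notin> N" using assms(12,13) by (intro AE_not_in) (simp add: null_sets_def)
    then have ae: "AE x in m. g1 t x - g2 t x = f t x"
      using AE_space by eventually_elim (simp add: g1_def g2_def assms(7)[OF t])
    have "(\<integral>\<^sup>+x. ennreal ((g1 t x + g2 t x) powr \<alpha>) \<partial>m) \<le> (\<integral>\<^sup>+x. ennreal ((g1 a x + g2 a x) powr \<alpha>) \<partial>m)"
    proof (intro nn_integral_mono ennreal_leI powr_mono2)
      fix x assume x: "x \<in> space m"
      show "0 \<le> g1 t x + g2 t x" using g1nn[OF t x] g2nn[OF t x] by simp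
      show "g1 t x + g2 t x \<le> g1 a x + g2 a x"
        using mono_onD[OF g1mono[OF x] t aa] mono_onD[OF g2mono[OF x] t aa] t by simp
    qed (use \<open>0 < \<alpha>\<close> in simp)
    also note fin
    finally obtain Y where "stable_int (\<lambda>x. g1 t x - g2 t x) Y"
      using stable_integral_exists[OF g1m[OF t] g2m[OF t] g1nn[OF t] g2nn[OF t]] by blast
    then have "stable_int (f t) Y" by (rule stable_integral_AE_cong[OF _ ae fm])
    then have "stable_int (f t) (X t)"
      unfolding assms(18)[OF t] stable_integral_def by (rule someI[of "stable_int (f t)"])
    moreover have "AE x in m. f t x = g1 t x - g2 t x" using ae by eventually_elim simp
    moreover have "(\<lambda>x. g1 t x - g2 t x) \<in> borel_measurable m"
      using g1m[OF t] g2m[OF t] by (rule borel_measurable_diff)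
    ultimately show ?thesis by (rule stable_integral_AE_cong)
  qed
  show ?thesis
    by (rule cadlag_modification[OF \<open>0 < a\<close> g1m g1nn g1mono g2m g2nn g2mono fin X rc])
qed

end
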